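(* Let $\lambda\in\mathbb{R}$, $\alpha,\beta\in\mathbb{R}_{>0}$ and $\rho,\sigma\in\mathbb{R}_{\ge3}$. Put $$(a,b,c,d)=(1+\rho+\sigma,\;1-\rho+\sigma,\;1+\alpha+\rho-\beta-\sigma,\;1-\alpha-\rho-\beta-\sigma),$$ $$(\widetilde a,\widetilde b,\widetilde c,\widetilde d)=(1-\beta,\;1+\beta+2\sigma,\;1+\alpha+2\rho,\;1-\alpha).$$ Then the function $\mathcal{F}_\lambda(x)=\mathcal{F}_\lambda(x;a,b,c,d)$ defined in the context (by an integral over the unit circle) can be expressed in terms of basic hypergeometric series as $$\mathcal{F}_\lambda(x)=C\,\frac{\bigl(q^{2+a-\widetilde d+2i\lambda+x},q^{2+a-\widetilde d+2i\lambda-x};q^2\bigr)_\infty}{\bigl(q^{2-d+x},q^{2-d-x};q^2\bigr)_\infty}\;{}_8W_7\bigl(q^{-2+\widetilde a+\widetilde b+\widetilde c+2i\lambda};q^{a+x},q^{a-x},q^{\widetilde a+2i\lambda},q^{\widetilde b+2i\lambda},q^{\widetilde c+2i\lambda};q^2,q^{2-\widetilde d-2i\lambda}\bigr)$$ with the generically nonzero, $x$-independent constant $C$ given by $$C=\frac{\bigl(q^{2+2\sigma},q^{2+\alpha+2\rho-\beta},q^{2+\alpha+2\rho+\beta+2\sigma},q^{1+\beta+2i\lambda},q^{1+\alpha-2i\lambda};q^2\bigr)_\infty}{\bigl(q^2,q^{1+\alpha+2i\lambda},q^{1+\alpha+2\rho+2i\lambda},q^{1+\beta+2\sigma-2i\lambda},q^{3+\alpha+2\rho+2\sigma+2i\lambda};q^2\bigr)_\infty}.$$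 Furthermore, $\mathcal{F}_\lambda(x)$ is $\tau^{-1}$-periodic and satisfies the Askey-Wilson difference equation $$A(x)\bigl(\mathcal{F}_\lambda(x+2)-\mathcal{F}_\lambda(x)\bigr)+A(-x)\bigl(\mathcal{F}_\lambda(x-2)-\mathcal{F}_\lambda(x)\bigr)=E(\lambda)\mathcal{F}_\lambda(x)$$ for generic $x\in i\mathbb{R}$, where $$A(x)=\frac{(1-q^{a+x})(1-q^{b+x})(1-q^{c+x})(1-q^{d+x})}{(1-q^{2x})(1-q^{2+2x})},\qquad E(\lambda)=-1-q^{2-2\beta}+q^{1-\beta}(q^{2i\lambda}+q^{-2i\lambda}).$$
   Context: Here $\tau\in i\mathbb{R}_{>0}$, $q=\exp(2\pi i\tau)\in(0,1)$, $q^u=\exp(2\pi i\tau u)$ for $u\in\mathbb{C}$. For $n\in\mathbb{Z}_{\ge0}\cup\{\infty\}$: $(b;q)_n=\prod_{j=0}^{n-1}(1-bq^j)$ and $(b_1,\dots,b_m;q)_n=\prod_{j=1}^m(b_j;q)_n$ (and similarly with base $q^2$ in place of $q$). The function $\mathcal{F}_\lambda$ is defined by $$\mathcal{F}_\lambda(x)=\frac{\bigl(q^{1+\rho+\sigma-x},q^{1-\rho+\sigma-x};q^2\bigr)_\infty}{\bigl(q^{1-\alpha-\rho+\beta+\sigma-x},q^{1+\alpha+\rho+\beta+\sigma-x};q^2\bigr)_\infty}\cdot\frac1{2\pi i}\int_{\mathbb{T}}I_x(z)\,\frac{dz}{z},$$ $$I_x(z)=\frac{\bigl(q^{1+\beta+\sigma+i\lambda-x}/z,\;q^{1+\alpha+\rho-\beta-i\lambda}/z;q^2\bigr)_\infty}{\bigl(q^{1-\rho+i\lambda}z,\;q^{1+\rho+i\lambda}z;q^2\bigr)_\infty}\cdot\frac{\bigl(q^{1-\alpha-\rho+\beta+i\lambda}z,\;q^{2+\sigma+i\lambda+x}z,\;q^{2+\alpha+\rho-i\lambda}z;q^2\bigr)_\infty}{\bigl(q^{\alpha+\rho+i\lambda}/z,\;q^{\sigma-i\lambda-x}/z,\;q^{1+\beta+\sigma-i\lambda+x}z;q^2\bigr)_\infty},$$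 where $\mathbb{T}=\{z\in\mathbb{C}\mid |z|=1\}$ is the positively oriented unit circle. The very-well-poised series is, for $|z|<1$, $${}_8W_7(u;b_1,b_2,b_3,b_4,b_5;q,z)=\sum_{k=0}^\infty\frac{(1-uq^{2k})\,(u,b_1,b_2,b_3,b_4,b_5;q)_k\,z^k}{(1-u)\,(q,qu/b_1,qu/b_2,qu/b_3,qu/b_4,qu/b_5;q)_k};$$ in the claim it is used with base $q^2$, i.e. with $q$ replaced by $q^2$ everywhere in this formula.
   Formalization: The unit circle is replaced by a closed contour enclosing 0 and the poles of the factors in 1/z but not those of the factors in z: for ρ≥3 poles of 1/(q^{1-ρ+iλ}z;q²)_∞ lie inside the circle, and on it for ρ=3, where the integral diverges. *)

theory Defs
  imports "HOL-Complex_Analysis.Complex_Analysis"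
begin

definition qpow :: "complex \<Rightarrow> complex \<Rightarrow> complex" where
  "qpow \<tau> u = exp (2 * of_real pi * \<i> * \<tau> * u)"

definition qpoch :: "complex list \<Rightarrow> complex \<Rightarrow> nat \<Rightarrow> complex" where
  "qpoch bs p n = (\<Prod>b\<leftarrow>bs. \<Prod>j<n. 1 - b * p ^ j)"

definition qpoch_inf :: "complex list \<Rightarrow> complex \<Rightarrow> complex" where
  "qpoch_inf bs p = (\<Prod>b\<leftarrow>bs. \<Prod>j. 1 - b * p ^ j)"

definition W87 :: "complex \<Rightarrow> complex \<Rightarrow> complex \<Rightarrow> complex \<Rightarrow> complex \<Rightarrow> complex
    \<Rightarrow> complex \<Rightarrow> complex \<Rightarrow> complex" where
  "W87 u b1 b2 b3 b4 b5 p z =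
     (\<Sum>k. (1 - u * p ^ (2 * k)) * qpoch [u, b1, b2, b3, b4, b5] p k * z ^ k /
          ((1 - u) * qpoch [p, p * u / b1, p * u / b2, p * u / b3, p * u / b4, p * u / b5] p k))"

text \<open>All parameters of the following functions are complex; the theorem instantiates
  them by reals.\<close>

definition F_integrand :: "complex \<Rightarrow> complex \<Rightarrow> complex \<Rightarrow> complex \<Rightarrow> complex \<Rightarrow> complex
    \<Rightarrow> complex \<Rightarrow> complex \<Rightarrow> complex" where
  "F_integrand \<tau> lam \<alpha> \<beta> \<rho> \<sigma> x z =
     qpoch_inf [qpow \<tau> (1 + \<beta> + \<sigma> + \<i> * lam - x) / z,
                qpow \<tau> (1 + \<alpha> + \<rho> - \<beta> - \<i> * lam) / z] (qpow \<tau> 2) /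
     qpoch_inf [qpow \<tau> (1 - \<rho> + \<i> * lam) * z,
                qpow \<tau> (1 + \<rho> + \<i> * lam) * z] (qpow \<tau> 2) *
     (qpoch_inf [qpow \<tau> (1 - \<alpha> - \<rho> + \<beta> + \<i> * lam) * z,
                 qpow \<tau> (2 + \<sigma> + \<i> * lam + x) * z,
                 qpow \<tau> (2 + \<alpha> + \<rho> - \<i> * lam) * z] (qpow \<tau> 2) /
      qpoch_inf [qpow \<tau> (\<alpha> + \<rho> + \<i> * lam) / z,
                 qpow \<tau> (\<sigma> - \<i> * lam - x) / z,
                 qpow \<tau> (1 + \<beta> + \<sigma> - \<i> * lam + x) * z] (qpow \<tau> 2))"

text \<open>The zeros of the denominator of the integrand fall into a family accumulating at
  0 (from the factors in \<open>1/z\<close>) and one accumulating at infinity (from the factors in \<open>z\<close>).\<close>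

definition inner_poles :: "complex \<Rightarrow> complex \<Rightarrow> complex \<Rightarrow> complex \<Rightarrow> complex \<Rightarrow> complex
    \<Rightarrow> complex set" where
  "inner_poles \<tau> lam \<alpha> \<rho> \<sigma> x =
     (\<Union>e \<in> {\<alpha> + \<rho> + \<i> * lam, \<sigma> - \<i> * lam - x}. range (\<lambda>j::nat. qpow \<tau> (e + 2 * of_nat j)))"

definition outer_poles :: "complex \<Rightarrow> complex \<Rightarrow> complex \<Rightarrow> complex \<Rightarrow> complex \<Rightarrow> complex
    \<Rightarrow> complex set" where
  "outer_poles \<tau> lam \<beta> \<rho> \<sigma> x =
     (\<Union>e \<in> {1 - \<rho> + \<i> * lam, 1 + \<rho> + \<i> * lam, 1 + \<beta> + \<sigma> - \<i> * lam + x}.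
        range (\<lambda>j::nat. qpow \<tau> (- e - 2 * of_nat j)))"

definition separates :: "complex set \<Rightarrow> complex set \<Rightarrow> (real \<Rightarrow> complex) \<Rightarrow> bool" where
  "separates P Q \<gamma> \<longleftrightarrow> valid_path \<gamma> \<and> pathfinish \<gamma> = pathstart \<gamma> \<and>
     path_image \<gamma> \<inter> insert 0 (P \<union> Q) = {} \<and>
     (\<forall>w \<in> insert 0 P. winding_number \<gamma> w = 1) \<and> (\<forall>w \<in> Q. winding_number \<gamma> w = 0)"

text \<open>The contour of the integral is the positively oriented unit circle, deformed so that
  it encloses 0 and the inner poles and leaves out the outer poles.  The deformation cannot
  be omitted when \<open>\<rho> \<ge> 1\<close>: the outer poles \<open>q\<^bsup>\<rho>-1-i lam-2j\<^esup>\<close>, of modulus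
  \<open>q\<^bsup>\<rho>-1-2j\<^esup>\<close>, then lie in the closed unit disc for \<open>2j \<le> \<rho> - 1\<close>, even on
  the circle itself when \<open>\<rho>\<close> is an odd integer.  By Cauchy's theorem the integral does not
  depend on the choice of the separating contour; the unit circle is one whenever
  \<open>-\<alpha> < \<rho> < 1\<close> and \<open>-1-\<beta>-\<sigma> < Re x < \<sigma>\<close> (proved below).\<close>

definition F_contour :: "complex \<Rightarrow> complex \<Rightarrow> complex \<Rightarrow> complex \<Rightarrow> complex \<Rightarrow> complex
    \<Rightarrow> complex \<Rightarrow> real \<Rightarrow> complex" where
  "F_contour \<tau> lam \<alpha> \<beta> \<rho> \<sigma> x =
     (SOME \<gamma>. separates (inner_poles \<tau> lam \<alpha> \<rho> \<sigma> x) (outer_poles \<tau> lam \<beta> \<rho> \<sigma> x) \<gamma>)"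

definition F_fun :: "complex \<Rightarrow> complex \<Rightarrow> complex \<Rightarrow> complex \<Rightarrow> complex \<Rightarrow> complex
    \<Rightarrow> complex \<Rightarrow> complex" where
  "F_fun \<tau> lam \<alpha> \<beta> \<rho> \<sigma> x =
     qpoch_inf [qpow \<tau> (1 + \<rho> + \<sigma> - x), qpow \<tau> (1 - \<rho> + \<sigma> - x)] (qpow \<tau> 2) /
     qpoch_inf [qpow \<tau> (1 - \<alpha> - \<rho> + \<beta> + \<sigma> - x),
                qpow \<tau> (1 + \<alpha> + \<rho> + \<beta> + \<sigma> - x)] (qpow \<tau> 2) *
     (1 / (2 * of_real pi * \<i>) *
      contour_integral (F_contour \<tau> lam \<alpha> \<beta> \<rho> \<sigma> x) (\<lambda>z. F_integrand \<tau> lam \<alpha> \<beta> \<rho> \<sigma> x z / z))"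

text \<open>The points \<open>x\<close> at which the defining expression of \<open>F_fun\<close> makes sense: the two
  families of poles are disjoint and the denominator of the prefactor does not vanish.\<close>

definition F_regular :: "complex \<Rightarrow> complex \<Rightarrow> complex \<Rightarrow> complex \<Rightarrow> complex \<Rightarrow> complex
    \<Rightarrow> complex \<Rightarrow> bool" where
  "F_regular \<tau> lam \<alpha> \<beta> \<rho> \<sigma> x \<longleftrightarrow>
     inner_poles \<tau> lam \<alpha> \<rho> \<sigma> x \<inter> outer_poles \<tau> lam \<beta> \<rho> \<sigma> x = {} \<and>
     qpoch_inf [qpow \<tau> (1 - \<alpha> - \<rho> + \<beta> + \<sigma> - x),
                qpow \<tau> (1 + \<alpha> + \<rho> + \<beta> + \<sigma> - x)] (qpow \<tau> 2) \<noteq> 0"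

definition C_const :: "complex \<Rightarrow> complex \<Rightarrow> complex \<Rightarrow> complex \<Rightarrow> complex \<Rightarrow> complex \<Rightarrow> complex"
  where
  "C_const \<tau> lam \<alpha> \<beta> \<rho> \<sigma> =
     qpoch_inf [qpow \<tau> (2 + 2 * \<sigma>), qpow \<tau> (2 + \<alpha> + 2 * \<rho> - \<beta>),
                qpow \<tau> (2 + \<alpha> + 2 * \<rho> + \<beta> + 2 * \<sigma>), qpow \<tau> (1 + \<beta> + 2 * \<i> * lam),
                qpow \<tau> (1 + \<alpha> - 2 * \<i> * lam)] (qpow \<tau> 2) /
     qpoch_inf [qpow \<tau> 2, qpow \<tau> (1 + \<alpha> + 2 * \<i> * lam),
                qpow \<tau> (1 + \<alpha> + 2 * \<rho> + 2 * \<i> * lam),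
                qpow \<tau> (1 + \<beta> + 2 * \<sigma> - 2 * \<i> * lam),
                qpow \<tau> (3 + \<alpha> + 2 * \<rho> + 2 * \<sigma> + 2 * \<i> * lam)] (qpow \<tau> 2)"

definition AW_coeff :: "complex \<Rightarrow> complex \<Rightarrow> complex \<Rightarrow> complex \<Rightarrow> complex \<Rightarrow> complex \<Rightarrow> complex"
  where
  "AW_coeff \<tau> a b c d x =
     (1 - qpow \<tau> (a + x)) * (1 - qpow \<tau> (b + x)) * (1 - qpow \<tau> (c + x)) * (1 - qpow \<tau> (d + x)) /
     ((1 - qpow \<tau> (2 * x)) * (1 - qpow \<tau> (2 + 2 * x)))"

definition AW_eigenvalue :: "complex \<Rightarrow> complex \<Rightarrow> complex \<Rightarrow> complex" where
  "AW_eigenvalue \<tau> \<beta> lam =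
     - 1 - qpow \<tau> (2 - 2 * \<beta>) +
     qpow \<tau> (1 - \<beta>) * (qpow \<tau> (2 * \<i> * lam) + qpow \<tau> (- 2 * \<i> * lam))"

lemma norm_qpow:
  assumes "Re \<tau> = 0"
  shows "norm (qpow \<tau> u) = exp (- (2 * pi * Im \<tau> * Re u))"
  using assms by (simp add: qpow_def)

lemma unit_circle_separates:
  fixes lam \<alpha> \<beta> \<rho> \<sigma> :: real
  assumes "Re \<tau> = 0" and "Im \<tau> > 0" and "- \<alpha> < \<rho>" and "- 1 < \<rho>" and "\<rho> < 1"
    and "- 1 - \<beta> - \<sigma> < Re x" and "Re x < \<sigma>"
  shows "separates (inner_poles \<tau> lam \<alpha> \<rho> \<sigma> x) (outer_poles \<tau> lam \<beta> \<rho> \<sigma> x) (circlepath 0 1)"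
proof -
  have inner: "norm w < 1" if "w \<in> insert 0 (inner_poles \<tau> lam \<alpha> \<rho> \<sigma> x)" for w
    using that assms by (auto simp: inner_poles_def norm_qpow intro!: mult_pos_pos)
  have outer: "norm w > 1" if "w \<in> outer_poles \<tau> lam \<beta> \<rho> \<sigma> x" for w
    using that assms by (auto simp: outer_poles_def norm_qpow intro!: mult_pos_neg)
  have "winding_number (circlepath 0 1) w = 0" if "norm w > 1" for w :: complex
    using that by (intro winding_number_zero_outside[of _ "cball 0 1"]) auto
  moreover have "winding_number (circlepath 0 1) w = 1" if "norm w < 1" for w :: complex
    using that by (intro winding_number_circlepath) auto
  ultimately show ?thesis
    unfolding separates_def using inner outer by (fastforce simp: dist_norm)
qed

end

theory Submission
  imports Defs
begin

text \<open>Vary only the parameter \<open>c = q ^ (sigma - i lam - x)\<close> of the integrand.  Up to infinite products,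
  both the contour integral and the 8W7 series are holomorphic in \<open>c\<close>, so by the identity theorem
  it suffices to compare them at a sequence of points tending to the interior point \<open>0\<close>.  At the
  points \<open>c = A2 * p ^ n\<close>, with \<open>p = q\<^sup>2\<close> and \<open>A2 = q ^ (1 + alpha + rho - beta - i lam)\<close>, only finitely many
  poles remain inside the contour, and the integral is a terminating balanced 4phi3 series, to
  which the transformation of Sears applies.  At the same points the Saalschuetz formula expands
  the general term of the 8W7 series, and summing the resulting 6phi5 series gives the same
  terminating sum.

  The difference equation follows by telescoping: applied to the \<open>k\<close>-th term of the series, the
  Askey--Wilson operator minus its eigenvalue is a difference \<open>G k - G (k - 1)\<close>, where \<open>G\<close> tends to \<open>0\<close>.

  The constant \<open>C\<close> vanishes only if \<open>beta - alpha - 2 rho\<close> is a positive even integer.\<close>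

section \<open>Shifted factorials\<close>

text \<open>The parameters \<open>B2\<close> and \<open>D3\<close> also contain q^x, yet they stay
  fixed while \<open>c\<close> moves: the formula is proved for seven independent parameters besides
  the base, so continuation in one variable is enough. The choice of special points comes from the
  quotients (A2/z)_inf / (c/z)_inf and (p C1 c/(A2 z))_inf / (C1/z)_inf in the integrand: for c = A2
  p^n both become finite products.

  A second obstacle is degenerate parameters. Denominator parameters of the 8W7 series can hit a
  pole of a term; for q^(2+alpha+2rho-beta) the constant C vanishes at the same time, and C times
  the series has no direct meaning, while the difference equation is claimed there too. Therefore
  the identities are stated with the infinite products multiplied in: (v p^k; p)_inf stands for (v;
  p)_inf / (v; p)_k. This also makes the terms holomorphic in \<open>c\<close>. The 6phi5 sum brings
  further size conditions, which hold only for small \<open>c\<close>; continuation removes them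
  again.\<close>

definition qfac :: "complex \<Rightarrow> complex \<Rightarrow> nat \<Rightarrow> complex" where
  "qfac p b n = (\<Prod>j<n. 1 - b * p ^ j)"

definition qinf :: "complex \<Rightarrow> complex \<Rightarrow> complex" where
  "qinf p b = (\<Prod>j. 1 - b * p ^ j)"

lemma qfac_0 [simp]: "qfac p b 0 = 1"
  by (simp add: qfac_def)

lemma qfac_Suc: "qfac p b (Suc n) = qfac p b n * (1 - b * p ^ n)"
  by (simp add: qfac_def)

lemma qfac_add: "qfac p b (m + n) = qfac p b m * qfac p (b * p ^ m) n"
  by (induction n) (simp_all add: qfac_Suc power_add mult_ac)

lemma qfac_Suc': "qfac p b (Suc n) = (1 - b) * qfac p (b * p) n"
  using qfac_add[of p b 1 n] by (simp add: qfac_def)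

lemma qfac_eq_0_iff: "qfac p b n = 0 \<longleftrightarrow> (\<exists>j<n. b * p ^ j = 1)"
  by (auto simp: qfac_def)

lemma qfac_self_nonzero:
  assumes "norm p < 1"
  shows "qfac p p n \<noteq> 0"
proof -
  have "p * p ^ j \<noteq> 1" for j
    using power_less_one_iff[of "norm p" "Suc j"] assms
    by (metis norm_ge_zero norm_one norm_power order_less_irrefl power_Suc zero_less_Suc)
  then show ?thesis
    by (auto simp: qfac_eq_0_iff)
qed

text \<open>The summand identity that telescopes in \<open>saalschuetz\<close>, after division by
  the common factor and multiplication by 1 - \<open>I\<close>: there \<open>J\<close> is p^j and
  \<open>I\<close> is p^(k+1-j).\<close>

lemma saalschuetz_step:
  fixes I J \<alpha> \<beta> w s :: complex
  assumes "s = \<alpha> * \<beta> * w"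
  shows "(1 - J * I) * (1 - w) * (1 - s * J) - (1 - \<alpha> * w) * (1 - \<beta> * w) * J * (1 - I) =
    (1 - J) * (1 - w * I) * (1 - s * J) - (1 - I) * w * (1 - \<alpha> * J) * (1 - \<beta> * J)"
  unfolding assms by (simp add: algebra_simps)

lemma fraction_step:
  fixes D :: complex
  assumes "D \<noteq> 0" "K * a - c * P * D = b - D * e"
  shows "K * (X * a / D) - c * (X * P) = X * b / D - X * e"
proof -
  have "K * (X * a / D) - c * (X * P) = X * (K * a - c * P * D) / D"
    using assms(1) by (simp add: field_simps)
  also have "\<dots> = X * b / D - X * e"
    using assms(1) unfolding assms(2) by (simp add: field_simps)
  finally show ?thesis .
qed

text \<open>Multiplied through by every denominator that depends on the parameters, so that no
  genericity assumption is needed.\<close>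

lemma saalschuetz:
  assumes p: "norm p < 1"
  shows "qfac p (\<alpha> * w) k * qfac p (\<beta> * w) k / qfac p p k =
    (\<Sum>j\<le>k. qfac p \<alpha> j * qfac p \<beta> j * w ^ j * qfac p w (k - j) *
       qfac p (\<alpha> * \<beta> * w * p ^ j) (k - j) / (qfac p p j * qfac p p (k - j)))"
proof (induction k arbitrary: w)
  case 0
  show ?case by simp
next
  case (Suc k)
  define s where "s = \<alpha> * \<beta> * w"
  define T where "T = (\<lambda>j. qfac p \<alpha> j * qfac p \<beta> j * w ^ j * qfac p w (Suc k - j) *
       qfac p (s * p ^ j) (Suc k - j) / (qfac p p j * qfac p p (Suc k - j)))"
  define T' where "T' = (\<lambda>j. qfac p \<alpha> j * qfac p \<beta> j * (w * p) ^ j * qfac p (w * p) (k - j) *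
       qfac p (\<alpha> * \<beta> * (w * p) * p ^ j) (k - j) / (qfac p p j * qfac p p (k - j)))"
  \<comment> \<open>Certificate of the recurrence that carries the induction: 1 - p^(k+1) times the
    sum for (k+1, w) is (1 - alpha w)(1 - beta w) times the sum for (k, w p), which is why
    \<open>w\<close> stays arbitrary. \<open>g\<close> vanishes at 0, and \<open>g (Suc k)\<close>
    supplies the term j = k+1, which has no partner in \<open>T'\<close>.\<close>
  define g where "g = (\<lambda>j. (1 - p ^ j) * (qfac p \<alpha> j * qfac p \<beta> j * w ^ j *
       qfac p (w * p) (Suc k - j) * qfac p (s * p ^ j) (Suc k - j) /
       (qfac p p j * qfac p p (Suc k - j))))"
  have nz: "qfac p p n \<noteq> 0" for n
    by (rule qfac_self_nonzero[OF p])
  have nz': "1 - p * p ^ n \<noteq> 0" for n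
    using nz[of "Suc n"] by (simp add: qfac_Suc)
  have step: "(1 - p ^ Suc k) * T j - (1 - \<alpha> * w) * (1 - \<beta> * w) * T' j = g j - g (Suc j)"
    if jk: "j \<le> k" for j
  proof -
    obtain i where k: "k = j + i" using le_Suc_ex[OF jk] by blast
    define A B W S Q Q' P I where "A = qfac p \<alpha> j" and "B = qfac p \<beta> j"
      and "W = qfac p (w * p) i" and "S = qfac p (s * p ^ Suc j) i"
      and "Q = qfac p p j" and "Q' = qfac p p i" and "P = p ^ j" and "I = p * p ^ i"
    define X where "X = A * B * w ^ j * W * S / (Q * Q')"
    have d: "Suc k - j = Suc i" "k - j = i" "Suc k - Suc j = i"
      by (simp_all add: k)
    have e: "qfac p w (Suc i) = (1 - w) * W" "qfac p (s * P) (Suc i) = (1 - s * P) * S"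
      "qfac p p (Suc i) = Q' * (1 - I)" "qfac p (w * p) (Suc i) = W * (1 - w * I)"
      "qfac p \<alpha> (Suc j) = A * (1 - \<alpha> * P)" "qfac p \<beta> (Suc j) = B * (1 - \<beta> * P)"
      "qfac p p (Suc j) = Q * (1 - p * P)" "qfac p (s * p ^ Suc j) i = S"
      "qfac p (\<alpha> * \<beta> * (w * p) * P) i = S"
      using qfac_Suc'[of p "s * P" i] qfac_Suc[of p "w * p" i]
      by (simp_all only: qfac_Suc'[of p w] qfac_Suc[of p p]
          qfac_Suc[of p \<alpha>] qfac_Suc[of p \<beta>] A_def B_def W_def S_def Q_def Q'_def P_def I_def s_def
          power_Suc mult_ac)
    have I: "1 - I \<noteq> 0" using nz' by (simp add: I_def)
    have P: "1 - p * P \<noteq> 0" using nz' by (simp add: P_def)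
    have "T j = X * (1 - w) * (1 - s * P) / (1 - I)"
      unfolding T_def d P_def[symmetric] e A_def[symmetric] B_def[symmetric] Q_def[symmetric] X_def by (simp add: mult_ac)
    moreover have "T' j = X * P"
      unfolding T'_def d P_def[symmetric] e A_def[symmetric] B_def[symmetric] Q_def[symmetric]
        Q'_def[symmetric] W_def[symmetric] X_def power_mult_distrib by (simp add: mult_ac)
    moreover have "g j = (1 - P) * X * (1 - w * I) * (1 - s * P) / (1 - I)"
      unfolding g_def d P_def[symmetric] e A_def[symmetric] B_def[symmetric] Q_def[symmetric] X_def by (simp add: mult_ac)
    moreover have "g (Suc j) = X * (1 - \<alpha> * P) * (1 - \<beta> * P) * w"
      unfolding g_def d e W_def[symmetric] Q'_def[symmetric] X_def unfolding power_Suc P_def[symmetric]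
      using P by (simp add: mult_ac)
    moreover have "p ^ Suc k = P * I"
      by (simp add: k I_def P_def power_add)
    ultimately show ?thesis
      using fraction_step[OF I, of "1 - P * I" "(1 - w) * (1 - s * P)" "(1 - \<alpha> * w) * (1 - \<beta> * w)" P
          "(1 - P) * (1 - w * I) * (1 - s * P)" "w * (1 - \<alpha> * P) * (1 - \<beta> * P)" X]
        saalschuetz_step[OF s_def, of P I]
      by (simp only: mult_ac)
  qed
  have "(1 - p ^ Suc k) * sum T {..k} - (1 - \<alpha> * w) * (1 - \<beta> * w) * sum T' {..k}
     = (\<Sum>j\<le>k. g j - g (Suc j))"
    unfolding sum_distrib_left sum_subtractf[symmetric] using step by (intro sum.cong) auto
  also have "\<dots> = - g (Suc k)"
    by (subst sum_telescope) (simp add: g_def)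
  also have "\<dots> = - ((1 - p ^ Suc k) * T (Suc k))"
    by (simp add: g_def T_def)
  finally have "(1 - p ^ Suc k) * sum T {..Suc k} = (1 - \<alpha> * w) * (1 - \<beta> * w) * sum T' {..k}"
    by (simp add: algebra_simps)
  also have "sum T' {..k} = qfac p (\<alpha> * (w * p)) k * qfac p (\<beta> * (w * p)) k / qfac p p k"
    unfolding T'_def by (rule Suc.IH[symmetric])
  finally have eq: "sum T {..Suc k} * (1 - p ^ Suc k) =
      (1 - \<alpha> * w) * (1 - \<beta> * w) * (qfac p (\<alpha> * (w * p)) k * qfac p (\<beta> * (w * p)) k / qfac p p k)"
    by (simp only: mult.commute)
  have "sum T {..Suc k} = (1 - \<alpha> * w) * (1 - \<beta> * w) *
      (qfac p (\<alpha> * (w * p)) k * qfac p (\<beta> * (w * p)) k / qfac p p k) / (1 - p ^ Suc k)"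
    using nz'[of k] by (subst nonzero_eq_divide_eq, simp) (rule eq)
  then show ?case
    by (simp add: T_def s_def qfac_Suc[of p p] qfac_Suc'[of p "\<alpha> * w"] qfac_Suc'[of p "\<beta> * w"]
        mult_ac)
qed

section \<open>Convergence, zeros and bounds of the infinite products\<close>

lemma norm_mult_power_le:
  fixes a p :: complex
  assumes "norm p < 1"
  shows "norm (a * p ^ n) \<le> norm a"
  using assms mult_left_le[of "norm p ^ n" "norm a"] by (simp add: norm_mult norm_power power_le_one)

lemma qinf_convergent:
  assumes "norm p < 1"
  shows "convergent_prod (\<lambda>j. 1 - b * p ^ j :: complex)"
proof -
  have "summable (\<lambda>j. norm (1 - b * p ^ j - 1))"
    using summable_mult[OF summable_geometric, of "norm p" "norm b"] assms
    by (simp add: norm_mult norm_power)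
  then show ?thesis
    using abs_convergent_prod_conv_summable abs_convergent_prod_imp_convergent_prod by blast
qed

lemma qfac_tendsto_qinf:
  assumes "norm p < 1"
  shows "(\<lambda>n. qfac p b n) \<longlonglongrightarrow> qinf p b"
  unfolding qfac_def qinf_def
  using has_prod_imp_tendsto'[OF convergent_prod_has_prod[OF qinf_convergent[OF assms]]] .

lemma qinf_split:
  assumes "norm p < 1"
  shows "qinf p b = qfac p b n * qinf p (b * p ^ n)"
proof (rule LIMSEQ_unique)
  show "(\<lambda>m. qfac p b (m + n)) \<longlonglongrightarrow> qinf p b"
    by (rule LIMSEQ_ignore_initial_segment[OF qfac_tendsto_qinf[OF assms]])
  show "(\<lambda>m. qfac p b (m + n)) \<longlonglongrightarrow> qfac p b n * qinf p (b * p ^ n)"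
    unfolding qfac_add add.commute[of _ n] by (intro tendsto_intros qfac_tendsto_qinf assms)
qed

lemma qinf_split_1:
  assumes "norm p < 1"
  shows "qinf p b = (1 - b) * qinf p (b * p)"
  using qinf_split[OF assms, of b 1] by (simp add: qfac_def)

lemma qinf_eq_0_iff:
  assumes "norm p < 1"
  shows "qinf p b = 0 \<longleftrightarrow> (\<exists>j. b * p ^ j = 1)"
  using has_prod_eq_0_iff[OF convergent_prod_has_prod[OF qinf_convergent[OF assms]]]
  unfolding qinf_def image_iff right_minus_eq eq_commute[of 0] eq_commute[of 1] by simp

lemma qinf_nonzero:
  assumes "norm p < 1" "norm b < 1"
  shows "qinf p b \<noteq> 0"
proof -
  have "norm (b * p ^ j) < 1" for j
    using norm_mult_power_le[OF assms(1), of b j] assms(2) by simp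
  then show ?thesis
    using assms by (metis qinf_eq_0_iff norm_one order_less_irrefl)
qed

lemma qinf_0 [simp]: "qinf p 0 = 1"
  by (simp add: qinf_def)

lemma norm_qfac_le:
  assumes "norm p < 1"
  shows "norm (qfac p b n) \<le> exp (norm b / (1 - norm p))"
proof -
  have "norm (qfac p b n) \<le> (\<Prod>j<n. exp (norm b * norm p ^ j))"
    unfolding qfac_def prod_norm[symmetric]
  proof (rule prod_mono, safe)
    fix j
    have "norm (1 - b * p ^ j) \<le> 1 + norm b * norm p ^ j"
      using norm_triangle_ineq4[of 1 "b * p ^ j"] by (simp add: norm_mult norm_power)
    also have "\<dots> \<le> exp (norm b * norm p ^ j)"
      by (rule exp_ge_add_one_self)
    finally show "norm (1 - b * p ^ j) \<le> exp (norm b * norm p ^ j)" .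
  qed auto
  also have "\<dots> = exp (norm b * (\<Sum>j<n. norm p ^ j))"
    by (simp add: exp_sum sum_distrib_left)
  also have "(\<Sum>j<n. norm p ^ j) \<le> 1 / (1 - norm p)"
    using sum_le_suminf[OF summable_geometric, of "norm p" "{..<n}"] suminf_geometric[of "norm p"] assms
    by simp
  finally show ?thesis
    by (simp add: mult_left_mono)
qed

lemma norm_qinf_le:
  assumes "norm p < 1"
  shows "norm (qinf p b) \<le> exp (norm b / (1 - norm p))"
  by (rule LIMSEQ_le_const2[OF tendsto_norm[OF qfac_tendsto_qinf[OF assms]]])
    (use norm_qfac_le[OF assms] in blast)

lemma holomorphic_qfac [holomorphic_intros]:
  "f holomorphic_on A \<Longrightarrow> (\<lambda>x. qfac p (f x) n) holomorphic_on A"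
  unfolding qfac_def by (intro holomorphic_intros)

lemma holomorphic_qinf_UNIV:
  assumes "norm p < 1"
  shows "qinf p holomorphic_on UNIV"
proof (rule holomorphic_uniform_sequence[where f = "\<lambda>n b. qfac p b n"])
  fix x :: complex
  let ?A = "cball x 1"
  have "uniformly_convergent_on ?A (\<lambda>N b. \<Prod>n<N. 1 - b * p ^ n)"
  proof (rule uniformly_convergent_on_prod')
    show "uniformly_convergent_on ?A (\<lambda>N b. \<Sum>n<N. norm (1 - b * p ^ n - 1))"
    proof (rule Weierstrass_m_test')
      show "summable (\<lambda>n. (norm x + 1) * norm p ^ n)"
        using assms by (intro summable_mult summable_geometric) auto
      fix n b assume "b \<in> ?A"
      then have "norm b \<le> norm x + 1"
        using norm_triangle_ineq2[of b x] by (auto simp: dist_norm norm_minus_commute)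
      then show "norm (norm (1 - b * p ^ n - 1)) \<le> (norm x + 1) * norm p ^ n"
        by (simp add: norm_mult norm_power mult_right_mono)
    qed
  qed (auto intro!: continuous_intros)
  then have "uniform_limit ?A (\<lambda>N b. qfac p b N) (\<lambda>b. lim (\<lambda>N. qfac p b N)) sequentially"
    unfolding qfac_def uniformly_convergent_uniform_limit_iff .
  also have "(\<lambda>b. lim (\<lambda>N. qfac p b N)) = qinf p"
    by (intro ext limI qfac_tendsto_qinf assms)
  finally show "\<exists>d>0. cball x d \<subseteq> UNIV \<and> uniform_limit (cball x d) (\<lambda>n b. qfac p b n) (qinf p) sequentially"
    by (intro exI[of _ 1]) auto
qed (auto intro!: holomorphic_intros)

lemma holomorphic_qinf [holomorphic_intros]:
  assumes "norm p < 1" "f holomorphic_on A"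
  shows "(\<lambda>x. qinf p (f x)) holomorphic_on A"
  using holomorphic_on_compose_gen[OF assms(2) holomorphic_qinf_UNIV[OF assms(1)]]
  by (simp add: o_def)

lemma continuous_on_qinf [continuous_intros]:
  assumes "norm p < 1" "continuous_on A f"
  shows "continuous_on A (\<lambda>x. qinf p (f x))"
  using continuous_on_compose2[OF holomorphic_on_imp_continuous_on[OF holomorphic_qinf_UNIV[OF assms(1)]] assms(2)]
  by simp

lemma tendsto_qinf [tendsto_intros]:
  assumes "norm p < 1" "(f \<longlongrightarrow> l) F"
  shows "((\<lambda>x. qinf p (f x)) \<longlongrightarrow> qinf p l) F"
proof -
  have "isCont (qinf p) l"
    using continuous_on_qinf[OF assms(1) continuous_on_id, of UNIV]
    by (simp add: continuous_on_eq_continuous_at)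
  then show ?thesis
    using assms(2) by (rule isCont_tendsto_compose)
qed

lemma tendsto_power_zero:
  assumes "norm (p :: complex) < 1"
  shows "(\<lambda>n. p ^ n) \<longlonglongrightarrow> 0"
  using assms by (simp add: LIMSEQ_power_zero)

lemma inverse_qfac_self_bounded:
  assumes "norm p < 1"
  obtains B where "\<And>n. norm (1 / qfac p p n) \<le> B"
proof -
  have "qinf p p \<noteq> 0"
    using qinf_nonzero[OF assms assms] .
  then have conv: "convergent (\<lambda>n. 1 / qfac p p n)"
    unfolding convergent_def
    by (intro exI[of _ "1 / qinf p p"] tendsto_intros qfac_tendsto_qinf assms)
  show ?thesis
    by (rule BseqE[OF convergent_imp_Bseq[OF conv]], rule that, erule spec)
qed

lemma qinf_bounded_below:
  assumes "norm p < 1" "r < 1" "0 \<le> r"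
  obtains \<delta> where "\<delta> > 0" "\<And>w. norm w \<le> r \<Longrightarrow> \<delta> \<le> norm (qinf p w)"
proof -
  have "\<exists>x\<in>cball 0 r. \<forall>y\<in>cball 0 r. norm (qinf p x) \<le> norm (qinf p y)"
    using assms by (intro continuous_attains_inf continuous_intros) auto
  then obtain x where x: "x \<in> cball 0 r" "\<forall>y\<in>cball 0 r. norm (qinf p x) \<le> norm (qinf p y)"
    by (rule bexE)
  show ?thesis
  proof (rule that)
    show "norm (qinf p x) > 0"
      using assms qinf_nonzero[of p x] x(1) by simp
    show "norm (qinf p x) \<le> norm (qinf p w)" if "norm w \<le> r" for w
      using x(2) that by simp
  qed
qed

section \<open>The very-well-poised 6phi5 sum\<close>

definition phi65_term where
  "phi65_term p a b c y t m =
     (1 - a * p ^ (2 * m)) * qfac p b m * qfac p c m * (\<Prod>i<m. t - p ^ i) * y ^ m *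
     qinf p (c * y * p ^ m) * qinf p (b * y * p ^ m) * qinf p (a * t * p ^ Suc m) /
     (qfac p p m * qinf p (a * p ^ m))"

text \<open>Majorant for the 6phi5 series: for |t| > 1 the products of the t - p^i grow like t^m, so
  a ratio test takes the place of a uniform bound on them.\<close>

lemma summable_prod_add_power:
  fixes r s z :: real
  assumes "0 \<le> s" "s < 1" "0 \<le> r" "0 \<le> z" "r * z < 1"
  shows "summable (\<lambda>m. (\<Prod>i<m. r + s ^ i) * z ^ m)"
proof -
  define c where "c = (1 + r * z) / 2"
  have "(\<lambda>n. (r + s ^ n) * z) \<longlonglongrightarrow> (r + 0) * z"
    using assms by (intro tendsto_intros LIMSEQ_realpow_zero)
  moreover have "(r + 0) * z < c"
    using assms by (simp add: c_def)
  ultimately have "\<forall>\<^sub>F n in sequentially. (r + s ^ n) * z < c"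
    by (rule order_tendstoD)
  then obtain N where N: "\<And>n. n \<ge> N \<Longrightarrow> (r + s ^ n) * z < c"
    by (auto simp: eventually_sequentially)
  show ?thesis
  proof (rule summable_ratio_test)
    show "c < 1" using assms by (simp add: c_def)
    fix n assume n: "n \<ge> N"
    have "(\<Prod>i<Suc n. r + s ^ i) * z ^ Suc n = ((r + s ^ n) * z) * ((\<Prod>i<n. r + s ^ i) * z ^ n)"
      by simp
    also have "\<dots> \<le> c * ((\<Prod>i<n. r + s ^ i) * z ^ n)"
      using N[OF n] assms by (intro mult_right_mono mult_nonneg_nonneg prod_nonneg) auto
    finally show "norm ((\<Prod>i<Suc n. r + s ^ i) * z ^ Suc n) \<le> c * norm ((\<Prod>i<n. r + s ^ i) * z ^ n)"
      using assms by (simp add: abs_mult abs_of_nonneg prod_nonneg)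
  qed
qed

lemma norm_prod_diff_power_le:
  fixes t p :: complex
  assumes "norm t \<le> r"
  shows "norm ((\<Prod>i<m. t - p ^ i) * y ^ m) \<le> (\<Prod>i<m. r + norm p ^ i) * norm y ^ m"
proof -
  have "norm (\<Prod>i<m. t - p ^ i) \<le> (\<Prod>i<m. r + norm p ^ i)"
    unfolding prod_norm[symmetric]
  proof (rule prod_mono, safe)
    fix i
    show "norm (t - p ^ i) \<le> r + norm p ^ i"
      using norm_triangle_ineq4[of t "p ^ i"] assms by (simp add: norm_power)
  qed auto
  then show ?thesis
    by (simp add: norm_mult norm_power mult_right_mono)
qed

lemma phi65_coefficient_tendsto:
  assumes p: "norm p < 1"
  shows "(\<lambda>m. (1 - a * p ^ (2 * m)) * qfac p b m * qfac p c m * qinf p (d * p ^ m) *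
     qinf p (e * p ^ m) / (qfac p p m * qinf p (a * p ^ m))) \<longlonglongrightarrow>
     (1 - a * 0) * qinf p b * qinf p c * qinf p (d * 0) * qinf p (e * 0) / (qinf p p * qinf p (a * 0))"
proof -
  have "(\<lambda>m. p ^ (2 * m)) \<longlonglongrightarrow> 0"
    using p unfolding power_mult by (intro LIMSEQ_power_zero) (simp add: norm_power power_less_one_iff)
  then show ?thesis
    using qinf_nonzero[OF p p] by (intro tendsto_intros qfac_tendsto_qinf p) auto
qed

text \<open>Uniform in \<open>t\<close> over a disc, because \<open>phi65_sum\<close> passes to the
  limit along t p^n term by term under one majorant.\<close>

lemma phi65_term_bound:
  assumes p: "norm p < 1" and r: "0 \<le> r"
  obtains K where "\<And>t m. norm t \<le> r \<Longrightarrow>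
    norm (phi65_term p a b c y t m) \<le> K * ((\<Prod>i<m. r + norm p ^ i) * norm y ^ m)"
proof -
  define f where "f = (\<lambda>m. (1 - a * p ^ (2 * m)) * qfac p b m * qfac p c m * qinf p (c * y * p ^ m) *
     qinf p (b * y * p ^ m) / (qfac p p m * qinf p (a * p ^ m)))"
  have "convergent f"
    unfolding f_def convergent_def using phi65_coefficient_tendsto[OF p] by blast
  then obtain K where K: "K > 0" "\<forall>m. norm (f m) \<le> K"
    using BseqE[OF convergent_imp_Bseq] by blast
  show ?thesis
  proof (rule that)
    fix t :: complex and m assume t: "norm t \<le> r"
    have "norm (a * t * p ^ Suc m) \<le> norm a * r * 1"
      unfolding norm_mult norm_power using t r p
      by (intro mult_mono power_le_one) auto
    then have "norm (qinf p (a * t * p ^ Suc m)) \<le> exp (norm a * r / (1 - norm p))"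
      using norm_qinf_le[OF p, of "a * t * p ^ Suc m"] p
      by (smt (verit, best) divide_right_mono exp_le_cancel_iff mult.right_neutral)
    then have "norm (f m * qinf p (a * t * p ^ Suc m) * ((\<Prod>i<m. t - p ^ i) * y ^ m)) \<le>
       K * exp (norm a * r / (1 - norm p)) * ((\<Prod>i<m. r + norm p ^ i) * norm y ^ m)"
      unfolding norm_mult[of "_ * qinf p _"] norm_mult[of "f m"]
      using K norm_prod_diff_power_le[OF t] by (intro mult_mono) auto
    then show "norm (phi65_term p a b c y t m) \<le>
        K * exp (norm a * r / (1 - norm p)) * ((\<Prod>i<m. r + norm p ^ i) * norm y ^ m)"
      by (simp add: phi65_term_def f_def mult_ac)
  qed
qed

lemma summable_phi65:
  assumes p: "norm p < 1" and t: "norm (y * t) < 1"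
  shows "summable (phi65_term p a b c y t)"
proof -
  obtain K where K: "\<And>s m. norm s \<le> norm t \<Longrightarrow>
    norm (phi65_term p a b c y s m) \<le> K * ((\<Prod>i<m. norm t + norm p ^ i) * norm y ^ m)"
    using phi65_term_bound[OF p norm_ge_zero] by blast
  have "summable (\<lambda>m. K * ((\<Prod>i<m. norm t + norm p ^ i) * norm y ^ m))"
    using p t by (intro summable_mult summable_prod_add_power) (auto simp: norm_mult mult.commute)
  then show ?thesis
    using K[OF order_refl] by (rule summable_comparison_test'[where N = 0])
qed

text \<open>The telescoping identity of \<open>phi65_recurrence\<close> at m = n+1 with the common
  factor divided out and a p replaced by b c y; \<open>R\<close> is p^n.\<close>

lemma phi65_certificate:
  fixes b c y t R p :: complex
  shows "(1 - b * c * y * p * R\<^sup>2) * ((1 - y * t) * (t - R) * (1 - b * c * y * t * (p * R)) -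
      (1 - c * y * t) * (1 - b * y * t) * R * (p * t - 1)) =
    t * (1 - c * y * R) * (1 - b * y * R) * (1 - b * c * y * t * (p * R)) * (1 - p * R) -
    t * (1 - b * (p * R)) * (1 - c * (p * R)) * (t - R) * y * (1 - b * c * y * R)"
  by (simp add: algebra_simps power2_eq_square)

text \<open>The combination of the m-th terms at t and at p t is a difference G (m+1) - G m, where G
  starts at 0 and tends to 0.\<close>

lemma phi65_recurrence:
  assumes p: "norm p < 1" "p \<noteq> 0" and a: "norm a < 1" and ap: "a * p = b * c * y"
    and t: "norm (y * t) < 1"
  shows "(1 - y * t) * (\<Sum>m. phi65_term p a b c y t m) =
    (1 - c * y * t) * (1 - b * y * t) * (\<Sum>m. phi65_term p a b c y (p * t) m)"
proof -
  define h where "h = (\<lambda>m. qfac p b (Suc m) * qfac p c (Suc m) * ((\<Prod>i<m. t - p ^ i) * y ^ m) *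
     qinf p (c * y * p ^ m) * qinf p (b * y * p ^ m) * qinf p (a * t * p ^ Suc (Suc m)) /
     (qfac p p m * qinf p (a * p ^ Suc m)))"
  \<comment> \<open>The certificate contains the factor 1 - p^m. The index shift absorbs it into
    \<open>qfac p p m\<close>, and it explains the value 0 at m = 0.\<close>
  define G where "G = (\<lambda>m. case m of 0 \<Rightarrow> 0 | Suc m \<Rightarrow> - t * y * h m)"
  let ?s = "phi65_term p a b c y"
  have nz: "qinf p (a * p ^ m) \<noteq> 0" for m
    using norm_mult_power_le[OF p(1), of a m] a by (intro qinf_nonzero p) simp
  have split: "qinf p (z * p ^ m) = (1 - z * p ^ m) * qinf p (z * p ^ Suc m)" for z m
    using qinf_split_1[OF p(1), of "z * p ^ m"] by (simp add: mult_ac)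
  have nz1: "1 - a * p ^ m \<noteq> 0" for m
    using nz[of m] split[of a m] by auto
  have q: "qfac p p m \<noteq> 0" for m
    by (rule qfac_self_nonzero[OF p(1)])
  have q1: "1 - p * p ^ m \<noteq> 0" for m
    using q[of "Suc m"] by (simp add: qfac_Suc)
  have step: "(1 - y * t) * ?s t m - (1 - c * y * t) * (1 - b * y * t) * ?s (p * t) m = G (Suc m) - G m" for m
  proof (cases m)
    case 0
    define Q where "Q = qinf p (c * y) * qinf p (b * y) * qinf p (a * t * p ^ 2) / qinf p (a * p)"
    have "?s t 0 = Q * (1 - a * p * t)" and e2: "?s (p * t) 0 = Q"
      using nz1[of 0] split[of a 0] split[of "a * t" 1]
      by (simp_all add: phi65_term_def Q_def power2_eq_square mult_ac)
    then have e1: "?s t 0 = Q * (1 - b * c * y * t)"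
      by (simp only: ap)
    have "G (Suc 0) - G 0 = - t * y * (Q * (1 - b) * (1 - c))"
      by (simp add: G_def h_def Q_def qfac_Suc power2_eq_square)
    then show ?thesis
      unfolding 0 e1 e2 by (simp add: algebra_simps)
  next
    case (Suc n)
    define R where "R = p ^ n"
    define X where "X = qfac p b m * qfac p c m * (\<Prod>i<n. t - p ^ i) * y ^ m *
       qinf p (c * y * p ^ m) * qinf p (b * y * p ^ m) * qinf p (a * t * p ^ Suc (Suc m)) /
       (qfac p p m * qinf p (a * p ^ m))"
    have P: "p ^ m = p * R" by (simp add: Suc R_def)
    have e1: "?s t m = (1 - b * c * y * p * R\<^sup>2) * ((t - R) * (1 - b * c * y * t * (p * R))) * X"
    proof -
      have "a * p ^ (2 * m) = (a * p) * p * R\<^sup>2"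
        by (simp add: Suc R_def power2_eq_square power_add mult_2 mult_2_right mult_ac)
      moreover have "qinf p (a * t * p ^ Suc m) = (1 - (a * p) * t * (p * R)) * qinf p (a * t * p ^ Suc (Suc m))"
        using split[of "a * t" "Suc m"] by (simp add: Suc R_def mult_ac)
      moreover have "(\<Prod>i<m. t - p ^ i) = (\<Prod>i<n. t - p ^ i) * (t - R)"
        by (simp add: Suc R_def)
      ultimately show ?thesis
        unfolding phi65_term_def X_def ap by (simp add: mult_ac)
    qed
    have e2: "?s (p * t) m = (1 - b * c * y * p * R\<^sup>2) * (R * (p * t - 1)) * X"
    proof -
      have "a * p ^ (2 * m) = (a * p) * p * R\<^sup>2"
        by (simp add: Suc R_def power2_eq_square power_add mult_2 mult_2_right mult_ac)
      moreover have "a * (p * t) * p ^ Suc m = a * t * p ^ Suc (Suc m)"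
        by (simp add: mult_ac)
      moreover have "(\<Prod>i<m. p * t - p ^ i) = (\<Prod>i<n. t - p ^ i) * (R * (p * t - 1))"
      proof -
        have "(\<Prod>i<m. p * t - p ^ i) = (p * t - 1) * (\<Prod>i<n. p * (t - p ^ i))"
          unfolding Suc prod.lessThan_Suc_shift by (simp add: right_diff_distrib)
        also have "(\<Prod>i<n. p * (t - p ^ i)) = R * (\<Prod>i<n. t - p ^ i)"
          by (simp add: prod.distrib R_def)
        finally show ?thesis by (simp add: mult_ac)
      qed
      ultimately show ?thesis
        unfolding phi65_term_def X_def ap by (simp add: mult_ac)
    qed
    have e3: "h m = (1 - b * (p * R)) * (1 - c * (p * R)) * (t - R) * (1 - b * c * y * R) * X"
    proof -
      have "qinf p (a * p ^ m) = (1 - b * c * y * R) * qinf p (a * p ^ Suc m)"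
        using split[of a m] ap by (simp add: P mult_ac)
      moreover have "1 - b * c * y * R \<noteq> 0"
        using nz1[of m] ap by (simp add: P mult_ac)
      moreover have "(\<Prod>i<m. t - p ^ i) = (\<Prod>i<n. t - p ^ i) * (t - R)"
        by (simp add: Suc R_def)
      ultimately show ?thesis
        unfolding h_def X_def qfac_Suc P by (simp add: mult_ac)
    qed
    have e4: "y * h n = (1 - c * y * R) * (1 - b * y * R) * (1 - b * c * y * t * (p * R)) * (1 - p * R) * X"
    proof -
      have "qinf p (a * t * p ^ Suc m) = (1 - (a * p) * t * (p * R)) * qinf p (a * t * p ^ Suc (Suc m))"
        using split[of "a * t" "Suc m"] by (simp add: Suc R_def mult_ac)
      moreover have "qfac p p m = qfac p p n * (1 - p * R)" "1 - p * R \<noteq> 0"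
        using q1[of n] by (simp_all add: Suc qfac_Suc R_def)
      moreover have "y ^ m = y * y ^ n" by (simp add: Suc)
      moreover have "qinf p (c * y * p ^ n) = (1 - c * y * R) * qinf p (c * y * p ^ m)"
        "qinf p (b * y * p ^ n) = (1 - b * y * R) * qinf p (b * y * p ^ m)"
        using split[of "c * y" n] split[of "b * y" n] by (simp_all add: Suc R_def)
      ultimately show ?thesis
        unfolding h_def X_def ap Suc[symmetric] by (simp add: mult_ac)
    qed
    have gen: "A * (B * C * D - E * F * R' * H) * X = B * (A * (C * D) * X) - E * F * (A * (R' * H) * X)"
      for A B C D E F R' H :: complex
      by (simp add: algebra_simps)
    have "G (Suc m) - G m = t * (y * h n) - t * y * h m"
      by (simp add: G_def Suc mult_ac)
    also have "\<dots> = (t * (1 - c * y * R) * (1 - b * y * R) * (1 - b * c * y * t * (p * R)) * (1 - p * R) -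
        t * (1 - b * (p * R)) * (1 - c * (p * R)) * (t - R) * y * (1 - b * c * y * R)) * X"
      unfolding e3 e4 left_diff_distrib[of _ _ X] by (simp only: mult_ac)
    also have "\<dots> = (1 - y * t) * ?s t m - (1 - c * y * t) * (1 - b * y * t) * ?s (p * t) m"
      unfolding phi65_certificate[symmetric] e1 e2 by (rule gen)
    finally show ?thesis by simp
  qed
  have "G \<longlonglongrightarrow> 0"
  proof -
    define f where "f = (\<lambda>m. qfac p b (Suc m) * qfac p c (Suc m) *
     qinf p (c * y * p ^ m) * qinf p (b * y * p ^ m) * qinf p (a * t * p ^ Suc (Suc m)) /
     (qfac p p m * qinf p (a * p ^ Suc m)))"
    have "summable (\<lambda>m. (\<Prod>i<m. norm t + norm p ^ i) * norm y ^ m)"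
      using p t by (intro summable_prod_add_power) (auto simp: norm_mult mult.commute)
    then have "(\<lambda>m. (\<Prod>i<m. norm t + norm p ^ i) * norm y ^ m) \<longlonglongrightarrow> 0"
      by (rule summable_LIMSEQ_zero)
    then have "(\<lambda>m. (\<Prod>i<m. t - p ^ i) * y ^ m) \<longlonglongrightarrow> 0"
      by (rule Lim_null_comparison[rotated]) (simp add: norm_prod_diff_power_le)
    moreover have "f \<longlonglongrightarrow> qinf p b * qinf p c * qinf p (c * y * 0) * qinf p (b * y * 0) *
        qinf p (a * t * 0) / (qinf p p * qinf p (a * 0))"
      unfolding f_def using qinf_nonzero[OF p(1) p(1)] p
      by (intro tendsto_intros qfac_tendsto_qinf LIMSEQ_Suc LIMSEQ_power_zero) auto
    ultimately have "(\<lambda>m. - t * y * (f m * ((\<Prod>i<m. t - p ^ i) * y ^ m))) \<longlonglongrightarrow>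
        - t * y * (qinf p b * qinf p c * qinf p (c * y * 0) * qinf p (b * y * 0) *
        qinf p (a * t * 0) / (qinf p p * qinf p (a * 0)) * 0)"
      by (intro tendsto_intros)
    then have "(\<lambda>m. G (Suc m)) \<longlonglongrightarrow> 0"
      by (simp add: G_def h_def f_def mult_ac)
    then show ?thesis
      by (simp add: filterlim_sequentially_Suc)
  qed
  then have "(\<lambda>m. G (Suc m) - G m) sums (0 - G 0)"
    by (rule telescope_sums)
  moreover have "(\<lambda>m. (1 - y * t) * ?s t m - (1 - c * y * t) * (1 - b * y * t) * ?s (p * t) m) sums
      ((1 - y * t) * (\<Sum>m. ?s t m) - (1 - c * y * t) * (1 - b * y * t) * (\<Sum>m. ?s (p * t) m))"
  proof (intro sums_diff sums_mult summable_sums summable_phi65 p t)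
    have "norm (y * (p * t)) \<le> norm (y * t)"
      using p mult_left_le[of "norm p" "norm (y * t)"] by (simp add: norm_mult mult_ac)
    then show "norm (y * (p * t)) < 1" using t by simp
  qed
  ultimately show ?thesis
    unfolding step using sums_unique2 by (fastforce simp: G_def)
qed

lemma phi65_iterate:
  assumes p: "norm p < 1" "p \<noteq> 0" and a: "norm a < 1" and ap: "a * p = b * c * y"
    and t: "norm (y * t) < 1"
  shows "qfac p (y * t) n * (\<Sum>m. phi65_term p a b c y t m) =
    qfac p (c * y * t) n * qfac p (b * y * t) n * (\<Sum>m. phi65_term p a b c y (t * p ^ n) m)"
proof (induction n)
  case 0
  then show ?case by simp
next
  case (Suc n)
  have "norm (y * (t * p ^ n)) < 1"
    using norm_mult_power_le[OF p(1), of "y * t" n] t by (simp add: mult.assoc)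
  from phi65_recurrence[OF p a ap this]
  have rec: "(1 - y * t * p ^ n) * (\<Sum>m. phi65_term p a b c y (t * p ^ n) m) =
      (1 - c * y * t * p ^ n) * (1 - b * y * t * p ^ n) * (\<Sum>m. phi65_term p a b c y (t * p ^ Suc n) m)"
    by (simp add: mult_ac)
  have "qfac p (y * t) (Suc n) * (\<Sum>m. phi65_term p a b c y t m) =
      (1 - y * t * p ^ n) * (qfac p (y * t) n * (\<Sum>m. phi65_term p a b c y t m))"
    by (simp add: qfac_Suc mult_ac)
  also have "\<dots> = qfac p (c * y * t) n * qfac p (b * y * t) n *
      ((1 - y * t * p ^ n) * (\<Sum>m. phi65_term p a b c y (t * p ^ n) m))"
    unfolding Suc.IH by (simp only: mult_ac)
  also have "\<dots> = qfac p (c * y * t) (Suc n) * qfac p (b * y * t) (Suc n) *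
      (\<Sum>m. phi65_term p a b c y (t * p ^ Suc n) m)"
    unfolding rec qfac_Suc by (simp only: mult_ac)
  finally show ?case .
qed

text \<open>The parameter \<open>d\<close> of the classical formula is \<open>1/t\<close>.  Both sides satisfy the same
  first-order recurrence under \<open>t \<mapsto> p t\<close> and agree at \<open>t = 1\<close>, where the series has a single term.\<close>

theorem phi65_sum:
  assumes p: "norm p < 1" "p \<noteq> 0" and a: "norm a < 1" and ap: "a * p = b * c * y"
    and t: "norm (y * t) < 1" and y: "norm y < 1" "norm (b * y) < 1" "norm (c * y) < 1"
  shows "phi65_term p a b c y t sums (qinf p y * qinf p (c * y * t) * qinf p (b * y * t) / qinf p (y * t))"
proof -
  let ?s = "phi65_term p a b c y"
  let ?S = "\<lambda>t. \<Sum>m. ?s t m"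
  have lim: "(\<lambda>n. ?S (t * p ^ n)) \<longlonglongrightarrow> ?S 0" if t: "norm (y * t) < 1" for t
  proof -
    obtain K where K: "\<And>s m. norm s \<le> norm t \<Longrightarrow>
      norm (?s s m) \<le> K * ((\<Prod>i<m. norm t + norm p ^ i) * norm y ^ m)"
      using phi65_term_bound[OF p(1) norm_ge_zero] by blast
    let ?M = "\<lambda>m. K * ((\<Prod>i<m. norm t + norm p ^ i) * norm y ^ m)"
    have bd: "norm (?s (t * p ^ n) m) \<le>
        ?M m" for n m
      by (rule K[OF norm_mult_power_le[OF p(1)]])
    have "summable ?M"
      using p t by (intro summable_mult summable_prod_add_power) (auto simp: norm_mult mult.commute)
    moreover have "(\<lambda>n. ?s (t * p ^ n) m) \<longlonglongrightarrow> ?s (t * 0) m" for m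
    proof (cases "qfac p p m * qinf p (a * p ^ m) = 0")
      case True
      then show ?thesis by (auto simp: phi65_term_def)
    next
      case False
      then show ?thesis
        unfolding phi65_term_def using p by (intro tendsto_intros tendsto_power_zero) auto
    qed
    moreover have "\<forall>\<^sub>F (m, n) in at_top \<times>\<^sub>F sequentially. norm (?s (t * p ^ n) m) \<le>
        ?M m"
      using bd by (intro always_eventually) auto
    ultimately show ?thesis
      using tannerys_theorem[of "\<lambda>m n. ?s (t * p ^ n) m" "?s (t * 0)"
          sequentially ?M]
      by simp
  qed
  \<comment> \<open>Iterating the recurrence towards t = 0 expresses every \<open>?S t\<close>
    through the single unknown \<open>?S 0\<close>. That value is then read off from t = 1, so the
    series at d = infinity never has to be summed directly.\<close>
  have eq: "qinf p (y * t) * ?S t = qinf p (c * y * t) * qinf p (b * y * t) * ?S 0"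
    if t: "norm (y * t) < 1" for t
  proof (rule LIMSEQ_unique)
    show "(\<lambda>n. qfac p (y * t) n * ?S t) \<longlonglongrightarrow> qinf p (y * t) * ?S t"
      by (intro tendsto_intros qfac_tendsto_qinf p)
    show "(\<lambda>n. qfac p (y * t) n * ?S t) \<longlonglongrightarrow> qinf p (c * y * t) * qinf p (b * y * t) * ?S 0"
      unfolding phi65_iterate[OF p a ap t] by (intro tendsto_intros qfac_tendsto_qinf p lim t)
  qed
  have "?S 1 = (\<Sum>m\<in>{0}. ?s 1 m)"
  proof (rule suminf_finite)
    fix m :: nat assume "m \<notin> {0}"
    then have "(\<Prod>i<m. 1 - p ^ i) = 0"
      by (intro prod_zero) (auto intro: bexI[of _ 0])
    then show "?s 1 m = 0"
      by (simp add: phi65_term_def)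
  qed auto
  also have "\<dots> = qinf p (c * y) * qinf p (b * y)"
    using qinf_nonzero[OF p(1) a] qinf_split_1[OF p(1), of a] by (simp add: phi65_term_def)
  finally have "?S 0 = qinf p y"
    using eq[of 1] y qinf_nonzero[OF p(1) y(2)] qinf_nonzero[OF p(1) y(3)] by auto
  then have "?S t = qinf p y * qinf p (c * y * t) * qinf p (b * y * t) / qinf p (y * t)"
    using eq[OF t] qinf_nonzero[OF p(1) t] by (simp add: field_simps)
  then show ?thesis
    using summable_phi65[OF p(1) t] summable_sums by metis
qed

section \<open>Transformations of terminating sums\<close>

lemma sum_lessThan_add: "(\<Sum>i<j + i'. i) = (\<Sum>i<j. i) + (\<Sum>i<i'. i) + j * i'" for j i' :: nat
  by (induction i') (simp_all add: algebra_simps)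

text \<open>Read backwards, the factors of (p^(1-j)/s; p)_j are 1 - 1/(s p^i). This is how
  parameters with negative powers of p are brought back to positive ones.\<close>

lemma qfac_reversal:
  assumes "p \<noteq> 0" "s \<noteq> 0"
  shows "qfac p (p / (s * p ^ j)) j = qfac p s j / ((- s) ^ j * p ^ (\<Sum>i<j. i))"
proof -
  have "qfac p (p / (s * p ^ j)) j = (\<Prod>i<j. 1 - p / (s * p ^ j) * p ^ (j - Suc i))"
    unfolding qfac_def by (subst prod.nat_diff_reindex [symmetric]) simp
  also have "\<dots> = (\<Prod>i<j. (1 - s * p ^ i) / (- s * p ^ i))"
  proof (rule prod.cong)
    fix i assume "i \<in> {..<j}"
    then have "p ^ j = p ^ (j - Suc i) * (p * p ^ i)"
      by (subst power_Suc [symmetric], subst power_add [symmetric]) simp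
    then show "1 - p / (s * p ^ j) * p ^ (j - Suc i) = (1 - s * p ^ i) / (- s * p ^ i)"
      using assms by (simp add: field_simps)
  qed simp
  also have "\<dots> = qfac p s j / (\<Prod>i<j. - s * p ^ i)"
    by (simp only: qfac_def prod_dividef)
  also have "(\<Prod>i<j. - s * p ^ i) = (- s) ^ j * p ^ (\<Sum>i<j. i)"
    by (induction j) (simp_all add: power_add)
  finally show ?thesis .
qed

lemma qfac_inverse_power_eq_0:
  assumes "k < j" "p \<noteq> 0"
  shows "qfac p (1 / p ^ k) j = 0"
  using assms by (auto simp: qfac_eq_0_iff intro!: exI[of _ k])

lemma qfac_inverse_power:
  assumes "norm p < 1" "p \<noteq> 0"
  shows "qfac p (1 / p ^ (j + m)) j =
    qfac p p (j + m) / (qfac p p m * ((- (p ^ Suc m)) ^ j * p ^ (\<Sum>i<j. i)))"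
proof -
  have "1 / p ^ (j + m) = p / (p ^ Suc m * p ^ j)"
    using assms by (simp add: power_add)
  moreover have "qfac p p (j + m) = qfac p p m * qfac p (p ^ Suc m) j"
    using qfac_add[of p p m j] by (simp add: add.commute)
  ultimately show ?thesis
    using assms qfac_self_nonzero[OF assms(1), of m] qfac_reversal[of p "p ^ Suc m" j] by simp
qed

text \<open>This is \<open>saalschuetz\<close> with numerator parameter \<open>p ^ - k\<close>: expanding the \<open>k\<close>-th term of an infinite
  series in this way turns that series into a finite sum of 6phi5 series.\<close>

lemma saalschuetz_symmetric:
  assumes p: "norm p < 1" "p \<noteq> 0" and f: "f \<noteq> 0" and u: "u * p = e * f * p ^ n"
  shows "qfac p (e * p ^ k) n * qfac p (f * p ^ k) n =
    (\<Sum>j\<le>n. if j \<le> k then qfac p p n * qfac p p k / (qfac p p j * qfac p p (n - j) * qfac p p (k - j)) *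
       qfac p (e * p ^ j) (n - j) * qfac p (f * p ^ j) (n - j) * qfac p (u * p ^ k) j *
       p ^ ((n - j) * (k - j)) else 0)"
    (is "_ = (\<Sum>j\<le>n. ?s j)")
proof -
  \<comment> \<open>In \<open>saalschuetz\<close> take alpha = p^-k and beta = u p^k. This
    \<open>w\<close> gives beta w = e p^k and alpha w = p^(1-n-k)/f; reversal turns the latter into
    f p^k at the cost of the factor \<open>c\<close>.\<close>
  define w where "w = p / (f * p ^ n)"
  define c where "c = (- (f * p ^ k)) ^ n * p ^ (\<Sum>i<n. i)"
  have c0: "c \<noteq> 0" using p f by (simp add: c_def)
  have q: "qfac p p m \<noteq> 0" for m by (rule qfac_self_nonzero[OF p(1)])
  have w1: "1 / p ^ k * w = p / (f * p ^ k * p ^ n)"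
    by (simp add: w_def mult_ac)
  have w2: "u * p ^ k * w = e * p ^ k"
    using u p f by (simp add: w_def field_simps)
  have w3: "1 / p ^ k * (u * p ^ k) * w * p ^ j = e * p ^ j" for j
    using u p f by (simp add: w_def field_simps)
  have rv: "qfac p (p / (f * p ^ k * p ^ n)) n = qfac p (f * p ^ k) n / c"
    unfolding c_def using p f by (intro qfac_reversal) auto
  have eq: "qfac p (f * p ^ k) n / c * qfac p (e * p ^ k) n / qfac p p n =
    (\<Sum>j\<le>n. qfac p (1 / p ^ k) j * qfac p (u * p ^ k) j * w ^ j * qfac p w (n - j) *
       qfac p (e * p ^ j) (n - j) / (qfac p p j * qfac p p (n - j)))"
    using saalschuetz[OF p(1), of "1 / p ^ k" w n "u * p ^ k"]
    unfolding w1 w2 w3 rv .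
  have summand: "c * (qfac p (1 / p ^ k) j * w ^ j * qfac p w (n - j)) =
      (if j \<le> k then qfac p p k / qfac p p (k - j) * qfac p (f * p ^ j) (n - j) * p ^ ((n - j) * (k - j)) else 0)"
    if "j \<le> n" for j
  proof (cases "j \<le> k")
    case False
    then show ?thesis using qfac_inverse_power_eq_0[of k j p] p by simp
  next
    case True
    obtain m where k: "k = j + m" using le_Suc_ex[OF True] by blast
    obtain i where n: "n = j + i" using le_Suc_ex[OF \<open>j \<le> n\<close>] by blast
    let ?g = "\<lambda>j::nat. \<Sum>i<j. i"
    have w: "qfac p w i = qfac p (f * p ^ j) i / ((- (f * p ^ j)) ^ i * p ^ ?g i)"
      using qfac_reversal[of p "f * p ^ j" i] p f by (simp add: w_def n power_add mult_ac)
    have nj: "n - j = i" by (simp add: n)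
    have wj: "w ^ j = p ^ j / (f * p ^ n) ^ j" by (simp add: w_def power_divide)
    have pk: "qfac p (1 / p ^ k) j = qfac p p k / (qfac p p m * ((- (p ^ Suc m)) ^ j * p ^ ?g j))"
      unfolding k by (rule qfac_inverse_power[OF p])
    \<comment> \<open>Only signs and powers of f and p are left. \<open>M\<close> is p^(i m) times
      the collected denominators, so \<open>L = M\<close> leaves exactly the factor
      p^((n-j)(k-j)).\<close>
    define L where "L = (- (f * p ^ k)) ^ n * p ^ ?g n * p ^ j"
    define M where "M = p ^ (i * m) * ((- (p ^ Suc m)) ^ j * p ^ ?g j) * (f * p ^ n) ^ j * ((- (f * p ^ j)) ^ i * p ^ ?g i)"
    have "L = (- 1) ^ n * f ^ n * p ^ (k * n + ?g n + j)"
      unfolding L_def by (simp add: power_minus[of "f * p ^ k"] power_mult_distrib power_add power_mult mult_ac)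
    moreover have "M = (- 1) ^ (j + i) * f ^ (j + i) * p ^ (i * m + (Suc m * j + ?g j) + n * j + (j * i + ?g i))"
      unfolding M_def power_minus[of "f * p ^ j"] power_minus[of "p ^ Suc m"] power_mult_distrib
        power_add power_mult[of p "Suc m" j, symmetric] power_mult[of p n j, symmetric]
        power_mult[of p j i, symmetric]
      by (simp only: mult_ac)
    moreover have "k * n + ?g n + j = i * m + (Suc m * j + ?g j) + n * j + (j * i + ?g i)"
      unfolding k n sum_lessThan_add by (simp add: algebra_simps)
    ultimately have LM: "L = M" by (simp only: n)
    have nz: "(- (p ^ Suc m)) ^ j * p ^ ?g j \<noteq> 0" "(f * p ^ n) ^ j \<noteq> 0" "(- (f * p ^ j)) ^ i * p ^ ?g i \<noteq> 0"
      using p f by simp_all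
    have "c * (qfac p (1 / p ^ k) j * w ^ j * qfac p w (n - j)) =
      c * (qfac p p k / (qfac p p m * ((- (p ^ Suc m)) ^ j * p ^ ?g j)) * (p ^ j / (f * p ^ n) ^ j) *
        (qfac p (f * p ^ j) i / ((- (f * p ^ j)) ^ i * p ^ ?g i)))"
      unfolding nj w wj pk ..
    also have "\<dots> = L / (((- (p ^ Suc m)) ^ j * p ^ ?g j) * (f * p ^ n) ^ j * ((- (f * p ^ j)) ^ i * p ^ ?g i)) *
        (qfac p p k / qfac p p m * qfac p (f * p ^ j) i)"
      unfolding L_def c_def by (simp only: times_divide_times_eq times_divide_eq_left times_divide_eq_right
          divide_divide_eq_left mult_ac)
    also have "\<dots> = p ^ (i * m) * (qfac p p k / qfac p p m * qfac p (f * p ^ j) i)"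
      unfolding LM M_def using nz by (simp only: mult.assoc) simp
    finally show ?thesis
      by (simp add: k n mult_ac)
  qed
  have "qfac p (e * p ^ k) n * qfac p (f * p ^ k) n =
     qfac p p n * c * (qfac p (f * p ^ k) n / c * qfac p (e * p ^ k) n / qfac p p n)"
    using c0 q by simp
  also have "\<dots> = (\<Sum>j\<le>n. qfac p p n * qfac p (u * p ^ k) j * qfac p (e * p ^ j) (n - j) /
      (qfac p p j * qfac p p (n - j)) * (c * (qfac p (1 / p ^ k) j * w ^ j * qfac p w (n - j))))"
    unfolding eq sum_distrib_left by (intro sum.cong) (simp_all add: mult_ac)
  also have "\<dots> = (\<Sum>j\<le>n. ?s j)"
  proof (rule sum.cong)
    fix j assume "j \<in> {..n}"
    then have "j \<le> n" by simp
    show "qfac p p n * qfac p (u * p ^ k) j * qfac p (e * p ^ j) (n - j) /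
      (qfac p p j * qfac p p (n - j)) * (c * (qfac p (1 / p ^ k) j * w ^ j * qfac p w (n - j))) =
      ?s j"
      unfolding summand[OF \<open>j \<le> n\<close>] by (simp add: mult_ac)
  qed simp
  finally show ?thesis .
qed

lemma sum_triangle_swap:
  "(\<Sum>j\<le>n. \<Sum>i\<le>j. f i (j - i)) = (\<Sum>i\<le>n. \<Sum>m\<le>n - i. f i m)"
  for f :: "nat \<Rightarrow> nat \<Rightarrow> 'a :: comm_monoid_add"
proof -
  have "(\<Sum>i\<le>n. \<Sum>m\<le>n - i. f i m) = (\<Sum>(i, m)\<in>(SIGMA i:{..n}. {..n - i}). f i m)"
    by (rule sum.Sigma) auto
  also have "(SIGMA i:{..n}. {..n - i}) = {(i, m). i + m \<le> n}"
    by auto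
  also have "(\<Sum>(i, m)\<in>{(i, m). i + m \<le> n}. f i m) = (\<Sum>j\<le>n. \<Sum>i\<le>j. f i (j - i))"
    by (rule sum.triangle_reindex_eq)
  finally show ?thesis ..
qed

text \<open>Both sides come from one double sum by applying the Saalschuetz formula to either of its inner
  sums.\<close>

lemma sears:
  assumes p: "norm p < 1"
  shows "(\<Sum>j\<le>n. qfac p (b * w) j * qfac p (c * w) j * qfac p d j * qinf p (b * c * w * p ^ j) *
       qinf p (w * d * r * p ^ j) * qfac p r (n - j) * r ^ j / (qfac p p j * qfac p p (n - j))) =
    qinf p (w * d * r * p ^ n) *
    (\<Sum>i\<le>n. qfac p b i * qfac p c i * qfac p d i * (w * r) ^ i * qinf p (b * c * w * p ^ i) *
       qfac p (w * r) (n - i) * qfac p (d * r * p ^ i) (n - i) / (qfac p p i * qfac p p (n - i)))"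
    (is "(\<Sum>j\<le>n. ?l j) = qinf p (w * d * r * p ^ n) * (\<Sum>i\<le>n. ?r i)")
proof -
  \<comment> \<open>Expanding (b w)_j (c w)_j / (p)_j by Saalschuetz and writing j = i + m produces
    the summand \<open>h i m\<close>. For fixed i the sum over m is again of Saalschuetz type, now
    with parameters w and d p^i and with r in the role of w.\<close>
  define h where "h = (\<lambda>i m. qfac p b i * qfac p c i * w ^ i * qinf p (b * c * w * p ^ i) / qfac p p i *
     (qfac p w m * qfac p d (i + m) * qinf p (w * d * r * p ^ (i + m)) * qfac p r (n - (i + m)) * r ^ (i + m) /
      (qfac p p m * qfac p p (n - (i + m)))))"
  have "(\<Sum>j\<le>n. ?l j) =
    (\<Sum>j\<le>n. \<Sum>i\<le>j. h i (j - i))"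
  proof (rule sum.cong)
    fix j assume "j \<in> {..n}"
    have "?l j =
      (qfac p (b * w) j * qfac p (c * w) j / qfac p p j) * (qinf p (b * c * w * p ^ j) * (qfac p d j *
       qinf p (w * d * r * p ^ j) * qfac p r (n - j) * r ^ j / qfac p p (n - j)))"
      by (simp add: mult_ac)
    also have "\<dots> = (\<Sum>i\<le>j. h i (j - i))"
      unfolding saalschuetz[OF p] sum_distrib_right
    proof (rule sum.cong)
      fix i assume "i \<in> {..j}"
      then have i: "i + (j - i) = j" by simp
      have "qinf p (b * c * w * p ^ i) = qfac p (b * c * w * p ^ i) (j - i) * qinf p (b * c * w * p ^ j)"
        using qinf_split[OF p, of "b * c * w * p ^ i" "j - i"] i
        by (simp add: power_add[symmetric] mult.assoc)
      then show "qfac p b i * qfac p c i * w ^ i * qfac p w (j - i) * qfac p (b * c * w * p ^ i) (j - i) /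
          (qfac p p i * qfac p p (j - i)) * (qinf p (b * c * w * p ^ j) * (qfac p d j *
       qinf p (w * d * r * p ^ j) * qfac p r (n - j) * r ^ j / qfac p p (n - j))) = h i (j - i)"
        unfolding h_def i by (simp add: mult_ac)
    qed simp
    finally show "?l j =
       (\<Sum>i\<le>j. h i (j - i))" .
  qed simp
  also have "\<dots> = (\<Sum>i\<le>n. \<Sum>m\<le>n - i. h i m)"
    by (rule sum_triangle_swap)
  also have "\<dots> = (\<Sum>i\<le>n. qinf p (w * d * r * p ^ n) *
     ?r i)"
  proof (rule sum.cong)
    fix i assume "i \<in> {..n}"
    define N where "N = n - i"
    let ?c = "qinf p (w * d * r * p ^ n) * (qfac p b i * qfac p c i * qfac p d i *
        (w * r) ^ i * qinf p (b * c * w * p ^ i) / qfac p p i)"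
    have n: "n = i + N" using \<open>i \<in> {..n}\<close> by (simp add: N_def)
    have "(\<Sum>m\<le>n - i. h i m) = (\<Sum>m\<le>N. ?c *
        (qfac p w m * qfac p (d * p ^ i) m * r ^ m * qfac p r (N - m) *
        qfac p (w * (d * p ^ i) * r * p ^ m) (N - m) / (qfac p p m * qfac p p (N - m))))"
      unfolding N_def[symmetric]
    proof (rule sum.cong)
      fix m assume "m \<in> {..N}"
      then have m: "i + m + (N - m) = n" "n - (i + m) = N - m" by (auto simp: n)
      have "qinf p (w * d * r * p ^ (i + m)) = qfac p (w * d * r * p ^ (i + m)) (N - m) * qinf p (w * d * r * p ^ n)"
        using qinf_split[OF p, of "w * d * r * p ^ (i + m)" "N - m"] m(1)
        by (simp add: power_add[symmetric] mult.assoc)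
      moreover have "w * d * r * p ^ (i + m) = w * (d * p ^ i) * r * p ^ m"
        by (simp add: power_add mult_ac)
      ultimately show "h i m = ?c *
        (qfac p w m * qfac p (d * p ^ i) m * r ^ m * qfac p r (N - m) *
        qfac p (w * (d * p ^ i) * r * p ^ m) (N - m) / (qfac p p m * qfac p p (N - m)))"
        unfolding h_def m(2) qfac_add by (simp add: power_mult_distrib power_add mult_ac)
    qed simp
    also have "\<dots> = ?c *
        (qfac p (w * r) N * qfac p (d * p ^ i * r) N / qfac p p N)"
      unfolding sum_distrib_left[symmetric] saalschuetz[OF p] ..
    finally show "(\<Sum>m\<le>n - i. h i m) = qinf p (w * d * r * p ^ n) *
     ?r i"
      unfolding N_def by (simp add: mult_ac)
  qed simp
  finally show ?thesis
    by (simp add: sum_distrib_left)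
qed

text \<open>The 8W7 series with base \<open>p\<close>, first parameter \<open>B2 * C1 * c * D2 / p\<close> and argument
  \<open>D1 * D3 * A2 / B2\<close>, multiplied by the infinite products that clear the five denominators
  depending on the remaining parameters.\<close>

definition w8_term where
  "w8_term p A2 B2 C1 D1 D2 D3 c k =
     (1 - B2 * C1 * c * D2 / p * p ^ (2 * k)) * (D1 * D3 * A2 / B2) ^ k *
     (qfac p (B2 / D1) k * qfac p (D2 * c) k * qfac p (B2 / D3) k * qfac p (C1 * c * B2 / A2) k *
      qfac p (D2 * C1) k) *
     (qinf p (C1 * c * D1 * D2 * p ^ k) * qinf p (B2 * C1 * p ^ k) * qinf p (C1 * c * D2 * D3 * p ^ k) *
      qinf p (D2 * A2 * p ^ k) * qinf p (B2 * c * p ^ k)) /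
     (qfac p p k * qinf p (B2 * C1 * c * D2 / p * p ^ k))"

section \<open>The 8W7 series and the residues at the special points c = A2 p^n\<close>

lemma prod_lessThan_add: "(\<Prod>i<j + m. h i) = (\<Prod>i<j. h i) * (\<Prod>i<m. h (j + i))"
  for h :: "nat \<Rightarrow> 'a :: comm_monoid_mult"
  by (induction m) (simp_all add: mult_ac)

text \<open>Both sides are (z p^n)_k (z p^k)_n (z p^(n+k))_inf. A numerator and a denominator
  parameter that differ by p^n are thus traded for a product of fixed length n, which Saalschuetz
  can expand.\<close>

lemma qfac_qinf_exchange:
  assumes "norm p < 1"
  shows "qfac p (z * p ^ n) k * qinf p (z * p ^ k) = qinf p (z * p ^ n) * qfac p (z * p ^ k) n"
  using qinf_split[OF assms, of "z * p ^ n" k] qinf_split[OF assms, of "z * p ^ k" n]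
  by (simp add: mult_ac)

text \<open>For c = A2 p^n the numerator parameters D2 c and C1 c B2/A2 are p^n times the
  denominator parameters D2 A2 and B2 C1. Their quotients are expanded by
  \<open>saalschuetz_symmetric\<close> into n+1 pieces, and each piece, summed over k, is a 6phi5
  series. The conditions \<open>small\<close> are those of \<open>phi65_sum\<close>.\<close>

lemma w8_sum_special:
  assumes p: "norm p < 1" "p \<noteq> 0"
    and nz: "A2 \<noteq> 0" "B2 \<noteq> 0" "C1 \<noteq> 0" "D1 \<noteq> 0" "D2 \<noteq> 0" "D3 \<noteq> 0"
    and c: "c = A2 * p ^ n"
    and u: "norm (B2 * C1 * c * D2 / p) < 1"
    and Z: "norm (D1 * D3 * A2 / B2) < 1"
    and small: "norm (C1 * c * D1 * D2) < 1" "norm (C1 * c * D2 * D3) < 1"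
      "norm (D1 * D2 * D3 * C1 * c / B2) < 1"
  shows "w8_term p A2 B2 C1 D1 D2 D3 c sums
    (qinf p (D2 * c) * qinf p (D1 * c) * qinf p (D3 * c) * qinf p (D1 * D2 * D3 * C1 * c / B2) * qfac p p n *
     (\<Sum>j\<le>n. qfac p (B2 / D1) j * qfac p (B2 / D3) j * qfac p (D2 * C1) j * (D1 * D3 * A2 / B2) ^ j *
        qinf p (B2 * C1 * p ^ j) * qfac p (D2 * A2 * p ^ j) (n - j) /
        (qfac p p j * qfac p p (n - j) * qinf p (D1 * D3 * A2 / B2 * p ^ (n - j)))))"
proof -
  define e f b1 b3 b5 u Z where "e = D2 * A2" and "f = B2 * C1" and "b1 = B2 / D1" and "b3 = B2 / D3"
    and "b5 = D2 * C1" and "u = B2 * C1 * c * D2 / p" and "Z = D1 * D3 * A2 / B2"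
  define y where "y = D1 * D2 * D3 * C1 * c / B2"
  have q: "qfac p p m \<noteq> 0" for m by (rule qfac_self_nonzero[OF p(1)])
  have nz': "b1 \<noteq> 0" "b3 \<noteq> 0" "b5 \<noteq> 0" "f \<noteq> 0"
    using nz by (simp_all add: b1_def b3_def b5_def f_def)
  have up: "u * p = e * f * p ^ n"
    using p by (simp add: u_def e_def f_def c)
  have uq: "qinf p (u * p ^ m) \<noteq> 0" for m
    using u norm_mult_power_le[OF p(1), of u m] by (intro qinf_nonzero p) (auto simp: u_def)
  define P where "P = (\<lambda>j. qinf p (e * p ^ n) * qinf p (f * p ^ n) * qfac p p n / (qfac p p j * qfac p p (n - j)) *
    qfac p (e * p ^ j) (n - j) * qfac p (f * p ^ j) (n - j) * Z ^ j * (qfac p b1 j * qfac p b3 j * qfac p b5 j))"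
  \<comment> \<open>With k = j + m the j-th piece is a 6phi5 series in m: its leading parameter is u
    p^(2j), and its other numerator parameters are b1 p^j, b3 p^j and b5 p^j = 1 /
    \<open>t j\<close>.\<close>
  define a where "a = (\<lambda>j. u * p ^ (2 * j))"
  define t where "t = (\<lambda>j. 1 / (b5 * p ^ j))"
  define g where "g = (\<lambda>j k. if j \<le> k then P j * phi65_term p (a j) (b1 * p ^ j) (b3 * p ^ j) y (t j) (k - j) else 0)"
  let ?G = "\<lambda>j. P j * (qinf p y * qinf p (D1 * c) * qinf p (D3 * c) / qinf p (Z * p ^ (n - j)))"
  have y1: "b3 * p ^ j * y = C1 * c * D1 * D2 * p ^ j" "b1 * p ^ j * y = C1 * c * D2 * D3 * p ^ j"
    and y2: "a j * t j * p = B2 * c * p ^ j" and y3: "y * t j = Z * p ^ (n - j)"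
    and y4: "a j * p = b1 * p ^ j * (b3 * p ^ j) * y"
    if "j \<le> n" for j
  proof -
    show "b3 * p ^ j * y = C1 * c * D1 * D2 * p ^ j" "b1 * p ^ j * y = C1 * c * D2 * D3 * p ^ j"
      using nz by (simp_all add: b3_def b1_def y_def)
    have "p ^ (2 * j) = p ^ j * p ^ j" by (simp add: power_add[symmetric] mult_2)
    then show "a j * t j * p = B2 * c * p ^ j" "a j * p = b1 * p ^ j * (b3 * p ^ j) * y"
      using nz p by (simp_all add: a_def t_def u_def b5_def b1_def b3_def y_def field_simps)
    have "p ^ n = p ^ j * p ^ (n - j)"
      using that by (simp add: power_add[symmetric])
    then show "y * t j = Z * p ^ (n - j)"
      using nz p by (simp add: y_def t_def Z_def b5_def c field_simps)
  qed
  have phi: "phi65_term p (a j) (b1 * p ^ j) (b3 * p ^ j) y (t j) sums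
      (qinf p y * qinf p (D1 * c) * qinf p (D3 * c) / qinf p (Z * p ^ (n - j)))" if j: "j \<le> n" for j
  proof -
    have "norm (a j) < 1"
      using norm_mult_power_le[OF p(1), of u "2 * j"] u by (simp add: a_def u_def)
    moreover have "norm (y * t j) < 1"
      using norm_mult_power_le[OF p(1), of Z "n - j"] Z by (simp add: y3[OF j] Z_def)
    moreover have "norm y < 1" using small by (simp add: y_def)
    moreover have "norm (b1 * p ^ j * y) < 1" "norm (b3 * p ^ j * y) < 1"
      unfolding y1[OF j] using small norm_mult_power_le[OF p(1)] by (meson le_less_trans)+
    ultimately have "phi65_term p (a j) (b1 * p ^ j) (b3 * p ^ j) y (t j) sums
       (qinf p y * qinf p (b3 * p ^ j * y * t j) * qinf p (b1 * p ^ j * y * t j) / qinf p (y * t j))"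
      using y4[OF j] by (intro phi65_sum p) auto
    moreover have "b3 * p ^ j * y * t j = D1 * c" "b1 * p ^ j * y * t j = D3 * c"
      unfolding y1[OF j] using nz p by (simp_all add: t_def b5_def field_simps)
    ultimately show ?thesis by (simp add: y3[OF j])
  qed
  have sums_g: "(\<lambda>k. \<Sum>j\<le>n. g j k) sums (\<Sum>j\<le>n. ?G j)"
  proof (rule sums_sum)
    fix j assume "j \<in> {..n}"
    then have j: "j \<le> n" by simp
    have "(\<lambda>m. g j (m + j)) sums ?G j"
      unfolding g_def using sums_mult[OF phi[OF j], of "P j"] by simp
    then show "g j sums ?G j"
      by (subst (asm) sums_zero_iff_shift) (auto simp: g_def)
  qed
  have w8: "w8_term p A2 B2 C1 D1 D2 D3 c k = (\<Sum>j\<le>n. g j k)" for k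
  proof -
    define W where "W = (1 - u * p ^ (2 * k)) * Z ^ k * (qfac p b1 k * qfac p b3 k * qfac p b5 k) *
      (qinf p (C1 * c * D1 * D2 * p ^ k) * qinf p (C1 * c * D2 * D3 * p ^ k) * qinf p (B2 * c * p ^ k)) /
      (qfac p p k * qinf p (u * p ^ k)) * (qinf p (e * p ^ n) * qinf p (f * p ^ n))"
    have ex: "qfac p (D2 * c) k * qinf p (D2 * A2 * p ^ k) = qinf p (e * p ^ n) * qfac p (e * p ^ k) n"
      "qfac p (C1 * c * B2 / A2) k * qinf p (B2 * C1 * p ^ k) = qinf p (f * p ^ n) * qfac p (f * p ^ k) n"
      using qfac_qinf_exchange[OF p(1), of e n k] qfac_qinf_exchange[OF p(1), of f n k] nz
      by (simp_all add: e_def f_def c mult_ac)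
    have "w8_term p A2 B2 C1 D1 D2 D3 c k =
      (1 - u * p ^ (2 * k)) * Z ^ k * (qfac p b1 k * qfac p b3 k * qfac p b5 k) *
      (qinf p (C1 * c * D1 * D2 * p ^ k) * qinf p (C1 * c * D2 * D3 * p ^ k) * qinf p (B2 * c * p ^ k)) /
      (qfac p p k * qinf p (u * p ^ k)) *
      ((qfac p (D2 * c) k * qinf p (D2 * A2 * p ^ k)) * (qfac p (C1 * c * B2 / A2) k * qinf p (B2 * C1 * p ^ k)))"
      unfolding w8_term_def u_def[symmetric] Z_def[symmetric] b1_def[symmetric] b3_def[symmetric] b5_def[symmetric]
      by (simp only: times_divide_eq_left times_divide_eq_right mult_ac)
    also have "\<dots> = W * (qfac p (e * p ^ k) n * qfac p (f * p ^ k) n)"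
      unfolding ex W_def by (simp only: mult_ac)
    also have "\<dots> = (\<Sum>j\<le>n. g j k)"
      unfolding saalschuetz_symmetric[OF p nz'(4) up] sum_distrib_left
    proof (rule sum.cong)
      fix j assume "j \<in> {..n}"
      then have j: "j \<le> n" by simp
      show "W * (if j \<le> k then qfac p p n * qfac p p k / (qfac p p j * qfac p p (n - j) * qfac p p (k - j)) *
       qfac p (e * p ^ j) (n - j) * qfac p (f * p ^ j) (n - j) * qfac p (u * p ^ k) j *
       p ^ ((n - j) * (k - j)) else 0) = g j k" (is "?lhs = _")
      proof (cases "j \<le> k")
        case True
        obtain m where k: "k = j + m" using le_Suc_ex[OF True] by blast
        have Zk: "Z ^ k * p ^ ((n - j) * m) = Z ^ j * (Z * p ^ (n - j)) ^ m"
          by (simp add: k power_add power_mult_distrib power_mult)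
        have uk: "qinf p (u * p ^ k) = qfac p (u * p ^ k) j * qinf p (a j * p ^ m)"
          using qinf_split[OF p(1), of "u * p ^ k" j] by (simp add: a_def k power_add mult_2 mult_2_right mult_ac)
        then have uj: "qfac p (u * p ^ k) j \<noteq> 0" using uq by auto
        have a2: "a j * p ^ (2 * m) = u * p ^ (2 * k)"
          by (simp add: a_def k power_add distrib_left mult_ac)
        have bk: "qfac p b k = qfac p b j * qfac p (b * p ^ j) m" for b
          by (simp add: k qfac_add)
        have ty: "(\<Prod>i<m. t j - p ^ i) * y ^ m = qfac p (b5 * p ^ j) m * (Z * p ^ (n - j)) ^ m"
        proof -
          have "(\<Prod>i<m. t j - p ^ i) = (\<Prod>i<m. t j * (1 - b5 * p ^ j * p ^ i))"
            using nz' p by (intro prod.cong) (auto simp: t_def field_simps)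
          also have "\<dots> = t j ^ m * qfac p (b5 * p ^ j) m"
            by (simp add: prod.distrib qfac_def)
          finally show ?thesis
            unfolding y3[OF j, symmetric] by (simp add: power_mult_distrib mult_ac)
        qed
        have at: "a j * t j * p ^ Suc m = B2 * c * p ^ k"
          using y2[OF j] by (simp add: k power_add mult_ac)
        have "g j k = P j * phi65_term p (a j) (b1 * p ^ j) (b3 * p ^ j) y (t j) m"
          by (simp add: g_def k)
        also have "\<dots> = P j * ((1 - u * p ^ (2 * k)) * (qfac p (b1 * p ^ j) m * qfac p (b3 * p ^ j) m *
            (qfac p (b5 * p ^ j) m * (Z * p ^ (n - j)) ^ m)) *
            (qinf p (C1 * c * D1 * D2 * p ^ k) * qinf p (C1 * c * D2 * D3 * p ^ k) * qinf p (B2 * c * p ^ k)) /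
            (qfac p p m * qinf p (a j * p ^ m)))"
          unfolding phi65_term_def a2 at y1[OF j] ty[symmetric]
          by (simp add: k power_add mult_ac)
        finally have gjk: "g j k = \<dots>" .
        define S where "S = (1 - u * p ^ (2 * k)) * (qfac p b1 j * qfac p (b1 * p ^ j) m *
           (qfac p b3 j * qfac p (b3 * p ^ j) m) * (qfac p b5 j * qfac p (b5 * p ^ j) m)) *
      (qinf p (C1 * c * D1 * D2 * p ^ k) * qinf p (C1 * c * D2 * D3 * p ^ k) * qinf p (B2 * c * p ^ k)) *
      (qinf p (e * p ^ n) * qinf p (f * p ^ n)) * qfac p p n * qfac p (e * p ^ j) (n - j) * qfac p (f * p ^ j) (n - j) /
      (qfac p p j * qfac p p (n - j) * qfac p p m * qinf p (a j * p ^ m))"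
        have kj: "k - j = m" by (simp add: k)
        have "?lhs = S * (Z ^ k * p ^ ((n - j) * m))"
          unfolding W_def S_def uk bk[of b1] bk[of b3] bk[of b5] kj using True q[of k] uj by (simp add: mult_ac)
        also have "\<dots> = g j k"
          unfolding gjk Zk S_def P_def by (simp add: mult_ac)
        finally show ?thesis .
      qed (simp add: g_def)
    qed simp
    finally show ?thesis .
  qed
  have "(\<Sum>j\<le>n. ?G j) =
    qinf p (D2 * c) * qinf p (D1 * c) * qinf p (D3 * c) * qinf p y * qfac p p n *
     (\<Sum>j\<le>n. qfac p b1 j * qfac p b3 j * qfac p b5 j * Z ^ j *
        qinf p (f * p ^ j) * qfac p (e * p ^ j) (n - j) /
        (qfac p p j * qfac p p (n - j) * qinf p (Z * p ^ (n - j))))"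
    unfolding sum_distrib_left
  proof (rule sum.cong)
    fix j assume "j \<in> {..n}"
    then have f: "qinf p (f * p ^ j) = qfac p (f * p ^ j) (n - j) * qinf p (f * p ^ n)"
      using qinf_split[OF p(1), of "f * p ^ j" "n - j"] by (simp add: power_add[symmetric] mult.assoc)
    have e: "e * p ^ n = D2 * c" by (simp add: e_def c)
    show "?G j =
      qinf p (D2 * c) * qinf p (D1 * c) * qinf p (D3 * c) * qinf p y * qfac p p n *
      (qfac p b1 j * qfac p b3 j * qfac p b5 j * Z ^ j *
        qinf p (f * p ^ j) * qfac p (e * p ^ j) (n - j) /
        (qfac p p j * qfac p p (n - j) * qinf p (Z * p ^ (n - j))))"
      unfolding P_def f e by (simp add: mult_ac)
  qed simp
  moreover have "w8_term p A2 B2 C1 D1 D2 D3 c = (\<lambda>k. \<Sum>j\<le>n. g j k)"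
    by (rule ext) (rule w8)
  ultimately show ?thesis
    using sums_g unfolding b1_def b3_def b5_def e_def f_def y_def Z_def by simp
qed

text \<open>The part of the residue at z = C1 p^j in which the special value of c shows: the
  products left over from the two cancelled families, together with the factor (p z/A2; p)_inf. Both
  finite products are split at i = j, and the lower halves are read backwards.\<close>

lemma residue_product:
  assumes p: "norm p < 1" "p \<noteq> 0" and nz: "A2 \<noteq> 0" "C1 \<noteq> 0" and j: "j \<le> n"
  shows "(\<Prod>i<n. C1 * p ^ j - A2 * p ^ i) / (\<Prod>i\<in>{..n} - {j}. C1 * p ^ j - C1 * p ^ i) *
      qinf p (p * C1 * p ^ j / A2) =
    qinf p (p * C1 / A2) * (qfac p (A2 / C1) (n - j) * (A2 / C1) ^ j / (qfac p p j * qfac p p (n - j)))"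
proof -
  define m where "m = n - j"
  have n: "n = j + m" using j by (simp add: m_def)
  have low: "(\<Prod>i<j. x * p ^ j - z * p ^ i) = (- z) ^ j * (\<Prod>i<j. p ^ i) * qfac p (p * x / z) j"
    if "z \<noteq> 0" for x z
  proof -
    have "(\<Prod>i<j. x * p ^ j - z * p ^ i) = (\<Prod>i<j. - z * p ^ i * (1 - p * x / z * p ^ (j - Suc i)))"
    proof (rule prod.cong)
      fix i assume "i \<in> {..<j}"
      then have "p ^ j = p ^ i * (p * p ^ (j - Suc i))"
        by (subst power_Suc [symmetric], subst power_add [symmetric]) simp
      then show "x * p ^ j - z * p ^ i = - z * p ^ i * (1 - p * x / z * p ^ (j - Suc i))"
        using that by (simp add: field_simps)
    qed simp
    also have "\<dots> = (- z) ^ j * (\<Prod>i<j. p ^ i) * (\<Prod>i<j. 1 - p * x / z * p ^ (j - Suc i))"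
      by (simp only: prod.distrib prod_constant card_lessThan)
    also have "(\<Prod>i<j. 1 - p * x / z * p ^ (j - Suc i)) = qfac p (p * x / z) j"
      unfolding qfac_def by (rule prod.nat_diff_reindex)
    finally show ?thesis .
  qed
  have shift: "(\<Prod>i<m. x * p ^ j - z * p ^ (j + s + i)) = (x * p ^ j) ^ m * qfac p (z * p ^ s / x) m"
    if "x \<noteq> 0" for x z s
  proof -
    have "(\<Prod>i<m. x * p ^ j - z * p ^ (j + s + i)) = (\<Prod>i<m. x * p ^ j * (1 - z * p ^ s / x * p ^ i))"
      using that p by (intro prod.cong) (auto simp: power_add field_simps)
    then show ?thesis by (simp add: prod.distrib qfac_def)
  qed
  have "(\<Prod>i<n. C1 * p ^ j - A2 * p ^ i) = (\<Prod>i<j. C1 * p ^ j - A2 * p ^ i) * (\<Prod>i<m. C1 * p ^ j - A2 * p ^ (j + i))"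
    unfolding n by (rule prod_lessThan_add)
  also have "\<dots> = (- A2) ^ j * (\<Prod>i<j. p ^ i) * qfac p (p * C1 / A2) j * ((C1 * p ^ j) ^ m * qfac p (A2 / C1) m)"
    using low[of A2 C1] shift[of C1 A2 0] nz by simp
  finally have num: "(\<Prod>i<n. C1 * p ^ j - A2 * p ^ i) =
    (- A2) ^ j * (\<Prod>i<j. p ^ i) * qfac p (p * C1 / A2) j * ((C1 * p ^ j) ^ m * qfac p (A2 / C1) m)" .
  have set: "{..n} - {j} = {..<j} \<union> (\<lambda>i. j + 1 + i) ` {..<m}"
  proof (intro set_eqI iffI)
    fix x assume x: "x \<in> {..n} - {j}"
    show "x \<in> {..<j} \<union> (\<lambda>i. j + 1 + i) ` {..<m}"
    proof (cases "x < j")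
      case False
      then have "x = j + 1 + (x - (j + 1))" "x - (j + 1) < m" using x n by auto
      then show ?thesis by blast
    qed simp
  qed (auto simp: n)
  have "(\<Prod>i\<in>{..n} - {j}. C1 * p ^ j - C1 * p ^ i) =
      (\<Prod>i<j. C1 * p ^ j - C1 * p ^ i) * (\<Prod>i<m. C1 * p ^ j - C1 * p ^ (j + 1 + i))"
    unfolding set by (subst prod.union_disjoint) (auto simp: prod.reindex inj_on_def)
  also have "\<dots> = (- C1) ^ j * (\<Prod>i<j. p ^ i) * qfac p p j * ((C1 * p ^ j) ^ m * qfac p p m)"
    using low[of C1 C1] shift[of C1 C1 1] nz by simp
  finally have den: "(\<Prod>i\<in>{..n} - {j}. C1 * p ^ j - C1 * p ^ i) =
    (- C1) ^ j * (\<Prod>i<j. p ^ i) * qfac p p j * ((C1 * p ^ j) ^ m * qfac p p m)" .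
  have "(\<Prod>i<j. p ^ i) \<noteq> 0" using p by simp
  moreover have "qinf p (p * C1 / A2) = qfac p (p * C1 / A2) j * qinf p (p * C1 * p ^ j / A2)"
    using qinf_split[OF p(1), of "p * C1 / A2" j] by simp
  moreover have "(A2 / C1) ^ j = (- A2) ^ j / (- C1) ^ j"
    by (simp add: power_divide[symmetric])
  ultimately show ?thesis
    unfolding num den m_def[symmetric] using nz p by simp
qed

section \<open>Separating contours\<close>

text \<open>The new loop runs round \<open>g1\<close>, along a path inside \<open>S\<close> to
  \<open>g2\<close>, round \<open>g2\<close> and back; the two passages along the connecting path
  cancel in every integral.\<close>

lemma closed_path_concatenation:
  assumes S: "open S" "connected S"
    and g1: "valid_path g1" "pathfinish g1 = pathstart g1" "path_image g1 \<subseteq> S"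
    and g2: "valid_path g2" "pathfinish g2 = pathstart g2" "path_image g2 \<subseteq> S"
  obtains g where "valid_path g" "pathfinish g = pathstart g" "path_image g \<subseteq> S"
    "\<And>f. f holomorphic_on S \<Longrightarrow> contour_integral g f = contour_integral g1 f + contour_integral g2 f"
proof -
  have "pathfinish g1 \<in> S" "pathstart g2 \<in> S"
    using g1 g2 pathfinish_in_path_image pathstart_in_path_image by blast+
  then obtain l where l: "polynomial_function l" "path_image l \<subseteq> S"
      "pathstart l = pathfinish g1" "pathfinish l = pathstart g2"
    using connected_open_polynomial_connected[OF S] by blast
  then have vl: "valid_path l"
    by (simp add: valid_path_polynomial_function)
  define g where "g = g1 +++ (l +++ (g2 +++ reversepath l))"
  show ?thesis
  proof (rule that)
    show "valid_path g" "pathfinish g = pathstart g" "path_image g \<subseteq> S"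
      unfolding g_def using l vl g1 g2 by (auto intro!: valid_path_join simp: path_image_join)
    fix f assume f: "f holomorphic_on S"
    have int: "f contour_integrable_on h" if "valid_path h" "path_image h \<subseteq> S" for h
      using contour_integrable_holomorphic_simple[OF f S(1) that] .
    have ints: "f contour_integrable_on g1" "f contour_integrable_on g2" "f contour_integrable_on l"
      "f contour_integrable_on reversepath l"
      using int g1 g2 l vl by auto
    then show "contour_integral g f = contour_integral g1 f + contour_integral g2 f"
      unfolding g_def using l vl g1 g2
      by (simp add: valid_path_join contour_integrable_joinI contour_integral_reversepath)
  qed
qed

lemma winding_number_via_integral:
  assumes "valid_path g" "path_image g \<subseteq> S" "w \<notin> S"
  shows "winding_number g w = 1 / (2 * pi * \<i>) * contour_integral g (\<lambda>z. 1 / (z - w))"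
  using assms by (intro winding_number_valid_path) auto

text \<open>For \<open>w\<close> outside \<open>S\<close> the winding number is the integral of a
  function holomorphic on \<open>S\<close>, so it is additive like all such integrals.\<close>

lemma closed_path_concatenation_winding:
  assumes S: "open S" "connected S"
    and g1: "valid_path g1" "pathfinish g1 = pathstart g1" "path_image g1 \<subseteq> S"
    and g2: "valid_path g2" "pathfinish g2 = pathstart g2" "path_image g2 \<subseteq> S"
  obtains g where "valid_path g" "pathfinish g = pathstart g" "path_image g \<subseteq> S"
    "\<And>f. f holomorphic_on S \<Longrightarrow> contour_integral g f = contour_integral g1 f + contour_integral g2 f"
    "\<And>w. w \<notin> S \<Longrightarrow> winding_number g w = winding_number g1 w + winding_number g2 w"
proof -
  obtain g where g: "valid_path g" "pathfinish g = pathstart g" "path_image g \<subseteq> S"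
    "\<And>f. f holomorphic_on S \<Longrightarrow> contour_integral g f = contour_integral g1 f + contour_integral g2 f"
    using closed_path_concatenation[OF S g1 g2] by blast
  have "winding_number g w = winding_number g1 w + winding_number g2 w" if w: "w \<notin> S" for w
  proof -
    have "(\<lambda>z. 1 / (z - w)) holomorphic_on S"
      using w by (intro holomorphic_intros) auto
    then show ?thesis
      using g(4) winding_number_via_integral[OF g(1,3) w] winding_number_via_integral[OF g1(1,3) w]
        winding_number_via_integral[OF g2(1,3) w] by (simp add: add_divide_distrib distrib_left)
  qed
  with g show ?thesis using that by blast
qed

text \<open>\<open>g1\<close> followed by the reverse of \<open>g2\<close> has winding number 0
  about every point outside \<open>S\<close>, so the homology form of Cauchy's theorem
  applies.\<close>

lemma separates_integral_unique:
  assumes S: "open S" "connected S" "S = - insert 0 (P \<union> Q)"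
    and f: "f holomorphic_on S"
    and g1: "separates P Q g1" and g2: "separates P Q g2"
  shows "contour_integral g1 f = contour_integral g2 f"
proof -
  have g1': "valid_path g1" "pathfinish g1 = pathstart g1" "path_image g1 \<subseteq> S"
    using g1 S(3) by (auto simp: separates_def)
  have g2': "valid_path (reversepath g2)" "pathfinish (reversepath g2) = pathstart (reversepath g2)"
    "path_image (reversepath g2) \<subseteq> S"
    using g2 S(3) by (auto simp: separates_def)
  obtain g where g: "valid_path g" "pathfinish g = pathstart g" "path_image g \<subseteq> S"
    "\<And>f. f holomorphic_on S \<Longrightarrow> contour_integral g f = contour_integral g1 f + contour_integral (reversepath g2) f"
    "\<And>w. w \<notin> S \<Longrightarrow> winding_number g w = winding_number g1 w + winding_number (reversepath g2) w"
    using closed_path_concatenation_winding[OF S(1,2) g1' g2'] by blast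
  have "winding_number g w = 0" if w: "w \<notin> S" for w
  proof -
    have "winding_number (reversepath g2) w = - winding_number g2 w"
      using g2 w S(3) by (intro winding_number_reversepath) (auto simp: separates_def valid_path_imp_path)
    moreover have "winding_number g1 w = winding_number g2 w"
      using w g1 g2 S(3) by (cases "w \<in> insert 0 P") (auto simp: separates_def)
    ultimately show ?thesis by (simp add: g(5)[OF w])
  qed
  then have "(f has_contour_integral 0) g"
    using Cauchy_theorem_global[OF S(1) f g(1,2,3)] by blast
  then have "contour_integral g f = 0"
    by (rule contour_integral_unique)
  then show ?thesis
    using g(4)[OF f] g2 by (simp add: contour_integral_reversepath separates_def)
qed

text \<open>Each point of \<open>W\<close> is isolated in the complement of \<open>S\<close>.
  Attaching a small circle around it raises the winding number there by 1 and changes it at no other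
  point outside \<open>S\<close>.\<close>

lemma separates_exists_aux:
  assumes S: "open S" "connected S" and "finite W" and W: "\<And>w. w \<in> W \<Longrightarrow> w \<notin> S"
    and g0: "valid_path g0" "pathfinish g0 = pathstart g0" "path_image g0 \<subseteq> S"
    and iso: "\<And>w. w \<in> W \<Longrightarrow> \<exists>e>0. cball w e \<inter> - S \<subseteq> {w}"
  shows "\<exists>g. valid_path g \<and> pathfinish g = pathstart g \<and> path_image g \<subseteq> S \<and>
    (\<forall>w. w \<notin> S \<longrightarrow> winding_number g w = winding_number g0 w + (if w \<in> W then 1 else 0))"
  using assms(3) W iso
proof (induction W)
  case empty
  then show ?case using g0 by auto
next
  case (insert v W)
  then obtain g where g: "valid_path g" "pathfinish g = pathstart g" "path_image g \<subseteq> S"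
    "\<And>w. w \<notin> S \<Longrightarrow> winding_number g w = winding_number g0 w + (if w \<in> W then 1 else 0)"
    by auto
  obtain e where e: "e > 0" "cball v e \<inter> - S \<subseteq> {v}"
    using insert.prems(2)[of v] by blast
  have c: "valid_path (circlepath v e)" "pathfinish (circlepath v e) = pathstart (circlepath v e)"
    "path_image (circlepath v e) \<subseteq> S"
    using e by (auto simp: dist_norm)
  obtain h where h: "valid_path h" "pathfinish h = pathstart h" "path_image h \<subseteq> S"
    "\<And>f. f holomorphic_on S \<Longrightarrow> contour_integral h f = contour_integral g f + contour_integral (circlepath v e) f"
    "\<And>w. w \<notin> S \<Longrightarrow> winding_number h w = winding_number g w + winding_number (circlepath v e) w"
    by (rule closed_path_concatenation_winding[OF S g(1-3) c]) metis
  have "winding_number h w = winding_number g0 w + (if w \<in> insert v W then 1 else 0)" if w: "w \<notin> S" for w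
  proof (cases "w = v")
    case True
    then show ?thesis
      using h(5)[OF w] g(4)[OF w] insert.hyps e by (simp add: winding_number_circlepath)
  next
    case False
    then have "w \<notin> cball v e" using e w by auto
    then have "winding_number (circlepath v e) w = 0"
      using e by (intro winding_number_zero_outside[of _ "cball v e"]) auto
    then show ?thesis
      using h(5)[OF w] g(4)[OF w] False by simp
  qed
  then show ?case using h(1-3) by blast
qed

text \<open>A small circle about 0 leaves out all of \<open>Q\<close> and encloses all but finitely
  many points of \<open>P\<close>; the remaining ones are collected by
  \<open>separates_exists_aux\<close>.\<close>

lemma separates_exists:
  fixes P Q :: "complex set"
  assumes P: "countable P" "bounded P" "\<And>e. e > 0 \<Longrightarrow> finite (P - ball 0 e)" and Q: "countable Q" "0 \<notin> Q"
    "\<And>r. finite (Q \<inter> cball 0 r)" and PQ: "P \<inter> Q = {}"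
  shows "open (- insert 0 (P \<union> Q))" "connected (- insert 0 (P \<union> Q))" "\<exists>g. separates P Q g"
proof -
  define S where "S = - insert 0 (P \<union> Q)"
  \<comment> \<open>Only 0 can be an accumulation point: near \<open>w\<close> the moduli lie
    between 3/4 and 5/4 of that of \<open>w\<close>, and the annulus defining \<open>F\<close> holds
    finitely many points of either family.\<close>
  have iso: "\<exists>d>0. cball w d \<inter> insert 0 (P \<union> Q) \<subseteq> {w}" if w: "w \<noteq> 0" for w
  proof -
    define F where "F = (P - ball 0 (norm w / 2)) \<union> (Q \<inter> cball 0 (2 * norm w))"
    have fin: "finite (F - {w})"
      using P(3)[of "norm w / 2"] Q(3)[of "2 * norm w"] w by (auto simp: F_def)
    obtain d where d: "d > 0" "\<And>x. x \<in> F - {w} \<Longrightarrow> d \<le> dist w x"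
      using finite_set_avoid[OF fin, of w] by blast
    show ?thesis
    proof (intro exI[of _ "min (d / 2) (norm w / 4)"] conjI subsetI)
      show "min (d / 2) (norm w / 4) > 0" using d w by simp
      fix x assume x: "x \<in> cball w (min (d / 2) (norm w / 4)) \<inter> insert 0 (P \<union> Q)"
      then have dx: "dist w x \<le> d / 2" "dist w x \<le> norm w / 4" by auto
      have "norm w \<le> dist w x + norm x" "norm x \<le> norm w + dist w x"
        using norm_triangle_ineq[of "w - x" x] norm_triangle_ineq[of w "x - w"]
        by (simp_all add: dist_norm norm_minus_commute)
      then have nx: "norm x \<ge> 3/4 * norm w" "norm x \<le> 5/4 * norm w" using dx by auto
      then have "x \<noteq> 0" using w by auto
      then have "x \<in> F" using x nx w by (auto simp: F_def not_less)
      then show "x \<in> {w}" using d(1) d(2)[of x] dx(1) by (cases "x = w") auto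
    qed
  qed
  have "\<exists>e>0. ball x e \<subseteq> S" if "x \<in> S" for x
  proof -
    have "x \<noteq> 0" using that by (auto simp: S_def)
    from iso[OF this] obtain d where d: "d > 0" "cball x d \<inter> insert 0 (P \<union> Q) \<subseteq> {x}" by blast
    have "y \<in> S" if "y \<in> ball x d" for y
    proof (rule ccontr)
      assume "y \<notin> S"
      then have "y \<in> cball x d \<inter> insert 0 (P \<union> Q)" using that by (simp add: S_def)
      then have "y = x" using d(2) by blast
      then show False using \<open>x \<in> S\<close> \<open>y \<notin> S\<close> by simp
    qed
    then show ?thesis using d(1) by blast
  qed
  then have op: "open S" by (simp add: open_contains_ball)
  have conn: "connected S"
    unfolding S_def using P Q
    by (intro path_connected_imp_connected path_connected_complement_countable) auto
  obtain r0 where r0: "r0 > 0" "cball 0 r0 \<inter> Q = {}"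
  proof -
    obtain d where d: "d > 0" "\<forall>x\<in>Q \<inter> cball 0 1. x \<noteq> 0 \<longrightarrow> d \<le> dist 0 x"
      using finite_set_avoid[OF Q(3)[of 1], of 0] by blast
    show ?thesis
    proof (rule that[of "min (d / 2) 1"])
      have False if x: "x \<in> cball 0 (min (d / 2) 1) \<inter> Q" for x
      proof -
        have "x \<in> Q \<inter> cball 0 1" "x \<noteq> 0" "norm x \<le> d / 2"
          using Q(2) x by auto
        then have "d \<le> norm x" "norm x \<le> d / 2"
          using d(2) by force+
        then show False using d(1) by simp
      qed
      then show "cball 0 (min (d / 2) 1) \<inter> Q = {}" by blast
    qed (use d in simp)
  qed
  \<comment> \<open>The moduli of the points of \<open>P\<close> form a countable set, so some
    radius avoids them.\<close>
  obtain r where r: "0 < r" "r < r0" "\<forall>w\<in>P. norm w \<noteq> r"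
  proof -
    have "uncountable ({0<..<r0} - norm ` P)"
      using r0 P(1) by (intro uncountable_minus_countable) (auto simp: uncountable_open_interval)
    then obtain r where "r \<in> {0<..<r0} - norm ` P"
      by (metis countable_empty ex_in_conv)
    then show ?thesis using that by auto
  qed
  define W where "W = P - ball 0 r"
  have g0: "path_image (circlepath 0 r) \<subseteq> S"
  proof
    fix x assume "x \<in> path_image (circlepath 0 r)"
    then have "norm x = r" using r by (simp add: dist_norm)
    then have "x \<in> cball 0 r0" "x \<notin> P" "x \<noteq> 0" using r by auto
    moreover from this(1) have "x \<notin> Q" using r0(2) by blast
    ultimately show "x \<in> S" by (simp add: S_def)
  qed
  have "\<exists>e>0. cball w e \<inter> - S \<subseteq> {w}" if "w \<in> W" for w
  proof -
    have "w \<noteq> 0" using that r by (auto simp: W_def)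
    from iso[OF this] show ?thesis by (simp add: S_def)
  qed
  moreover have "\<And>w. w \<in> W \<Longrightarrow> w \<notin> S" by (auto simp: W_def S_def)
  ultimately obtain g where g: "valid_path g" "pathfinish g = pathstart g" "path_image g \<subseteq> S"
    "\<And>w. w \<notin> S \<Longrightarrow> winding_number g w = winding_number (circlepath 0 r) w + (if w \<in> W then 1 else 0)"
    using separates_exists_aux[OF op conn P(3)[OF r(1), folded W_def], of "circlepath 0 r"] g0 by auto
  have out: "winding_number (circlepath 0 r) w = 0" if "norm w > r" for w
    using that r by (intro winding_number_zero_outside[of _ "cball 0 r"]) auto
  have inn: "winding_number (circlepath 0 r) w = 1" if "norm w < r" for w
    using that r by (intro winding_number_circlepath) auto
  have "separates P Q g"
    unfolding separates_def
  proof (intro conjI ballI g(1,2))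
    show "path_image g \<inter> insert 0 (P \<union> Q) = {}" using g(3) by (auto simp: S_def)
    show "winding_number g w = 1" if "w \<in> insert 0 P" for w
    proof (cases "norm w < r")
      case True
      then have "w \<notin> W" by (auto simp: W_def)
      then show ?thesis using that True inn g(4)[of w] by (auto simp: S_def)
    next
      case False
      then have "norm w > r" "w \<in> W" using that r by (auto simp: W_def)
      then show ?thesis using that out g(4)[of w] by (auto simp: S_def)
    qed
    show "winding_number g w = 0" if "w \<in> Q" for w
    proof -
      have "norm w > r0" using r0(2) that by (meson disjoint_iff mem_cball_0 not_le)
      moreover have "w \<notin> W" using PQ that by (auto simp: W_def)
      ultimately show ?thesis using that out[of w] r g(4)[of w] by (auto simp: S_def)
    qed
  qed
  then show "\<exists>g. separates P Q g" by blast
  show "open (- insert 0 (P \<union> Q))" "connected (- insert 0 (P \<union> Q))"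
    using op conn by (simp_all add: S_def)
qed

section \<open>Holomorphic dependence of the series on a parameter\<close>

text \<open>Being stable under products, this notion lets \<open>w8_term\<close> be bounded factor
  by factor, uniformly in the parameter and in the index.\<close>

definition bounded_family :: "'a set \<Rightarrow> ('a \<Rightarrow> nat \<Rightarrow> complex) \<Rightarrow> bool" where
  "bounded_family A f \<longleftrightarrow> (\<exists>K. \<forall>c\<in>A. \<forall>k. norm (f c k) \<le> K)"

lemma bounded_familyI: "(\<And>c k. c \<in> A \<Longrightarrow> norm (f c k) \<le> K) \<Longrightarrow> bounded_family A f"
  by (auto simp: bounded_family_def)

lemma bounded_family_mult:
  assumes "bounded_family A f" "bounded_family A g"
  shows "bounded_family A (\<lambda>c k. f c k * g c k)"
proof -
  obtain K L where KL: "\<And>c k. c \<in> A \<Longrightarrow> norm (f c k) \<le> K" "\<And>c k. c \<in> A \<Longrightarrow> norm (g c k) \<le> L"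
    using assms unfolding bounded_family_def by blast
  have "norm (f c k * g c k) \<le> \<bar>K\<bar> * \<bar>L\<bar>" if "c \<in> A" for c k
    using KL(1)[OF that, of k] KL(2)[OF that, of k] unfolding norm_mult by (intro mult_mono) auto
  then show ?thesis by (rule bounded_familyI)
qed

lemma bounded_family_qfac:
  assumes p: "norm p < 1" and A: "\<And>c. c \<in> A \<Longrightarrow> norm (b c) \<le> M"
  shows "bounded_family A (\<lambda>c k. qfac p (b c) k)"
proof (rule bounded_familyI)
  fix c k assume "c \<in> A"
  have "norm (qfac p (b c) k) \<le> exp (norm (b c) / (1 - norm p))"
    by (rule norm_qfac_le[OF p])
  also have "\<dots> \<le> exp (M / (1 - norm p))"
    using p A[OF \<open>c \<in> A\<close>] by (simp add: divide_right_mono)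
  finally show "norm (qfac p (b c) k) \<le> exp (M / (1 - norm p))" .
qed

lemma bounded_family_qinf:
  assumes p: "norm p < 1" and A: "\<And>c. c \<in> A \<Longrightarrow> norm (b c) \<le> M"
  shows "bounded_family A (\<lambda>c k. qinf p (b c * p ^ k))"
proof (rule bounded_familyI)
  fix c k assume "c \<in> A"
  have "norm (qinf p (b c * p ^ k)) \<le> exp (norm (b c * p ^ k) / (1 - norm p))"
    by (rule norm_qinf_le[OF p])
  also have "\<dots> \<le> exp (M / (1 - norm p))"
    using p A[OF \<open>c \<in> A\<close>] norm_mult_power_le[OF p, of "b c" k] by (simp add: divide_right_mono)
  finally show "norm (qinf p (b c * p ^ k)) \<le> exp (M / (1 - norm p))" .
qed

lemma bounded_family_inverse_qinf:
  assumes p: "norm p < 1" and r: "0 \<le> r" "r < 1" and A: "\<And>c. c \<in> A \<Longrightarrow> norm (u c) \<le> r"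
  shows "bounded_family A (\<lambda>c k. 1 / qinf p (u c * p ^ k))"
proof -
  obtain \<delta> where \<delta>: "\<delta> > 0" "\<And>w. norm w \<le> r \<Longrightarrow> \<delta> \<le> norm (qinf p w)"
    using qinf_bounded_below[OF p r(2,1)] by blast
  show ?thesis
  proof (rule bounded_familyI)
    fix c k assume "c \<in> A"
    then have "\<delta> \<le> norm (qinf p (u c * p ^ k))"
      using A[of c] norm_mult_power_le[OF p, of "u c" k] by (intro \<delta>(2)) auto
    then show "norm (1 / qinf p (u c * p ^ k)) \<le> 1 / \<delta>"
      using \<delta>(1) unfolding norm_divide by (intro divide_left_mono frac_le) auto
  qed
qed

text \<open>On a closed subdisc all factors of \<open>w8_term\<close> other than the power of Z = D1
  D3 A2 / B2 are bounded uniformly in k, which leaves a geometric majorant. The disc is |u| < 1 for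
  the leading parameter u = B2 C1 c D2 / p; this keeps the denominators (u p^k; p)_inf away from
  0.\<close>

lemma w8_series_holomorphic:
  assumes p: "norm p < 1" "p \<noteq> 0" and nz: "B2 * C1 * D2 \<noteq> 0" and Z: "norm (D1 * D3 * A2 / B2) < 1"
  shows "(\<lambda>c. \<Sum>k. w8_term p A2 B2 C1 D1 D2 D3 c k) holomorphic_on {c. norm (B2 * C1 * c * D2 / p) < 1}"
    and "norm (B2 * C1 * c * D2 / p) < 1 \<Longrightarrow> summable (w8_term p A2 B2 C1 D1 D2 D3 c)"
proof -
  let ?w = "w8_term p A2 B2 C1 D1 D2 D3"
  define \<kappa> where "\<kappa> = B2 * C1 * D2 / p"
  have \<kappa>0: "norm \<kappa> > 0" using nz p by (simp add: \<kappa>_def)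
  have \<kappa>: "B2 * C1 * c * D2 / p = \<kappa> * c" for c by (simp add: \<kappa>_def)
  define R where "R = 1 / norm \<kappa>"
  have R: "{c. norm (\<kappa> * c) < 1} = ball 0 R"
    using \<kappa>0 by (auto simp: R_def norm_mult field_simps)
  define Z where "Z = D1 * D3 * A2 / B2"
  have Z1: "norm Z < 1" using Z by (simp add: Z_def)
  have bound: "\<exists>K. \<forall>c\<in>cball 0 s. \<forall>k. norm (?w c k) \<le> K * norm Z ^ k"
    if s: "0 \<le> s" "s < R" for s
  proof -
    let ?A = "cball 0 s :: complex set"
    have lin: "norm (x * c) \<le> norm x * s" if "c \<in> ?A" for c x :: complex
      using that by (auto simp: norm_mult intro: mult_left_mono)
    have r: "norm \<kappa> * s < 1" using s \<kappa>0 by (simp add: R_def field_simps)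
    have b1: "bounded_family ?A (\<lambda>c k. 1 - \<kappa> * c * p ^ (2 * k))"
    proof (rule bounded_familyI)
      fix c k assume "c \<in> ?A"
      then have "norm (\<kappa> * c * p ^ (2 * k)) \<le> norm \<kappa> * s"
        using lin[of c \<kappa>] norm_mult_power_le[OF p(1), of "\<kappa> * c" "2 * k"] by simp
      then show "norm (1 - \<kappa> * c * p ^ (2 * k)) \<le> 1 + norm \<kappa> * s"
        using norm_triangle_ineq4[of 1 "\<kappa> * c * p ^ (2 * k)"] by simp
    qed
    have q1: "bounded_family ?A (\<lambda>c k. qfac p x k)" for x
      by (rule bounded_family_qfac[OF p(1), where M = "norm x"]) simp
    have q2: "bounded_family ?A (\<lambda>c k. qfac p (x * c) k)" for x
      using lin by (rule bounded_family_qfac[OF p(1)])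
    have i1: "bounded_family ?A (\<lambda>c k. qinf p (x * p ^ k))" for x
      by (rule bounded_family_qinf[OF p(1), where M = "norm x"]) simp
    have i2: "bounded_family ?A (\<lambda>c k. qinf p (x * c * p ^ k))" for x
      using lin by (rule bounded_family_qinf[OF p(1)])
    have d1: "bounded_family ?A (\<lambda>c k. 1 / qfac p p k)"
      using inverse_qfac_self_bounded[OF p(1)] by (metis bounded_familyI)
    have d2: "bounded_family ?A (\<lambda>c k. 1 / qinf p (\<kappa> * c * p ^ k))"
      using lin[of _ \<kappa>] r s by (intro bounded_family_inverse_qinf[OF p(1), where r = "norm \<kappa> * s"]) auto
    let ?f = "\<lambda>c k. (1 - \<kappa> * c * p ^ (2 * k)) *
     (qfac p (B2 / D1) k * qfac p (D2 * c) k * qfac p (B2 / D3) k * qfac p (C1 * B2 / A2 * c) k *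
      qfac p (D2 * C1) k) *
     (qinf p (C1 * D1 * D2 * c * p ^ k) * qinf p (B2 * C1 * p ^ k) * qinf p (C1 * D2 * D3 * c * p ^ k) *
      qinf p (D2 * A2 * p ^ k) * qinf p (B2 * c * p ^ k)) *
     (1 / qfac p p k * (1 / qinf p (\<kappa> * c * p ^ k)))"
    have "bounded_family ?A ?f"
      by (intro bounded_family_mult b1 q1 q2 i1 i2 d1 d2)
    then obtain K where K: "\<And>c k. c \<in> ?A \<Longrightarrow> norm (?f c k) \<le> K"
      unfolding bounded_family_def by blast
    have "?w c k = ?f c k * Z ^ k" for c k
      by (simp add: w8_term_def \<kappa>_def Z_def mult_ac)
    then have "norm (?w c k) \<le> K * norm Z ^ k" if "c \<in> ?A" for c k
      using K[OF that, of k] by (simp only: norm_mult[of "?f c k"] norm_power) (intro mult_right_mono, auto)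
    then show ?thesis by blast
  qed
  have sumZ: "summable (\<lambda>k. K * norm Z ^ k)" for K :: real
    using Z1 by (intro summable_mult summable_geometric) simp
  show "(\<lambda>c. \<Sum>k. ?w c k) holomorphic_on {c. norm (B2 * C1 * c * D2 / p) < 1}"
    unfolding \<kappa> R
  proof (rule holomorphic_uniform_sequence[where f = "\<lambda>n c. \<Sum>k<n. ?w c k"])
    show "(\<lambda>c. \<Sum>k<n. ?w c k) holomorphic_on ball 0 R" for n
    proof (rule holomorphic_on_sum)
      fix k
      have "qinf p (B2 * C1 * c * D2 / p * p ^ k) \<noteq> 0" if "c \<in> ball 0 R" for c
      proof (rule qinf_nonzero[OF p(1)])
        have "norm (\<kappa> * c) < 1" using that R by blast
        then show "norm (B2 * C1 * c * D2 / p * p ^ k) < 1"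
          unfolding \<kappa> using norm_mult_power_le[OF p(1), of "\<kappa> * c" k] by simp
      qed
      then show "(\<lambda>c. ?w c k) holomorphic_on ball 0 R"
        unfolding w8_term_def divide_inverse[of _ p] divide_inverse[of _ A2]
        using qfac_self_nonzero[OF p(1)] p
        by (intro holomorphic_intros) (auto simp: divide_inverse)
    qed
    fix x :: complex assume x: "x \<in> ball 0 R"
    define d where "d = (R - norm x) / 2"
    have d: "d > 0" "norm x + d < R" using x by (auto simp: d_def field_simps)
    have sub: "cball x d \<subseteq> cball 0 (norm x + d)"
    proof
      fix c assume "c \<in> cball x d"
      then show "c \<in> cball 0 (norm x + d)"
        using norm_triangle_ineq2[of c x] by (simp add: dist_norm norm_minus_commute)
    qed
    obtain K where K: "\<forall>c\<in>cball 0 (norm x + d). \<forall>k. norm (?w c k) \<le> K * norm Z ^ k"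
      using bound[of "norm x + d"] d by auto
    have "uniform_limit (cball x d) (\<lambda>n c. \<Sum>k<n. ?w c k)
        (\<lambda>c. \<Sum>k. ?w c k) sequentially"
      by (rule Weierstrass_m_test[OF _ sumZ[of K]]) (use K sub in blast)
    moreover have "cball x d \<subseteq> ball 0 R" using sub d by force
    ultimately show "\<exists>d>0. cball x d \<subseteq> ball 0 R \<and> uniform_limit (cball x d)
        (\<lambda>n c. \<Sum>k<n. ?w c k) (\<lambda>c. \<Sum>k. ?w c k) sequentially"
      using d by blast
  qed simp
  show "summable (?w c)" if "norm (B2 * C1 * c * D2 / p) < 1"
  proof -
    have "c \<in> ball 0 R" using that unfolding \<kappa> R[symmetric] by simp
    then have "norm c < R" by simp
    then obtain K where K: "\<forall>c'\<in>cball 0 (norm c). \<forall>k. norm (?w c' k) \<le> K * norm Z ^ k"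
      using bound[of "norm c"] norm_ge_zero by blast
    have "norm (?w c k) \<le> K * norm Z ^ k" for k
      using K by simp
    then show ?thesis
      by (intro summable_comparison_test'[OF sumZ[of K], of 0])
  qed
qed

section \<open>The contour integral\<close>

text \<open>Three relations among the parameters of the integrand allow writing three of its numerator
  parameters as \<open>p * C1 * c / A2\<close>, \<open>p / A2\<close> and \<open>D1 * D2 * D3 * A2 / B2\<close>.\<close>

definition kernel ::
  "complex \<Rightarrow> complex \<Rightarrow> complex \<Rightarrow> complex \<Rightarrow> complex \<Rightarrow> complex \<Rightarrow> complex \<Rightarrow> complex \<Rightarrow> complex \<Rightarrow> complex"
  where
  "kernel p A2 B2 C1 D1 D2 D3 c z =
     qinf p (p * C1 * c / A2 / z) * qinf p (A2 / z) / (qinf p (D1 * z) * qinf p (D2 * z)) *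
     (qinf p (p / A2 * z) * qinf p (B2 * z) * qinf p (D1 * D2 * D3 * A2 / B2 * z) /
      (qinf p (C1 / z) * qinf p (c / z) * qinf p (D3 * z))) / z"

definition inner_set :: "complex \<Rightarrow> complex \<Rightarrow> complex \<Rightarrow> complex set" where
  "inner_set p C1 c = range (\<lambda>j::nat. C1 * p ^ j) \<union> range (\<lambda>j::nat. c * p ^ j)"

definition outer_set :: "complex \<Rightarrow> complex \<Rightarrow> complex \<Rightarrow> complex \<Rightarrow> complex set" where
  "outer_set p D1 D2 D3 = (\<Union>D\<in>{D1, D2, D3}. range (\<lambda>j::nat. 1 / (D * p ^ j)))"

text \<open>The arbitrary choice of contour mirrors \<open>F_contour\<close>, so that the two
  expressions can be matched literally; \<open>kernel_integral_eq\<close> gives independence of the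
  choice.\<close>

definition kernel_integral where
  "kernel_integral p A2 B2 C1 D1 D2 D3 c =
     contour_integral (SOME \<gamma>. separates (inner_set p C1 c) (outer_set p D1 D2 D3) \<gamma>)
       (kernel p A2 B2 C1 D1 D2 D3 c)"

lemma finite_large_powers:
  assumes p: "norm p < 1" and e: "e > 0"
  shows "finite (range (\<lambda>j::nat. a * p ^ j) - ball (0 :: complex) e)"
proof -
  have "(\<lambda>j. a * p ^ j) \<longlonglongrightarrow> a * 0"
    using p by (intro tendsto_intros LIMSEQ_power_zero)
  then have "\<forall>\<^sub>F j in sequentially. dist (a * p ^ j) 0 < e"
    using e by (intro tendstoD) simp_all
  then obtain N where N: "\<And>j. j \<ge> N \<Longrightarrow> dist (a * p ^ j) 0 < e"
    by (auto simp: eventually_sequentially)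
  have "range (\<lambda>j. a * p ^ j) - ball 0 e \<subseteq> (\<lambda>j. a * p ^ j) ` {..<N}"
  proof safe
    fix j :: nat assume "a * p ^ j \<notin> ball 0 e"
    then have "\<not> j \<ge> N" using N[of j] by (auto simp: dist_commute)
    then show "a * p ^ j \<in> (\<lambda>j. a * p ^ j) ` {..<N}" by (intro imageI) simp
  qed
  then show ?thesis by (rule finite_subset) simp
qed

lemma inner_set_props:
  assumes p: "norm p < 1"
  shows "countable (inner_set p C1 c)" "bounded (inner_set p C1 c)"
    "e > 0 \<Longrightarrow> finite (inner_set p C1 c - ball 0 e)"
proof -
  show "countable (inner_set p C1 c)" by (auto simp: inner_set_def)
  show "finite (inner_set p C1 c - ball 0 e)" if "e > 0" for e
    unfolding inner_set_def Un_Diff using finite_large_powers[OF p that] by simp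
  have "norm w \<le> max (norm C1) (norm c)" if "w \<in> inner_set p C1 c" for w
    using that norm_mult_power_le[OF p, of C1] norm_mult_power_le[OF p, of c]
    by (fastforce simp: inner_set_def le_max_iff_disj)
  then show "bounded (inner_set p C1 c)" by (auto simp: bounded_iff)
qed

lemma finite_small_inverse_powers:
  assumes p: "norm p < 1" "p \<noteq> 0" and D: "D \<noteq> 0"
  shows "finite (range (\<lambda>j::nat. 1 / (D * p ^ j)) \<inter> cball (0 :: complex) r)"
proof -
  have fin: "finite (range (\<lambda>j::nat. D * p ^ j) - ball 0 (1 / (\<bar>r\<bar> + 1)))"
    by (intro finite_large_powers p) simp
  have "range (\<lambda>j::nat. 1 / (D * p ^ j)) \<inter> cball 0 r \<subseteq> (\<lambda>w. 1 / w) ` (range (\<lambda>j::nat. D * p ^ j) - ball 0 (1 / (\<bar>r\<bar> + 1)))"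
  proof safe
    fix j :: nat assume "1 / (D * p ^ j) \<in> cball 0 r"
    then have "1 / norm (D * p ^ j) \<le> r" by (simp add: norm_divide)
    then have "1 / norm (D * p ^ j) \<le> \<bar>r\<bar> + 1" by simp
    then have "1 / (\<bar>r\<bar> + 1) \<le> norm (D * p ^ j)"
      using p D by (simp add: field_simps)
    then have "D * p ^ j \<in> range (\<lambda>j::nat. D * p ^ j) - ball 0 (1 / (\<bar>r\<bar> + 1))"
      by (auto simp: not_less)
    then show "1 / (D * p ^ j) \<in> (\<lambda>w. 1 / w) ` (range (\<lambda>j::nat. D * p ^ j) - ball 0 (1 / (\<bar>r\<bar> + 1)))"
      by (rule imageI)
  qed
  then show ?thesis using fin finite_subset by blast
qed

lemma outer_set_props:
  assumes p: "norm p < 1" "p \<noteq> 0" and D: "D1 \<noteq> 0" "D2 \<noteq> 0" "D3 \<noteq> 0"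
  shows "countable (outer_set p D1 D2 D3)" "0 \<notin> outer_set p D1 D2 D3"
    "finite (outer_set p D1 D2 D3 \<inter> cball 0 r)"
proof -
  show "countable (outer_set p D1 D2 D3)" by (auto simp: outer_set_def)
  show "0 \<notin> outer_set p D1 D2 D3" using p D by (auto simp: outer_set_def)
  have "outer_set p D1 D2 D3 \<inter> cball 0 r = (\<Union>D\<in>{D1, D2, D3}. range (\<lambda>j::nat. 1 / (D * p ^ j)) \<inter> cball 0 r)"
    by (auto simp: outer_set_def)
  also have "finite \<dots>"
    using finite_small_inverse_powers[OF p] D by (intro finite_UN_I) auto
  finally show "finite (outer_set p D1 D2 D3 \<inter> cball 0 r)" .
qed

lemma closed_outer_set:
  assumes "norm p < 1" "p \<noteq> 0" "D1 \<noteq> 0" "D2 \<noteq> 0" "D3 \<noteq> 0"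
  shows "closed (outer_set p D1 D2 D3)"
proof -
  have "\<not> x islimpt outer_set p D1 D2 D3" for x
  proof -
    have "outer_set p D1 D2 D3 \<inter> cball x 1 \<subseteq> outer_set p D1 D2 D3 \<inter> cball 0 (norm x + 1)"
    proof safe
      fix y assume "y \<in> cball x 1"
      then show "y \<in> cball 0 (norm x + 1)"
        using norm_triangle_ineq2[of y x] by (simp add: dist_norm norm_minus_commute)
    qed
    then have "finite (outer_set p D1 D2 D3 \<inter> cball x 1)"
      using outer_set_props(3)[OF assms] finite_subset by blast
    then show ?thesis
      unfolding islimpt_eq_infinite_cball by (metis zero_less_one)
  qed
  then show ?thesis by (simp add: closed_limpt)
qed

lemma in_outer_set_iff:
  assumes "norm p < 1" "p \<noteq> 0" "D1 \<noteq> 0" "D2 \<noteq> 0" "D3 \<noteq> 0"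
  shows "w \<in> outer_set p D1 D2 D3 \<longleftrightarrow> qinf p (D1 * w) = 0 \<or> qinf p (D2 * w) = 0 \<or> qinf p (D3 * w) = 0"
proof -
  have "w \<in> range (\<lambda>j::nat. 1 / (D * p ^ j)) \<longleftrightarrow> qinf p (D * w) = 0" if "D \<noteq> 0" for D
    using assms(2) that unfolding qinf_eq_0_iff[OF assms(1)] image_iff
    by (auto simp: field_simps)
  then show ?thesis using assms by (simp add: outer_set_def)
qed

lemma in_inner_set_iff:
  assumes "norm p < 1" "w \<noteq> 0"
  shows "w \<in> inner_set p C1 c \<longleftrightarrow> qinf p (C1 / w) = 0 \<or> qinf p (c / w) = 0"
proof -
  have "w \<in> range (\<lambda>j::nat. a * p ^ j) \<longleftrightarrow> qinf p (a / w) = 0" for a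
    using assms(2) unfolding qinf_eq_0_iff[OF assms(1)] image_iff
    by (auto simp: field_simps)
  then show ?thesis by (simp add: inner_set_def)
qed

text \<open>A coincidence a p^j = 1/(D p^i) means a = 1/(D p^(i+j)), so only the leading points
  \<open>C1\<close> and \<open>c\<close> of the inner families have to be tested.\<close>

lemma inner_outer_disjoint:
  assumes p: "norm p < 1" "p \<noteq> 0" and D: "D1 \<noteq> 0" "D2 \<noteq> 0" "D3 \<noteq> 0"
    and "\<And>D. D \<in> {D1, D2, D3} \<Longrightarrow> qinf p (D * C1) \<noteq> 0" "c \<notin> outer_set p D1 D2 D3"
  shows "inner_set p C1 c \<inter> outer_set p D1 D2 D3 = {}"
proof -
  have *: "a * p ^ j \<notin> outer_set p D1 D2 D3" if "a \<notin> outer_set p D1 D2 D3" for a j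
  proof -
    have "qinf p (D * a) = 0" if "qinf p (D * (a * p ^ j)) = 0" for D
      using qinf_split[OF p(1), of "D * a" j] that by (simp add: mult_ac)
    then show ?thesis using that unfolding in_outer_set_iff[OF p D] by blast
  qed
  have "C1 \<notin> outer_set p D1 D2 D3"
    using assms(6) unfolding in_outer_set_iff[OF p D] by blast
  then show ?thesis
    using *[of C1] *[of c] assms(7) by (auto simp: inner_set_def)
qed

lemma power_inj_norm_less_1:
  fixes p :: complex
  assumes "norm p < 1" "p \<noteq> 0" "p ^ i = p ^ j"
  shows "i = j"
proof (rule ccontr)
  assume "i \<noteq> j"
  have *: "norm p ^ n < norm p ^ m" if "m < n" for m n
    using assms that by (intro power_strict_decreasing) auto
  have "norm p ^ i = norm p ^ j" using assms(3) by (metis norm_power)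
  with *[of i j] *[of j i] \<open>i \<noteq> j\<close> show False by linarith
qed

lemma contour_integral_simple_poles:
  fixes w :: "nat \<Rightarrow> complex"
  assumes S: "open S" "connected S" and N: "N holomorphic_on S" and inj: "inj_on w {..n}" and wS: "w ` {..n} \<subseteq> S"
    and g: "valid_path g" "pathfinish g = pathstart g" "path_image g \<subseteq> S - w ` {..n}"
    and out: "\<And>z. z \<notin> S \<Longrightarrow> winding_number g z = 0"
    and inn: "\<And>j. j \<le> n \<Longrightarrow> winding_number g (w j) = 1"
  shows "contour_integral g (\<lambda>z. N z / (\<Prod>i\<le>n. z - w i)) =
    2 * pi * \<i> * (\<Sum>j\<le>n. N (w j) / (\<Prod>i\<in>{..n} - {j}. w j - w i))"
proof -
  let ?f = "\<lambda>z. N z / (\<Prod>i\<le>n. z - w i)"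
  have "?f holomorphic_on S - w ` {..n}"
    by (intro holomorphic_intros holomorphic_on_subset[OF N]) auto
  then have "contour_integral g ?f = 2 * pi * \<i> * (\<Sum>z\<in>w ` {..n}. winding_number g z * residue ?f z)"
    using S g out by (intro Residue_theorem) auto
  also have "(\<Sum>z\<in>w ` {..n}. winding_number g z * residue ?f z) = (\<Sum>j\<le>n. winding_number g (w j) * residue ?f (w j))"
    using inj by (simp add: sum.reindex)
  also have "\<dots> = (\<Sum>j\<le>n. N (w j) / (\<Prod>i\<in>{..n} - {j}. w j - w i))"
  proof (rule sum.cong)
    fix j assume j: "j \<in> {..n}"
    let ?g = "\<lambda>z. N z / (\<Prod>i\<in>{..n} - {j}. z - w i)"
    let ?s = "S - w ` ({..n} - {j})"
    have "residue (\<lambda>z. ?g z / (z - w j)) (w j) = ?g (w j)"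
    proof (rule residue_simple)
      show "open ?s" using S by (intro open_Diff finite_imp_closed) auto
      show "w j \<in> ?s" using wS j inj by (auto simp: inj_on_def)
      show "?g holomorphic_on ?s"
        by (intro holomorphic_intros holomorphic_on_subset[OF N]) auto
    qed
    moreover have "(\<lambda>z. ?g z / (z - w j)) = ?f"
      using j by (auto simp: prod.remove[of "{..n}" j] mult.commute)
    ultimately show "winding_number g (w j) * residue ?f (w j) = N (w j) / (\<Prod>i\<in>{..n} - {j}. w j - w i)"
      using inn[of j] j by simp
  qed simp
  finally show ?thesis .
qed

section \<open>The contour integral as a function of c, all other parameters fixed\<close>

context
  fixes p A2 B2 C1 D1 D2 D3 :: complex
  assumes p: "norm p < 1" "p \<noteq> 0"
    and nz: "A2 \<noteq> 0" "B2 \<noteq> 0" "C1 \<noteq> 0" and D: "D1 \<noteq> 0" "D2 \<noteq> 0" "D3 \<noteq> 0"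
    and CD: "\<And>D. D \<in> {D1, D2, D3} \<Longrightarrow> qinf p (D * C1) \<noteq> 0"
begin

abbreviation (input) "ker \<equiv> kernel p A2 B2 C1 D1 D2 D3"
abbreviation (input) "inn \<equiv> inner_set p C1"
abbreviation (input) "out \<equiv> outer_set p D1 D2 D3"
abbreviation (input) "J \<equiv> kernel_integral p A2 B2 C1 D1 D2 D3"

text \<open>Split off so that differentiation in \<open>c\<close> under the integral sign concerns
  only the remaining quotient of two infinite products.\<close>

definition kernel_factor where
  "kernel_factor z = qinf p (A2 / z) / (qinf p (D1 * z) * qinf p (D2 * z)) *
     (qinf p (p / A2 * z) * qinf p (B2 * z) * qinf p (D1 * D2 * D3 * A2 / B2 * z) /
      (qinf p (C1 / z) * qinf p (D3 * z))) / z"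

lemma kernel_eq: "ker c z = kernel_factor z * (qinf p (p * C1 / A2 / z * c) / qinf p (1 / z * c))"
  by (simp add: kernel_def kernel_factor_def mult_ac)

lemma domain:
  assumes "c \<notin> out"
  shows "open (- insert 0 (inn c \<union> out))" "connected (- insert 0 (inn c \<union> out))"
    "\<exists>\<gamma>. separates (inn c) out \<gamma>"
  using separates_exists[OF inner_set_props[OF p(1)] outer_set_props[OF p D]
      inner_outer_disjoint[OF p D CD assms]] by blast+

lemma kernel_factor_holomorphic: "kernel_factor holomorphic_on (- insert 0 (inn c \<union> out))"
proof -
  have "qinf p (C1 / z) \<noteq> 0 \<and> qinf p (D1 * z) \<noteq> 0 \<and> qinf p (D2 * z) \<noteq> 0 \<and> qinf p (D3 * z) \<noteq> 0"
    if "z \<in> - insert 0 (inn c \<union> out)" for z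
    using that in_inner_set_iff[OF p(1), of z C1 c] in_outer_set_iff[OF p D, of z] by auto
  then show ?thesis
    unfolding kernel_factor_def by (intro holomorphic_intros p) auto
qed

lemma kernel_holomorphic: "ker c holomorphic_on (- insert 0 (inn c \<union> out))"
proof -
  have "qinf p (1 / z * c) \<noteq> 0" if "z \<in> - insert 0 (inn c \<union> out)" for z
    using that in_inner_set_iff[OF p(1), of z C1 c] by auto
  then show ?thesis
    unfolding kernel_eq by (intro holomorphic_intros kernel_factor_holomorphic p) auto
qed

lemma kernel_integral_eq:
  assumes "separates (inn c) out \<gamma>" "c \<notin> out"
  shows "J c = contour_integral \<gamma> (ker c)"
  unfolding kernel_integral_def
proof (rule separates_integral_unique[OF domain(1,2)[OF assms(2)] refl kernel_holomorphic])
  show "separates (inn c) out (SOME \<gamma>. separates (inn c) out \<gamma>)"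
    by (rule someI[of "separates (inn c) out", OF assms(1)])
qed (rule assms)

text \<open>Leibniz' rule is applied to an integrand continuous in the path parameter, which calls
  for a loop with continuous derivative. A polynomial loop close enough to a given one has the same
  winding numbers about all singular points.\<close>

lemma polynomial_separating_path:
  assumes c: "c \<notin> out"
  obtains \<gamma> where "polynomial_function \<gamma>" "separates (inn c) out \<gamma>"
proof -
  let ?S = "- insert 0 (inn c \<union> out)"
  obtain g where g: "separates (inn c) out g" using domain(3)[OF c] by blast
  then have vg: "valid_path g" "pathfinish g = pathstart g" "path_image g \<subseteq> ?S"
    by (auto simp: separates_def)
  have "compact (path_image g)" "closed (- ?S)"
    using vg(1) domain(1)[OF c] by (auto simp: compact_valid_path_image closed_def)
  then obtain e where e: "e > 0" "\<And>x y. x \<in> path_image g \<Longrightarrow> y \<in> - ?S \<Longrightarrow> e \<le> dist x y"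
    using separate_compact_closed[of "path_image g" "- ?S"] vg(3) by blast
  obtain h where h: "polynomial_function h" "pathstart h = pathstart g" "pathfinish h = pathfinish g"
    "\<And>t. t \<in> {0..1} \<Longrightarrow> norm (h t - g t) < e"
    using path_approx_polynomial_function[OF valid_path_imp_path[OF vg(1)] e(1)] by blast
  have vh: "valid_path h" using h(1) by (rule valid_path_polynomial_function[OF _])
  have close: "norm (h t - g t) < norm (g t - z)" if "t \<in> {0..1}" "z \<in> - ?S" for t z
  proof -
    have "g t \<in> path_image g" using that(1) by (simp add: path_image_def)
    then show ?thesis using e(2)[of "g t" z] h(4)[OF that(1)] that(2) by (simp add: dist_norm)
  qed
  have wn: "winding_number h z = winding_number g z" if "z \<in> - ?S" for z
    using vg vh h close that by (intro winding_number_nearby_loops_eq) (auto intro: valid_path_imp_path)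
  have "z \<notin> path_image h" if "z \<in> - ?S" for z
  proof
    assume "z \<in> path_image h"
    then obtain t where t: "t \<in> {0..1}" "z = h t" by (auto simp: path_image_def)
    then show False using close[OF t(1) that] by (simp add: norm_minus_commute)
  qed
  then have "separates (inn c) out h"
    using g wn vh h(2,3) unfolding separates_def by auto
  then show ?thesis using that h(1) by blast
qed

text \<open>The points c0 p^j together with their limit 0 form a compact subset of the open set of
  winding number 1, and c p^j is at most |c - c0| away from c0 p^j. So one contour serves a whole
  neighbourhood of c0.\<close>

lemma separates_nearby:
  assumes g: "separates (inn c0) out \<gamma>"
  obtains e where "e > 0" "\<And>c. c \<in> ball c0 e \<Longrightarrow> separates (inn c) out \<gamma>"
proof -
  define U where "U = {w. w \<notin> path_image \<gamma> \<and> winding_number \<gamma> w = 1}"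
  have vg: "valid_path \<gamma>" "pathfinish \<gamma> = pathstart \<gamma>"
    using g by (auto simp: separates_def)
  have "open U"
    unfolding U_def by (rule open_winding_number_levelsets[OF valid_path_imp_path[OF vg(1)] vg(2)])
  moreover have "(\<lambda>j. c0 * p ^ j) \<longlonglongrightarrow> c0 * 0"
    using p by (intro tendsto_intros LIMSEQ_power_zero)
  then have "compact (insert 0 (range (\<lambda>j. c0 * p ^ j)))"
    using compact_sequence_with_limit by fastforce
  moreover have "insert 0 (range (\<lambda>j. c0 * p ^ j)) \<subseteq> U"
    using g unfolding separates_def U_def inner_set_def by blast
  ultimately obtain e where e: "e > 0" "(\<Union>x\<in>insert 0 (range (\<lambda>j. c0 * p ^ j)). ball x e) \<subseteq> U"
    using compact_subset_open_imp_ball_epsilon_subset by blast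
  have "separates (inn c) out \<gamma>" if c: "c \<in> ball c0 e" for c
  proof -
    have "c * p ^ j \<in> U" for j
    proof -
      have "norm ((c0 - c) * p ^ j) < e"
        using norm_mult_power_le[OF p(1), of "c0 - c" j] c by (simp add: dist_norm)
      then have "c * p ^ j \<in> ball (c0 * p ^ j) e"
        by (simp add: dist_norm left_diff_distrib)
      then show ?thesis using e(2) by blast
    qed
    then show ?thesis
      using g unfolding separates_def U_def inner_set_def by blast
  qed
  then show ?thesis using that e(1) by blast
qed

text \<open>Locally the contour can be kept fixed, by \<open>separates_nearby\<close>, and the
  integral is then differentiated under the integral sign.\<close>

lemma kernel_integral_holomorphic: "J holomorphic_on - out"
proof (rule analytic_imp_holomorphic, unfold analytic_on_def, safe)
  fix c0 assume c0: "c0 \<notin> out"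
  obtain \<gamma> where \<gamma>: "polynomial_function \<gamma>" "separates (inn c0) out \<gamma>"
    using polynomial_separating_path[OF c0] .
  obtain \<gamma>' where \<gamma>': "polynomial_function \<gamma>'" "\<And>t. (\<gamma> has_vector_derivative \<gamma>' t) (at t)"
    by (rule has_vector_derivative_polynomial_function[OF \<gamma>(1)]) metis
  have vd: "vector_derivative \<gamma> (at t) = \<gamma>' t" for t
    using \<gamma>'(2) by (rule vector_derivative_at)
  obtain e1 where e1: "e1 > 0" "\<And>c. c \<in> ball c0 e1 \<Longrightarrow> separates (inn c) out \<gamma>"
    by (rule separates_nearby[OF \<gamma>(2)]) metis
  obtain e2 where e2: "e2 > 0" "ball c0 e2 \<subseteq> - out"
    using closed_outer_set[OF p D] c0 by (metis ComplI open_Compl open_contains_ball)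
  define U where "U = ball c0 (min e1 e2)"
  have U: "separates (inn c) out \<gamma>" "c \<notin> out" if "c \<in> U" for c
    using that e1 e2 by (auto simp: U_def)
  have cU: "c0 \<in> U" using e1 e2 by (simp add: U_def)
  have img: "\<gamma> t \<in> - insert 0 (inn c \<union> out)" if "c \<in> U" "t \<in> {0..1}" for c t
    using U(1)[OF that(1)] that(2) unfolding separates_def path_image_def by blast
  have t0: "\<gamma> t \<noteq> 0" if "t \<in> {0..1}" for t
    using img[OF cU that] by simp
  have den: "qinf p (1 / \<gamma> t * c) \<noteq> 0" if "c \<in> U" "t \<in> {0..1}" for c t
    using img[OF that] in_inner_set_iff[OF p(1), of "\<gamma> t" C1 c] by auto
  have cont: "continuous_on {0..1} \<gamma>" "continuous_on {0..1} \<gamma>'"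
    using \<gamma>(1) \<gamma>'(1) by (auto intro: continuous_on_polymonial_function)
  have contM: "continuous_on {0..1} (\<lambda>t. kernel_factor (\<gamma> t) * \<gamma>' t)"
    using img[OF cU] cont
    by (intro continuous_intros continuous_on_compose2[OF
          holomorphic_on_imp_continuous_on[OF kernel_factor_holomorphic[of c0]]]) auto
  define q' where "q' = deriv (qinf p)"
  have q': "(qinf p has_field_derivative q' w) (at w)" for w
    unfolding q'_def using holomorphic_qinf_UNIV[OF p(1)] holomorphic_derivI by blast
  have cq': "continuous_on UNIV q'"
    unfolding q'_def using holomorphic_qinf_UNIV[OF p(1)]
    by (intro holomorphic_on_imp_continuous_on holomorphic_deriv) auto
  define k where "k = (\<lambda>t. p * C1 / A2 / \<gamma> t)"
  define f where "f = (\<lambda>c t. kernel_factor (\<gamma> t) * \<gamma>' t * (qinf p (k t * c) / qinf p (1 / \<gamma> t * c)))"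
  define fx where "fx = (\<lambda>c t. kernel_factor (\<gamma> t) * \<gamma>' t * ((q' (k t * c) * k t * qinf p (1 / \<gamma> t * c) -
     qinf p (k t * c) * (q' (1 / \<gamma> t * c) * (1 / \<gamma> t))) / (qinf p (1 / \<gamma> t * c) * qinf p (1 / \<gamma> t * c))))"
  have "(\<lambda>c. integral (cbox 0 1) (f c)) holomorphic_on U"
  proof (rule leibniz_rule_holomorphic[where fx = fx])
    show "convex U" by (simp add: U_def)
    show "((\<lambda>c. f c t) has_field_derivative fx c t) (at c within U)" if "c \<in> U" "t \<in> cbox 0 1" for c t
    proof -
      have lin: "((\<lambda>c. qinf p (x * c)) has_field_derivative q' (x * c) * x) (at c within U)" for x
        by (rule DERIV_chain2[OF q']) (auto intro!: derivative_eq_intros)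
      show ?thesis
        unfolding f_def fx_def using den[OF that(1)] that(2)
        by (intro DERIV_cmult DERIV_divide lin) auto
    qed
    show "f c integrable_on cbox 0 1" if "c \<in> U" for c
    proof (rule integrable_continuous)
      show "continuous_on (cbox 0 1) (f c)"
        unfolding f_def k_def using contM
        by (intro continuous_on_mult[of _ "\<lambda>t. kernel_factor (\<gamma> t) * \<gamma>' t"])
          (use den[OF that] t0 cont p nz in \<open>auto intro!: continuous_intros\<close>)
    qed
    have sub: "continuous_on (U \<times> cbox 0 1) (\<lambda>x. h (snd x))" if "continuous_on {0..1} h" for h :: "real \<Rightarrow> complex"
      by (rule continuous_on_compose2[OF that]) (auto intro!: continuous_intros)
    have ck: "continuous_on (U \<times> cbox 0 1) (\<lambda>x. k (snd x))"
      unfolding k_def using t0 cont by (intro sub continuous_intros) auto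
    have cg: "continuous_on (U \<times> cbox 0 1) (\<lambda>x. 1 / \<gamma> (snd x))"
      using t0 cont by (intro sub[of "\<lambda>t. 1 / \<gamma> t"] continuous_intros) auto
    have cfst: "continuous_on (U \<times> cbox 0 1) (\<lambda>x. fst x)"
      by (intro continuous_intros)
    have cQ: "continuous_on (U \<times> cbox 0 1) (\<lambda>x. q' (h x))"
      if "continuous_on (U \<times> cbox 0 1) h" for h :: "complex \<times> real \<Rightarrow> complex"
      by (rule continuous_on_compose2[OF cq' that]) auto
    show "continuous_on (U \<times> cbox 0 1) (\<lambda>(c, t). fx c t)"
      unfolding fx_def case_prod_unfold
      by (intro continuous_on_mult continuous_on_divide continuous_on_diff sub[OF contM] cQ continuous_on_qinf p
          ck cg cfst) (use den in auto)
  qed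
  moreover have "J c = integral (cbox 0 1) (f c)" if "c \<in> U" for c
    unfolding kernel_integral_eq[OF U[OF that]] contour_integral_integral vd f_def k_def kernel_eq
    by (simp add: mult_ac)
  ultimately have "J holomorphic_on U"
    by (simp cong: holomorphic_cong)
  then show "\<exists>e>0. kernel_integral p A2 B2 C1 D1 D2 D3 holomorphic_on ball c0 e"
    unfolding U_def using e1 e2 by (intro exI[of _ "min e1 e2"]) auto
qed

text \<open>The kernel at c = A2 p^n without its n+1 simple inner poles. The n zeros and n+1 poles,
  rewritten as factors z - A2 p^i and z - C1 p^i, use up the factor 1/z, so 0 is no longer
  singular.\<close>

definition numer where
  "numer n z = (\<Prod>i<n. z - A2 * p ^ i) * qinf p (p / A2 * z) * qinf p (B2 * z) * qinf p (D1 * D2 * D3 * A2 / B2 * z) /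
     (qinf p (D1 * z) * qinf p (D2 * z) * qinf p (D3 * z))"

text \<open>For \<open>c = A2 * p ^ n\<close> the numerator cancels all inner poles except \<open>C1 * p ^ j\<close>, \<open>j \<le> n\<close>.\<close>

lemma kernel_special:
  assumes z: "z \<noteq> 0" "z \<notin> inn (A2 * p ^ n)"
  shows "ker (A2 * p ^ n) z = numer n z / (\<Prod>i\<le>n. z - C1 * p ^ i)"
proof -
  have nq: "qinf p (C1 / z) \<noteq> 0" "qinf p (A2 * p ^ n / z) \<noteq> 0"
    using in_inner_set_iff[OF p(1) z(1)] z(2) by auto
  have "qinf p (C1 / z) = qfac p (C1 / z) (Suc n) * qinf p (p * C1 * (A2 * p ^ n) / A2 / z)"
    using qinf_split[OF p(1), of "C1 / z" "Suc n"] nz by (simp add: mult_ac)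
  moreover have "qinf p (A2 / z) = qfac p (A2 / z) n * qinf p (A2 * p ^ n / z)"
    using qinf_split[OF p(1), of "A2 / z" n] by simp
  moreover have "(\<Prod>i<m. z - a * p ^ i) = z ^ m * qfac p (a / z) m" for a m
  proof -
    have "(\<Prod>i<m. z - a * p ^ i) = (\<Prod>i<m. z * (1 - a / z * p ^ i))"
      using z(1) by (intro prod.cong) (auto simp: field_simps)
    then show ?thesis by (simp add: prod.distrib qfac_def)
  qed
  ultimately show ?thesis
    using nq z(1) unfolding kernel_def numer_def lessThan_Suc_atMost[symmetric] by simp
qed

abbreviation (input) "resid n j \<equiv> numer n (C1 * p ^ j) / (\<Prod>i\<in>{..n} - {j}. C1 * p ^ j - C1 * p ^ i)"

lemma kernel_integral_special:
  assumes c: "A2 * p ^ n \<notin> out"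
  shows "J (A2 * p ^ n) = 2 * pi * \<i> *
    (\<Sum>j\<le>n. resid n j)"
proof -
  obtain g where g: "separates (inn (A2 * p ^ n)) out g"
    using domain(3)[OF c] by blast
  have disj: "inn (A2 * p ^ n) \<inter> out = {}"
    by (rule inner_outer_disjoint[OF p D CD c])
  have "J (A2 * p ^ n) = contour_integral g (ker (A2 * p ^ n))"
    by (rule kernel_integral_eq[OF g c])
  also have "\<dots> = contour_integral g (\<lambda>z. numer n z / (\<Prod>i\<le>n. z - C1 * p ^ i))"
    using g by (intro contour_integral_eq kernel_special) (auto simp: separates_def)
  also have "\<dots> = 2 * pi * \<i> *
    (\<Sum>j\<le>n. resid n j)"
  proof (rule contour_integral_simple_poles)
    \<comment> \<open>The domain may now include 0 and the inner points: the rewritten numerator is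
      regular off the outer poles, and only the C1 p^j with j at most n contribute residues.\<close>
    show "open (- out)" using closed_outer_set[OF p D] by (rule open_Compl)
    show "connected (- out)"
      using outer_set_props(1)[OF p D]
      by (intro path_connected_imp_connected path_connected_complement_countable) auto
    show "numer n holomorphic_on - out"
      unfolding numer_def using in_outer_set_iff[OF p D] by (intro holomorphic_intros p) auto
    show "inj_on (\<lambda>i. C1 * p ^ i) {..n}"
      using power_inj_norm_less_1[OF p] nz by (auto simp: inj_on_def)
    show "(\<lambda>i. C1 * p ^ i) ` {..n} \<subseteq> - out"
      using disj by (auto simp: inner_set_def)
    show "path_image g \<subseteq> - out - (\<lambda>i. C1 * p ^ i) ` {..n}"
      using g unfolding separates_def inner_set_def by blast
    show "winding_number g (C1 * p ^ j) = 1" for j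
      using g unfolding separates_def inner_set_def by blast
  qed (use g in \<open>auto simp: separates_def\<close>)
  finally show ?thesis .
qed

text \<open>Multiplication by the (D C1; p)_inf turns each 1/(D C1 p^j; p)_inf into (D C1; p)_j. The
  residue sum becomes the left side of \<open>sears\<close>, whose right side has the shape reached
  in \<open>w8_sum_special\<close>.\<close>

lemma residue_sum:
  "(\<Sum>j\<le>n. resid n j) *
     (qinf p (D1 * C1) * qinf p (D2 * C1) * qinf p (D3 * C1)) =
   qinf p (p * C1 / A2) * (qinf p (D1 * D2 * D3 * A2 * C1 / B2 * p ^ n) *
    (\<Sum>i\<le>n. qfac p (B2 / D3) i * qfac p (B2 / D1) i * qfac p (D2 * C1) i * (D1 * D3 * A2 / B2) ^ i *
       qinf p (B2 * C1 * p ^ i) *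
       qfac p (D1 * D3 * A2 / B2) (n - i) * qfac p (D2 * A2 * p ^ i) (n - i) / (qfac p p i * qfac p p (n - i))))"
proof -
  let ?d = "qinf p (D1 * C1) * qinf p (D2 * C1) * qinf p (D3 * C1)"
  \<comment> \<open>Chosen to match \<open>sears\<close> with b = B2/D3, c = B2/D1 and d = D2 C1:
    the relation b w = D1 C1 determines \<open>w\<close>, and d r = D2 A2 determines
    \<open>r\<close>.\<close>
  define w where "w = D1 * D3 * C1 / B2"
  define r where "r = A2 / C1"
  have e: "B2 / D3 * w = D1 * C1" "B2 / D1 * w = D3 * C1" "B2 / D3 * (B2 / D1) * w = B2 * C1"
    "w * (D2 * C1) * r = D1 * D2 * D3 * A2 * C1 / B2" "w * r = D1 * D3 * A2 / B2" "D2 * C1 * r = D2 * A2"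
    using nz D by (simp_all add: w_def r_def)
  let ?r = "\<lambda>j. qfac p (D1 * C1) j * qfac p (D3 * C1) j * qfac p (D2 * C1) j * qinf p (B2 * C1 * p ^ j) *
       qinf p (D1 * D2 * D3 * A2 * C1 / B2 * p ^ j) * qfac p r (n - j) * r ^ j / (qfac p p j * qfac p p (n - j))"
  have "resid n j *
      ?d =
    qinf p (p * C1 / A2) * ?r j"
    if j: "j \<le> n" for j
  proof -
    have q: "qinf p (Di * C1) = qfac p (Di * C1) j * qinf p (Di * (C1 * p ^ j))" for Di
      using qinf_split[OF p(1), of "Di * C1" j] by (simp add: mult_ac)
    have q0: "qinf p (Di * (C1 * p ^ j)) \<noteq> 0" if "Di \<in> {D1, D2, D3}" for Di
      using CD[OF that] q[of Di] by auto
    have "resid n j =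
      ((\<Prod>i<n. C1 * p ^ j - A2 * p ^ i) / (\<Prod>i\<in>{..n} - {j}. C1 * p ^ j - C1 * p ^ i) * qinf p (p * C1 * p ^ j / A2)) *
      (qinf p (B2 * C1 * p ^ j) * qinf p (D1 * D2 * D3 * A2 * C1 / B2 * p ^ j) /
       (qinf p (D1 * (C1 * p ^ j)) * qinf p (D2 * (C1 * p ^ j)) * qinf p (D3 * (C1 * p ^ j))))"
      by (simp add: numer_def mult_ac)
    also have "\<dots> = qinf p (p * C1 / A2) * (qfac p r (n - j) * r ^ j / (qfac p p j * qfac p p (n - j))) *
      (qinf p (B2 * C1 * p ^ j) * qinf p (D1 * D2 * D3 * A2 * C1 / B2 * p ^ j) /
       (qinf p (D1 * (C1 * p ^ j)) * qinf p (D2 * (C1 * p ^ j)) * qinf p (D3 * (C1 * p ^ j))))"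
      unfolding residue_product[OF p nz(1,3) j] r_def ..
    finally show ?thesis
      unfolding q[of D1] q[of D2] q[of D3] using q0[of D1] q0[of D2] q0[of D3] by (simp add: mult_ac)
  qed
  then have "(\<Sum>j\<le>n. resid n j) *
     ?d =
    qinf p (p * C1 / A2) * (\<Sum>j\<le>n. ?r j)"
    unfolding sum_distrib_right sum_distrib_left by (intro sum.cong) auto
  then show ?thesis
    using sears[OF p(1), of "B2 / D3" w "B2 / D1" "D2 * C1" r n] unfolding e by simp
qed

text \<open>Integral and series reduce to the same finite sum \<open>T\<close>. The series side
  carries 1/(Z p^(n-j); p)_inf where \<open>T\<close> has (Z; p)_(n-j), which the factor (Z; p)_inf
  reconciles.\<close>

lemma formula_special:
  assumes c: "c = A2 * p ^ n" "c \<notin> out"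
    and u: "norm (B2 * C1 * c * D2 / p) < 1"
    and Z: "norm (D1 * D3 * A2 / B2) < 1"
    and small: "norm (C1 * c * D1 * D2) < 1" "norm (C1 * c * D2 * D3) < 1"
      "norm (D1 * D2 * D3 * C1 * c / B2) < 1"
  shows "J c * (qinf p p * (qinf p (D1 * C1) * qinf p (D2 * C1) * qinf p (D3 * C1)) *
      (qinf p (D1 * c) * qinf p (D2 * c) * qinf p (D3 * c))) =
    2 * pi * \<i> * (qinf p (p * C1 / A2) * qinf p (p * c / A2) * qinf p (D1 * D3 * A2 / B2)) *
      (\<Sum>k. w8_term p A2 B2 C1 D1 D2 D3 c k)"
proof -
  define Z where "Z = D1 * D3 * A2 / B2"
  define T where "T = (\<Sum>i\<le>n. qfac p (B2 / D3) i * qfac p (B2 / D1) i * qfac p (D2 * C1) i * Z ^ i *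
       qinf p (B2 * C1 * p ^ i) *
       qfac p Z (n - i) * qfac p (D2 * A2 * p ^ i) (n - i) / (qfac p p i * qfac p p (n - i)))"
  define y where "y = D1 * D2 * D3 * C1 * c / B2"
  let ?t = "\<lambda>j. qfac p (B2 / D1) j * qfac p (B2 / D3) j * qfac p (D2 * C1) j * Z ^ j *
        qinf p (B2 * C1 * p ^ j) * qfac p (D2 * A2 * p ^ j) (n - j) /
        (qfac p p j * qfac p p (n - j) * qinf p (Z * p ^ (n - j)))"
  have Zq: "qinf p (Z * p ^ m) \<noteq> 0" for m
    using Z norm_mult_power_le[OF p(1), of Z m] by (intro qinf_nonzero p) (auto simp: Z_def)
  have y: "D1 * D2 * D3 * A2 * C1 / B2 * p ^ n = y"
    by (simp add: y_def c)
  have pc: "qinf p p = qfac p p n * qinf p (p * c / A2)"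
    using qinf_split[OF p(1), of p n] nz by (simp add: c)
  have "J c = 2 * pi * \<i> * (\<Sum>j\<le>n. resid n j)"
    using kernel_integral_special[of n] c by simp
  then have "J c * (qinf p (D1 * C1) * qinf p (D2 * C1) * qinf p (D3 * C1)) =
      2 * pi * \<i> * (qinf p (p * C1 / A2) * (qinf p y * T))"
    using residue_sum[of n] unfolding y T_def Z_def by (simp only: mult.assoc)
  moreover have "qinf p Z * (\<Sum>k. w8_term p A2 B2 C1 D1 D2 D3 c k) =
      (qinf p (D2 * c) * qinf p (D1 * c) * qinf p (D3 * c) * qinf p y * qfac p p n) * T"
  proof -
    have A: "(\<Sum>k. w8_term p A2 B2 C1 D1 D2 D3 c k) =
      qinf p (D2 * c) * qinf p (D1 * c) * qinf p (D3 * c) * qinf p y * qfac p p n *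
     (\<Sum>j\<le>n. ?t j)"
      unfolding y_def Z_def
      by (rule sums_unique[symmetric], rule w8_sum_special[OF p nz D c(1) u Z small])
    have B: "qinf p Z * (\<Sum>j\<le>n. ?t j) = T"
      unfolding T_def sum_distrib_left
    proof (rule sum.cong)
      fix j
      show "qinf p Z * ?t j =
        qfac p (B2 / D3) j * qfac p (B2 / D1) j * qfac p (D2 * C1) j * Z ^ j *
       qinf p (B2 * C1 * p ^ j) *
       qfac p Z (n - j) * qfac p (D2 * A2 * p ^ j) (n - j) / (qfac p p j * qfac p p (n - j))"
        using Zq[of "n - j"] qinf_split[OF p(1), of Z "n - j"] by (simp add: mult_ac)
    qed simp
    show ?thesis
      unfolding A by (subst mult.left_commute) (simp only: B)
  qed
  ultimately show ?thesis
    unfolding Z_def[symmetric] pc by algebra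
qed

text \<open>At c = 0 the pole family c p^j collapses into 0, which every separating contour encloses
  anyway. So 0 is an interior point of the domain of holomorphy, and the special points accumulate
  there.\<close>

theorem kernel_integral_formula:
  assumes c: "c \<notin> out" and u: "norm (B2 * C1 * c * D2 / p) < 1" and Z: "norm (D1 * D3 * A2 / B2) < 1"
  shows "J c * (qinf p p * (qinf p (D1 * C1) * qinf p (D2 * C1) * qinf p (D3 * C1)) *
      (qinf p (D1 * c) * qinf p (D2 * c) * qinf p (D3 * c))) =
    2 * pi * \<i> * (qinf p (p * C1 / A2) * qinf p (p * c / A2) * qinf p (D1 * D3 * A2 / B2)) *
      (\<Sum>k. w8_term p A2 B2 C1 D1 D2 D3 c k)"
    (is "?l c = ?r c")
proof -
  define L where "L = (\<lambda>c. ?l c - ?r c)"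
  define V where "V = {c. norm (B2 * C1 * c * D2 / p) < 1}"
  define S where "S = V - out"
  have "V = ball 0 (1 / norm (B2 * C1 * D2 / p))"
    using nz D p by (auto simp: V_def norm_mult norm_divide field_simps)
  then have V: "open V" "connected V" by simp_all
  have S: "open S" "connected S"
    unfolding S_def using V closed_outer_set[OF p D] outer_set_props(1)[OF p D]
    by (auto intro!: path_connected_imp_connected path_connected_open_diff_countable)
  have hol: "L holomorphic_on S"
    unfolding L_def
    using kernel_integral_holomorphic w8_series_holomorphic(1)[OF p _ Z, of C1 D2] nz D
    by (intro holomorphic_intros p) (auto elim!: holomorphic_on_subset simp: S_def V_def)
  \<comment> \<open>The size conditions of the 6phi5 sum are imposed only at the special points,
    where they hold for all large n because A2 p^n tends to 0.\<close>
  define good where "good = (\<lambda>c. c \<in> S \<and> norm (C1 * c * D1 * D2) < 1 \<and> norm (C1 * c * D2 * D3) < 1 \<and>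
      norm (D1 * D2 * D3 * C1 * c / B2) < 1)"
  have lim: "(\<lambda>n. A2 * p ^ n) \<longlonglongrightarrow> 0"
    using tendsto_mult[OF tendsto_const LIMSEQ_power_zero[OF p(1)], of A2] by simp
  have "0 \<in> S" using outer_set_props(2)[OF p D] by (simp add: S_def V_def)
  have small: "\<forall>\<^sub>F n in sequentially. norm (x * (A2 * p ^ n) * y) < 1" for x y
  proof -
    have "(\<lambda>n. norm (x * (A2 * p ^ n) * y)) \<longlonglongrightarrow> norm (x * 0 * y)"
      by (intro tendsto_intros lim)
    then show ?thesis by (rule order_tendstoD) simp
  qed
  have "\<forall>\<^sub>F n in sequentially. good (A2 * p ^ n)"
    unfolding good_def
    using topological_tendstoD[OF lim S(1) \<open>0 \<in> S\<close>] small[of C1 "D1 * D2"] small[of C1 "D2 * D3"]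
      small[of "D1 * D2 * D3 * C1" "1 / B2"]
    by eventually_elim (simp add: mult_ac)
  then obtain M where M: "\<And>n. n \<ge> M \<Longrightarrow> good (A2 * p ^ n)"
    by (auto simp: eventually_sequentially)
  define U where "U = (\<lambda>n. A2 * p ^ n) ` {M..}"
  have "0 islimpt U"
    unfolding islimpt_sequential
  proof (intro exI conjI allI)
    show "(\<lambda>n. A2 * p ^ (n + M)) \<longlonglongrightarrow> 0"
      using lim by (rule LIMSEQ_ignore_initial_segment)
    show "A2 * p ^ (n + M) \<in> U - {0}" for n
      using nz p by (auto simp: U_def)
  qed
  moreover have "U \<subseteq> S" using M by (auto simp: U_def good_def)
  moreover have "L z = 0" if zU: "z \<in> U" for z
  proof -
    obtain n where n: "z = A2 * p ^ n" "good z" using zU M by (auto simp: U_def)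
    then show ?thesis
      using formula_special[OF n(1)] Z by (simp add: L_def good_def S_def V_def)
  qed
  moreover have "c \<in> S" using c u by (simp add: S_def V_def)
  ultimately have "L c = 0"
    using analytic_continuation[OF hol S _ \<open>0 \<in> S\<close>, of U c] by blast
  then show ?thesis by (simp add: L_def)
qed

end

section \<open>The Askey--Wilson operator\<close>

text \<open>The polynomial core of \<open>aw_step_Suc\<close> for k = n+1, with \<open>R\<close> =
  p^n and X = q^x; the factor 1 - p s r is the very-well-poised factor 1 - (h a/p) p^(2k).\<close>

lemma aw_certificate:
  fixes X a b c d h p s r R :: complex
  assumes "s = a * R" "r = h * R"
  shows "(1 - p * s * r) *
     (h * (- (d - p * X) * ((1 - b * X) * (1 - c * X)) * ((1 - s * X) * (1 - p * s * X) * (p * X - a) * (X - r) * (X - p * r)) * (X\<^sup>2 - p) +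
           (d * X - p) * ((X - b) * (X - c)) * ((X - s) * (X - p * s) * (p - a * X) * (1 - r * X) * (1 - p * r * X)) * (1 - p * X\<^sup>2) -
           p * ((1 - s * X) * (X - s) * (1 - p * r * X) * (X - p * r)) *
             ((1 - a * X) * (1 - d * X) * ((1 - b * X) * (1 - c * X)) * (X\<^sup>2 - p) -
              (X - a) * (X - d) * ((X - b) * (X - c)) * (1 - p * X\<^sup>2))) +
      (p - h * d) * (h - a * b * c) * ((1 - s * X) * (X - s) * (1 - p * r * X) * (X - p * r)) *
        ((1 - X\<^sup>2) * (1 - p * X\<^sup>2) * (X\<^sup>2 - p))) =
    X * (a - h) * (- p * (1 - h * s) * (1 - r * d) * ((c - p * r) * (b - p * r)) * ((1 - s * X) * (X - s)) +
      h * (1 - p * R) * (d - p * s) * ((1 - s * c) * (1 - s * b)) * ((1 - p * r * X) * (X - p * r))) *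
      ((1 - X\<^sup>2) * (1 - p * X\<^sup>2) * (X\<^sup>2 - p))"
  unfolding assms by algebra

text \<open>Clearing of denominators for \<open>aw_gauged\<close>, with \<open>e0\<close> = 1 - X^2,
  \<open>e1\<close> = X^2 - p and \<open>e2\<close> = 1 - p X^2. Treating the factors as opaque
  variables keeps the large polynomials from being expanded.\<close>

lemma aw_combine:
  fixes e0 e1 e2 :: complex
  assumes nz: "X \<noteq> 0" "p \<noteq> 0" "h \<noteq> 0" "e0 \<noteq> 0" "e1 \<noteq> 0" "e2 \<noteq> 0"
    and E: "p * h * E = - E'"
    and poly: "h * (- d1 * q1 * t1 * e1 + d2 * q2 * t2 * e2 - p * t0 * (a1 * q1 * e1 - a2 * q2 * e2)) +
       E' * t0 * (e0 * e2 * e1) = M * (e0 * e2 * e1)"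
  shows "- X * d1 * q1 / (e0 * e2) * (t1 / (p * X ^ 3)) + d2 * q2 / (e0 * e1) * (t2 / (p * X\<^sup>2)) -
     (a1 * q1 / (e0 * e2) - a2 * q2 / (e0 * e1) + E) * (t0 / X\<^sup>2) = M / (h * p * X\<^sup>2)"
proof -
  let ?D = "h * p * X\<^sup>2 * (e0 * e2 * e1)"
  let ?L = "- X * d1 * q1 / (e0 * e2) * (t1 / (p * X ^ 3)) + d2 * q2 / (e0 * e1) * (t2 / (p * X\<^sup>2)) -
     (a1 * q1 / (e0 * e2) - a2 * q2 / (e0 * e1) + E) * (t0 / X\<^sup>2)"
  have "- X * d1 * q1 / (e0 * e2) * (t1 / (p * X ^ 3)) * ?D = h * (- d1 * q1 * t1 * e1)"
    using nz by (simp add: power2_eq_square power3_eq_cube)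
  moreover have "d2 * q2 / (e0 * e1) * (t2 / (p * X\<^sup>2)) * ?D = h * (d2 * q2 * t2 * e2)"
    using nz by (simp add: power2_eq_square)
  moreover have "a1 * q1 / (e0 * e2) * (t0 / X\<^sup>2) * ?D = h * (p * t0 * (a1 * q1 * e1))"
    using nz by (simp add: power2_eq_square)
  moreover have "a2 * q2 / (e0 * e1) * (t0 / X\<^sup>2) * ?D = h * (p * t0 * (a2 * q2 * e2))"
    using nz by (simp add: power2_eq_square)
  moreover have "E * (t0 / X\<^sup>2) * ?D = p * h * E * t0 * (e0 * e2 * e1)"
    using nz by (simp add: power2_eq_square)
  ultimately have "?L * ?D = h * (- d1 * q1 * t1 * e1) + h * (d2 * q2 * t2 * e2) -
     (h * (p * t0 * (a1 * q1 * e1)) - h * (p * t0 * (a2 * q2 * e2)) + p * h * E * t0 * (e0 * e2 * e1))"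
    by (simp only: distrib_right left_diff_distrib)
  also have "\<dots> = M * (e0 * e2 * e1)"
    unfolding E poly[symmetric] by (simp add: algebra_simps)
  finally have "?L * (h * p * X\<^sup>2) * (e0 * e2 * e1) = M * (e0 * e2 * e1)"
    by (simp only: mult.assoc)
  moreover have "e0 * e2 * e1 \<noteq> 0" "h * p * X\<^sup>2 \<noteq> 0" using nz by simp_all
  ultimately show ?thesis
    by (metis eq_divide_imp mult_right_cancel)
qed

lemma aw_assemble:
  fixes E :: complex
  assumes "A1 * G1 = u1 * \<kappa>" "A2 * G2 = u2 * \<kappa>" "A1 = q1" "A2 = - q2"
    "(u1 + u2 - (q1 - q2 + E) * f) * \<kappa> = 0" "G0 = f * \<kappa>"
  shows "A1 * (G1 - G0) + A2 * (G2 - G0) = E * G0"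
  using assms by algebra

context
  fixes p a b c d h :: complex
  assumes p: "norm p < 1" "p \<noteq> 0" and nz: "a \<noteq> 0" "b \<noteq> 0" "c \<noteq> 0" "d \<noteq> 0" "h \<noteq> 0"
    and u: "norm (h * a / p) < 1" and Z: "norm (b * c * p / (h * d)) < 1"
begin

text \<open>The 8W7 series in the variable \<open>X = q\<^sup>x\<close> with \<open>h = q ^ (2 + a - td + 2 i lam)\<close>, all denominators
  that may vanish being cleared: the difference equation has to hold also where the series of
  the theorem has no meaning.\<close>

definition aw_weight where
  "aw_weight k = (b * c * p / (h * d)) ^ k * (qfac p (h * d / p) k * qfac p (h / c) k * qfac p (h / b) k) *
     (qinf p (p * a / d * p ^ k) * qinf p (a * c * p ^ k) * qinf p (a * b * p ^ k)) /
     (qfac p p k * qinf p (h * a / p * p ^ k))"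

definition aw_basis where
  "aw_basis k X = qfac p (a * X) k * qfac p (a / X) k * qinf p (h * X * p ^ k) * qinf p (h / X * p ^ k)"

definition aw_summand where
  "aw_summand k X = (1 - h * a / p * p ^ (2 * k)) * aw_weight k * aw_basis k X"

text \<open>The antidifference of the image of \<open>aw_summand\<close> under
  \<open>aw_gauged\<close>. Its dependence on X is that of \<open>aw_basis\<close> with h replaced
  by h p.\<close>

definition aw_primitive where
  "aw_primitive X k = - (d * (a - h) / p) * ((b * c * p / (h * d)) ^ Suc k *
     (qfac p (h * d / p) (Suc k) * qfac p (h / c) (Suc k) * qfac p (h / b) (Suc k)) *
     (qinf p (p * a / d * p ^ k) * qinf p (a * c * p ^ k) * qinf p (a * b * p ^ k)) /
     (qfac p p k * qinf p (h * a / p * p ^ Suc k))) *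
     (qfac p (a * X) k * qfac p (a / X) k * qinf p (h * X * p ^ Suc k) * qinf p (h / X * p ^ Suc k))"

text \<open>This is -(1 - h d/p)(1 - a b c/h). In the application the two quotients are q^(1-beta+2i
  lam) and q^(1-beta-2i lam), which yields E(lambda).\<close>

definition aw_eigen where "aw_eigen = - (p - h * d) * (h - a * b * c) / (p * h)"

text \<open>The Askey--Wilson operator minus its eigenvalue, conjugated by the factor
  \<open>1 / (p X / d, p / (d X); p)\<close> that multiplies the series.\<close>

definition aw_gauged where
  "aw_gauged X f = - X * (d - p * X) * ((1 - b * X) * (1 - c * X)) / ((1 - X\<^sup>2) * (1 - p * X\<^sup>2)) * ((1 - a * X) * f (p * X)) +
     (d * X - p) * ((X - b) * (X - c)) / ((1 - X\<^sup>2) * (X\<^sup>2 - p)) * ((1 - a / X) * f (X / p)) -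
     ((1 - a * X) * (1 - d * X) * ((1 - b * X) * (1 - c * X)) / ((1 - X\<^sup>2) * (1 - p * X\<^sup>2)) -
      (X - a) * (X - d) * ((X - b) * (X - c)) / ((1 - X\<^sup>2) * (X\<^sup>2 - p)) + aw_eigen) * f X"

lemma qinf_step: "qinf p (z * p ^ k) = (1 - z * p ^ k) * qinf p (z * p ^ Suc k)"
  using qinf_split_1[OF p(1), of "z * p ^ k"] by (simp add: mult_ac)

lemma aw_den_nonzero: "qinf p (h * a / p * p ^ k) \<noteq> 0" "1 - h * a / p * p ^ k \<noteq> 0"
proof -
  show "qinf p (h * a / p * p ^ k) \<noteq> 0"
    using norm_mult_power_le[OF p(1), of "h * a / p" k] u by (intro qinf_nonzero p) auto
  then show "1 - h * a / p * p ^ k \<noteq> 0"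
    using qinf_step[of "h * a / p" k] by auto
qed

text \<open>\<open>t1\<close>, \<open>t2\<close>, \<open>t0\<close> are the values at p X, X/p and X
  relative to a common factor \<open>Y\<close>. The powers of X and p are taken out so that the
  remaining condition is polynomial.\<close>

lemma aw_gauged_eval:
  assumes X: "X \<noteq> 0" "X\<^sup>2 \<noteq> 1" "p * X\<^sup>2 \<noteq> 1" "X\<^sup>2 \<noteq> p"
    and f: "(1 - a * X) * f (p * X) = t1 / (p * X ^ 3) * Y" "(1 - a / X) * f (X / p) = t2 / (p * X\<^sup>2) * Y"
      "f X = t0 / X\<^sup>2 * Y"
    and poly: "h * (- (d - p * X) * ((1 - b * X) * (1 - c * X)) * t1 * (X\<^sup>2 - p) +
           (d * X - p) * ((X - b) * (X - c)) * t2 * (1 - p * X\<^sup>2) -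
           p * t0 * ((1 - a * X) * (1 - d * X) * ((1 - b * X) * (1 - c * X)) * (X\<^sup>2 - p) -
              (X - a) * (X - d) * ((X - b) * (X - c)) * (1 - p * X\<^sup>2))) +
      (p - h * d) * (h - a * b * c) * t0 *
        ((1 - X\<^sup>2) * (1 - p * X\<^sup>2) * (X\<^sup>2 - p)) = M * ((1 - X\<^sup>2) * (1 - p * X\<^sup>2) * (X\<^sup>2 - p))"
  shows "aw_gauged X f = M / (h * p * X\<^sup>2) * Y"
proof -
  have E: "p * h * aw_eigen = - ((p - h * d) * (h - a * b * c))"
    using p nz by (simp add: aw_eigen_def field_simps)
  have "aw_gauged X f = (- X * (d - p * X) * ((1 - b * X) * (1 - c * X)) / ((1 - X\<^sup>2) * (1 - p * X\<^sup>2)) * (t1 / (p * X ^ 3)) +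
     (d * X - p) * ((X - b) * (X - c)) / ((1 - X\<^sup>2) * (X\<^sup>2 - p)) * (t2 / (p * X\<^sup>2)) -
     ((1 - a * X) * (1 - d * X) * ((1 - b * X) * (1 - c * X)) / ((1 - X\<^sup>2) * (1 - p * X\<^sup>2)) -
      (X - a) * (X - d) * ((X - b) * (X - c)) / ((1 - X\<^sup>2) * (X\<^sup>2 - p)) + aw_eigen) * (t0 / X\<^sup>2)) * Y"
    unfolding aw_gauged_def f by (simp only: distrib_right left_diff_distrib mult.assoc)
  also have "\<dots> = M / (h * p * X\<^sup>2) * Y"
    by (subst aw_combine[OF _ _ _ _ _ _ E poly]) (use X p nz in auto)
  finally show ?thesis .
qed

text \<open>The start of the telescoping, where the primitive at index -1 counts as 0. It is
  separate because the general step extracts (a X, a/X; p)_(k-1) as part of the common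
  factor.\<close>

lemma aw_step_0:
  assumes X: "X \<noteq> 0" "X\<^sup>2 \<noteq> 1" "p * X\<^sup>2 \<noteq> 1" "X\<^sup>2 \<noteq> p"
  shows "aw_gauged X (aw_summand 0) = aw_primitive X 0"
proof -
  define w where "w = aw_weight 0"
  define Q where "Q = qinf p (h * X * p) * qinf p (h / X * p)"
  define Y where "Y = (1 - h * a / p) * w * Q"
  have q: "qinf p (h * X) = (1 - h * X) * qinf p (h * X * p)" "qinf p (h / X) = (1 - h / X) * qinf p (h / X * p)"
    "qinf p (h * (X / p)) = (1 - h * (X / p)) * qinf p (h * X)"
    "qinf p (h / (p * X)) = (1 - h / (p * X)) * qinf p (h / X)"
    using qinf_split_1[OF p(1), of "h * X"] qinf_split_1[OF p(1), of "h / X"]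
      qinf_split_1[OF p(1), of "h * (X / p)"] qinf_split_1[OF p(1), of "h / (p * X)"] p
    by (simp_all add: mult_ac)
  have q': "qinf p (h * (p * X)) = qinf p (h * X * p)" "qinf p (h / (X / p)) = qinf p (h / X * p)"
    by (simp_all add: mult_ac)
  have s0: "aw_summand 0 Z = (1 - h * a / p) * w * (qinf p (h * Z) * qinf p (h / Z))" for Z
    by (simp add: aw_summand_def aw_basis_def w_def)
  \<comment> \<open>The extra X in the numerator matches the denominators p X^3, p X^2 and X^2 of
    \<open>aw_gauged_eval\<close>, whose shape is that of the case of positive index.\<close>
  have e1: "(1 - a * X) * aw_summand 0 (p * X) = X * ((1 - a * X) * (p * X - h) * (X - h)) / (p * X ^ 3) * Y"
  proof -
    have "(1 - h / (p * X)) * (1 - h / X) = X * ((p * X - h) * (X - h)) / (p * X ^ 3)"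
      using X p by (simp add: field_simps power2_eq_square power3_eq_cube)
    then have "(1 - a * X) * ((1 - h / (p * X)) * (1 - h / X)) * Y = X * ((1 - a * X) * (p * X - h) * (X - h)) / (p * X ^ 3) * Y"
      by (simp add: mult_ac)
    then show ?thesis
      unfolding s0 q'(1) q(4) q(2) Y_def Q_def by (simp only: mult_ac)
  qed
  have e2: "(1 - a / X) * aw_summand 0 (X / p) = X * ((X - a) * (p - h * X) * (1 - h * X)) / (p * X\<^sup>2) * Y"
  proof -
    have "(1 - a / X) * (1 - h * (X / p)) = X * ((X - a) * (p - h * X)) / (p * X\<^sup>2)"
      using X p by (simp add: field_simps power2_eq_square)
    then have "(1 - a / X) * (1 - h * (X / p)) * (1 - h * X) * Y = X * ((X - a) * (p - h * X) * (1 - h * X)) / (p * X\<^sup>2) * Y"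
      by simp
    then show ?thesis
      unfolding s0 q'(2) q(3) q(1) Y_def Q_def by (simp only: mult_ac)
  qed
  have e0: "aw_summand 0 X = X * ((1 - h * X) * (X - h)) / X\<^sup>2 * Y"
  proof -
    have "1 - h / X = X * (X - h) / X\<^sup>2"
      using X by (simp add: field_simps power2_eq_square)
    then have "(1 - h * X) * (1 - h / X) * Y = X * ((1 - h * X) * (X - h)) / X\<^sup>2 * Y"
      by simp
    then show ?thesis
      unfolding s0 q(1,2) Y_def Q_def by (simp only: mult_ac)
  qed
  have "aw_gauged X (aw_summand 0) = (- (X * X) * (a - h) * (p - h * d) * (c - h) * (b - h)) / (h * p * X\<^sup>2) * Y"
    by (rule aw_gauged_eval[OF X e1 e2 e0], algebra)
  also have "\<dots> = - (d * (a - h) / p) * (b * c * p / (h * d) * (1 - h * d / p) * (1 - h / c) * (1 - h / b)) * Y"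
    using X p nz by (simp add: field_simps power2_eq_square)
  also have "\<dots> = aw_primitive X 0"
  proof -
    have "qinf p (h * a / p) = (1 - h * a / p) * qinf p (h * a / p * p)" "1 - h * a / p \<noteq> 0"
      using qinf_step[of "h * a / p" 0] aw_den_nonzero(2)[of 0] by simp_all
    then have "w * (1 - h * a / p) = qinf p (p * a / d) * qinf p (a * c) * qinf p (a * b) / qinf p (h * a / p * p)"
      by (simp add: w_def aw_weight_def)
    then have Y: "Y = qinf p (p * a / d) * qinf p (a * c) * qinf p (a * b) / qinf p (h * a / p * p) * Q"
      by (simp add: Y_def mult_ac)
    have "qfac p z (Suc 0) = 1 - z" for z by (simp add: qfac_Suc)
    then show ?thesis
      unfolding aw_primitive_def Y Q_def by (simp add: mult_ac)
  qed
  finally show ?thesis .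
qed

text \<open>The values of the k-th summand at X, p X, X/p and both primitives share the factor
  \<open>Y\<close>; dividing by it leaves the rational identity behind
  \<open>aw_certificate\<close>.\<close>

lemma aw_step_Suc:
  assumes X: "X \<noteq> 0" "X\<^sup>2 \<noteq> 1" "p * X\<^sup>2 \<noteq> 1" "X\<^sup>2 \<noteq> p"
  shows "aw_gauged X (aw_summand (Suc n)) = aw_primitive X (Suc n) - aw_primitive X n"
proof -
  define k where "k = Suc n"
  define R s r where "R = p ^ n" and "s = a * R" and "r = h * R"
  have P: "p ^ k = p * R" by (simp add: k_def R_def)
  define w where "w = aw_weight k"
  define Q where "Q = qinf p (h * X * p ^ Suc k) * qinf p (h / X * p ^ Suc k)"
  define B where "B = qfac p (a * X) n * qfac p (a / X) n"
  define Y where "Y = w * (B * Q)"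
  define \<tau> where "\<tau> = 1 - p * s * r"
  have tau: "1 - h * a / p * p ^ (2 * k) = \<tau>"
    using p by (simp add: \<tau>_def s_def r_def k_def R_def mult_2 mult_2_right power_add mult_ac)
  have b0: "qfac p (a * X) k = qfac p (a * X) n * (1 - s * X)" "qfac p (a / X) k = qfac p (a / X) n * (1 - s / X)"
    by (simp_all add: k_def qfac_Suc s_def R_def mult_ac)
  have q0: "qinf p (h * X * p ^ k) = (1 - p * r * X) * qinf p (h * X * p ^ Suc k)"
    "qinf p (h / X * p ^ k) = (1 - p * r / X) * qinf p (h / X * p ^ Suc k)"
    using qinf_step[of "h * X" k] qinf_step[of "h / X" k] unfolding P r_def by (simp_all add: mult_ac)
  have b1: "(1 - a * X) * qfac p (a * (p * X)) k = qfac p (a * X) n * (1 - s * X) * (1 - p * s * X)"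
    using qfac_Suc'[of p "a * X" k] qfac_Suc[of p "a * X" k] b0(1) unfolding P s_def by (simp add: mult_ac)
  have b1': "qfac p (a / (p * X)) k = (1 - a / (p * X)) * qfac p (a / X) n"
    using qfac_Suc'[of p "a / (p * X)" n] p by (simp add: k_def)
  have q1: "qinf p (h * (p * X) * p ^ k) = qinf p (h * X * p ^ Suc k)"
    by (simp add: mult_ac)
  have q1': "qinf p (h / (p * X) * p ^ k) = (1 - r / X) * ((1 - p * r / X) * qinf p (h / X * p ^ Suc k))"
  proof -
    have "h / (p * X) * p ^ k = h / X * p ^ n" using p by (simp add: k_def)
    then show ?thesis
      using qinf_step[of "h / X" n] q0(2) by (simp add: k_def r_def R_def)
  qed
  have b2: "(1 - a / X) * qfac p (a / (X / p)) k = qfac p (a / X) n * (1 - s / X) * (1 - p * s / X)"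
    using qfac_Suc'[of p "a / X" k] qfac_Suc[of p "a / X" k] b0(2) unfolding P s_def by (simp add: mult_ac)
  have b2': "qfac p (a * (X / p)) k = (1 - a * X / p) * qfac p (a * X) n"
    using qfac_Suc'[of p "a * X / p" n] p by (simp add: k_def)
  have q2: "qinf p (h / (X / p) * p ^ k) = qinf p (h / X * p ^ Suc k)"
    by (simp add: mult_ac)
  have q2': "qinf p (h * (X / p) * p ^ k) = (1 - r * X) * ((1 - p * r * X) * qinf p (h * X * p ^ Suc k))"
  proof -
    have "h * (X / p) * p ^ k = h * X * p ^ n" using p by (simp add: k_def)
    then show ?thesis
      using qinf_step[of "h * X" n] q0(1) by (simp add: k_def r_def R_def mult_ac)
  qed
  let ?t1 = "(1 - s * X) * (1 - p * s * X) * (p * X - a) * (X - r) * (X - p * r)"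
  let ?t2 = "(X - s) * (X - p * s) * (p - a * X) * (1 - r * X) * (1 - p * r * X)"
  let ?t0 = "(1 - s * X) * (X - s) * (1 - p * r * X) * (X - p * r)"
  let ?u1 = "(1 - s * X) * (1 - p * s * X) * ((1 - a / (p * X)) * (1 - r / X) * (1 - p * r / X))"
  let ?u2 = "(1 - s / X) * (1 - p * s / X) * (1 - a * X / p) * (1 - r * X) * (1 - p * r * X)"
  let ?u0 = "(1 - s * X) * (1 - p * r * X) * ((1 - s / X) * (1 - p * r / X))"
  \<comment> \<open>\<open>?U\<close> and \<open>?V\<close> are the primitives at k and at n = k-1,
    divided by \<open>Y\<close> and by their common constant - d (a - h) / p.\<close>
  let ?U = "(b * c * p / (h * d)) * ((1 - r * d) * (1 - p * r / c) * (1 - p * r / b)) *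
      (1 - h * s) * ((1 - s * X) * (1 - s / X))"
  let ?V = "(1 - p * s / d) * (1 - s * c) * (1 - s * b) * (1 - p * R) *
      ((1 - p * r * X) * (1 - p * r / X))"
  have e1: "(1 - a * X) * aw_summand k (p * X) =
      \<tau> * ?t1 / (p * X ^ 3) * Y"
  proof -
    have "(1 - a / (p * X)) * (1 - r / X) * (1 - p * r / X) = (p * X - a) * (X - r) * (X - p * r) / (p * X ^ 3)"
      using X p by (simp add: field_simps power3_eq_cube)
    then have f: "\<tau> * ?u1 * Y =
      \<tau> * ?t1 / (p * X ^ 3) * Y"
      by (simp add: mult_ac)
    have "(1 - a * X) * aw_summand k (p * X) = \<tau> * w * ((1 - a * X) * qfac p (a * (p * X)) k) *
       (qfac p (a / (p * X)) k * qinf p (h * (p * X) * p ^ k) * qinf p (h / (p * X) * p ^ k))"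
      unfolding aw_summand_def aw_basis_def w_def[symmetric] tau by (simp only: mult_ac)
    also have "\<dots> = \<tau> * ?u1 * Y"
      unfolding b1 b1' q1 q1' Y_def B_def Q_def by (simp only: mult_ac)
    finally show ?thesis unfolding f .
  qed
  have e2: "(1 - a / X) * aw_summand k (X / p) =
      \<tau> * ?t2 / (p * X\<^sup>2) * Y"
  proof -
    have "(1 - s / X) * (1 - p * s / X) * (1 - a * X / p) = (X - s) * (X - p * s) * (p - a * X) / (p * X\<^sup>2)"
      using X p by (simp add: field_simps power2_eq_square)
    then have f: "\<tau> * ?u2 * Y =
      \<tau> * ?t2 / (p * X\<^sup>2) * Y"
      by (simp add: mult_ac)
    have "(1 - a / X) * aw_summand k (X / p) = \<tau> * w * ((1 - a / X) * qfac p (a / (X / p)) k) *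
       (qfac p (a * (X / p)) k * qinf p (h * (X / p) * p ^ k) * qinf p (h / (X / p) * p ^ k))"
      unfolding aw_summand_def aw_basis_def w_def[symmetric] tau by (simp only: mult_ac)
    also have "\<dots> = \<tau> * ?u2 * Y"
      unfolding b2 b2' q2 q2' Y_def B_def Q_def by (simp only: mult_ac)
    finally show ?thesis unfolding f .
  qed
  have e0: "aw_summand k X = \<tau> * ?t0 / X\<^sup>2 * Y"
  proof -
    have "(1 - s / X) * (1 - p * r / X) = (X - s) * (X - p * r) / X\<^sup>2"
      using X p by (simp add: field_simps power2_eq_square)
    then have f: "\<tau> * ?u0 * Y =
      \<tau> * ?t0 / X\<^sup>2 * Y"
      by (simp add: mult_ac)
    have "aw_summand k X = \<tau> * ?u0 * Y"
      unfolding aw_summand_def aw_basis_def w_def[symmetric] tau b0 q0 Y_def B_def Q_def by (simp only: mult_ac)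
    then show ?thesis unfolding f .
  qed
  define M where "M = X * (a - h) * (- p * (1 - h * s) * (1 - r * d) * ((c - p * r) * (b - p * r)) * ((1 - s * X) * (X - s)) +
      h * (1 - p * R) * (d - p * s) * ((1 - s * c) * (1 - s * b)) * ((1 - p * r * X) * (X - p * r)))"
  have gen: "h * (- d1 * q1 * (\<tau> * t1) * f1 + d2 * q2 * (\<tau> * t2) * f2 - p * (\<tau> * t0) * g) + v * v' * (\<tau> * t0) * e =
      \<tau> * (h * (- d1 * q1 * t1 * f1 + d2 * q2 * t2 * f2 - p * t0 * g) + v * v' * t0 * e)"
    for d1 d2 q1 q2 t1 t2 t0 f1 f2 g v v' e :: complex
    by (simp add: algebra_simps)
  have "aw_gauged X (aw_summand k) = M / (h * p * X\<^sup>2) * Y"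
    by (rule aw_gauged_eval[OF X e1 e2 e0],
        unfold M_def aw_certificate[OF s_def r_def, symmetric] \<tau>_def[symmetric], rule gen)
  moreover have "aw_primitive X k = - (d * (a - h) / p) * ?U * Y"
  proof -
    define z q where "z = b * c * p / (h * d)" and "q = qinf p (h * a / p * p ^ Suc k)"
    have hs: "h * a / p * p ^ k = h * s" using p by (simp add: P s_def)
    have U: "qinf p (h * a / p * p ^ k) = (1 - h * s) * q" and hs0: "1 - h * s \<noteq> 0"
      using qinf_step[of "h * a / p" k] aw_den_nonzero(2)[of k] unfolding hs q_def by simp_all
    have V: "qfac p (h * d / p) (Suc k) = qfac p (h * d / p) k * (1 - r * d)"
      "qfac p (h / c) (Suc k) = qfac p (h / c) k * (1 - p * r / c)"
      "qfac p (h / b) (Suc k) = qfac p (h / b) k * (1 - p * r / b)"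
      using p unfolding qfac_Suc P r_def by (simp_all add: mult_ac)
    show ?thesis
      unfolding aw_primitive_def b0 Y_def B_def Q_def w_def aw_weight_def U V z_def[symmetric] q_def[symmetric]
      using hs0 by (simp add: mult_ac)
  qed
  moreover have "aw_primitive X n = - (d * (a - h) / p) * ?V * Y"
  proof -
    have "qfac p p k = qfac p p n * (1 - p * R)"
      by (simp add: k_def qfac_Suc R_def)
    moreover have "1 - p * R \<noteq> 0"
      using qfac_self_nonzero[OF p(1), of k] calculation by auto
    moreover have "qinf p (p * a / d * p ^ n) = (1 - p * s / d) * qinf p (p * a / d * p ^ k)"
      "qinf p (a * c * p ^ n) = (1 - s * c) * qinf p (a * c * p ^ k)"
      "qinf p (a * b * p ^ n) = (1 - s * b) * qinf p (a * b * p ^ k)"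
      using qinf_step[of "p * a / d" n] qinf_step[of "a * c" n] qinf_step[of "a * b" n]
      by (simp_all add: k_def s_def R_def mult_ac)
    ultimately show ?thesis
      unfolding aw_primitive_def k_def[symmetric] q0 Y_def B_def Q_def w_def aw_weight_def
      by (simp add: mult_ac)
  qed
  moreover have "M / (h * p * X\<^sup>2) = - (d * (a - h) / p) * ?U - - (d * (a - h) / p) * ?V"
  proof -
    have f1: "?U =
      p * (1 - r * d) * ((c - p * r) * (b - p * r)) * (1 - h * s) * ((1 - s * X) * (X - s)) / (h * d * X)"
    proof -
      have "1 - p * r / c = (c - p * r) / c" "1 - p * r / b = (b - p * r) / b" "1 - s / X = (X - s) / X"
        using X nz by (simp_all add: field_simps)
      then show ?thesis using nz by (simp add: mult_ac)
    qed
    have f2: "?V =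
      (1 - p * R) * (d - p * s) * ((1 - s * c) * (1 - s * b)) * ((1 - p * r * X) * (X - p * r)) / (d * X)"
    proof -
      have "1 - p * s / d = (d - p * s) / d" "1 - p * r / X = (X - p * r) / X"
        using X nz by (simp_all add: field_simps)
      then show ?thesis by (simp add: mult_ac)
    qed
    have gen: "X * A * (- p * U1 * U2 * U3 * U4 + h * V1 * V2 * V3 * V4) / (h * p * X\<^sup>2) =
      - (d * A / p) * (p * U2 * U3 * U1 * U4 / (h * d * X)) - - (d * A / p) * (V1 * V2 * V3 * V4 / (d * X))"
      for A U1 U2 U3 U4 V1 V2 V3 V4
      using X p nz by (simp add: field_simps power2_eq_square)
    show ?thesis unfolding f1 f2 M_def by (rule gen)
  qed
  ultimately show ?thesis
    unfolding k_def[symmetric] by (simp only: left_diff_distrib)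
qed

lemma aw_primitive_tendsto_0: "aw_primitive X \<longlonglongrightarrow> 0"
proof -
  have "aw_primitive X \<longlonglongrightarrow> - (d * (a - h) / p) * (0 *
     (qinf p (h * d / p) * qinf p (h / c) * qinf p (h / b)) *
     (qinf p (p * a / d * 0) * qinf p (a * c * 0) * qinf p (a * b * 0)) /
     (qinf p p * qinf p (h * a / p * 0))) *
     (qinf p (a * X) * qinf p (a / X) * qinf p (h * X * 0) * qinf p (h / X * 0))"
    unfolding aw_primitive_def
    by (intro tendsto_intros qfac_tendsto_qinf LIMSEQ_Suc LIMSEQ_power_zero p Z)
      (use qinf_nonzero[OF p(1) p(1)] in auto)
  then show ?thesis by simp
qed

lemma aw_gauged_sum:
  assumes X: "X \<noteq> 0" "X\<^sup>2 \<noteq> 1" "p * X\<^sup>2 \<noteq> 1" "X\<^sup>2 \<noteq> p"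
    and sm: "\<And>Y. Y \<in> {X, p * X, X / p} \<Longrightarrow> summable (\<lambda>k. aw_summand k Y)"
  shows "aw_gauged X (\<lambda>Y. \<Sum>k. aw_summand k Y) = 0"
proof -
  have "(\<lambda>k. aw_gauged X (aw_summand k)) sums aw_gauged X (\<lambda>Y. \<Sum>k. aw_summand k Y)"
    unfolding aw_gauged_def
    by (intro sums_add sums_diff sums_mult summable_sums sm) auto
  moreover have "(\<lambda>k. aw_gauged X (aw_summand (Suc k))) sums (0 - aw_primitive X 0)"
    unfolding aw_step_Suc[OF X] by (rule telescope_sums[OF aw_primitive_tendsto_0])
  then have "(\<lambda>k. aw_gauged X (aw_summand k)) sums 0"
    using aw_step_0[OF X] by (subst (asm) sums_Suc_iff) simp
  ultimately show ?thesis by (rule sums_unique2)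
qed

text \<open>Undoes the conjugation. \<open>F\<close> is prescribed only at X, p X and X/p, because
  the series formula for the integral is available only at regular points.\<close>

theorem askey_wilson_equation:
  assumes X: "X \<noteq> 0" "X\<^sup>2 \<noteq> 1" "p * X\<^sup>2 \<noteq> 1" "X\<^sup>2 \<noteq> p" "d * X \<noteq> 1" "d \<noteq> X"
    and m: "qinf p (p / d * X) \<noteq> 0" "qinf p (p / d / X) \<noteq> 0"
    and sm: "\<And>Y. Y \<in> {X, p * X, X / p} \<Longrightarrow> summable (\<lambda>k. aw_summand k Y)"
    and F: "\<And>Y. Y \<in> {X, p * X, X / p} \<Longrightarrow> F Y = K * (\<Sum>k. aw_summand k Y) / (qinf p (p / d * Y) * qinf p (p / d / Y))"
  shows "(1 - a * X) * (1 - b * X) * (1 - c * X) * (1 - d * X) / ((1 - X\<^sup>2) * (1 - p * X\<^sup>2)) * (F (p * X) - F X) +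
     (1 - a / X) * (1 - b / X) * (1 - c / X) * (1 - d / X) / ((1 - 1 / X\<^sup>2) * (1 - p / X\<^sup>2)) * (F (X / p) - F X) =
     aw_eigen * F X"
proof -
  let ?A1 = "(1 - a * X) * (1 - b * X) * (1 - c * X) * (1 - d * X)"
  let ?A2 = "(1 - a / X) * (1 - b / X) * (1 - c / X) * (1 - d / X)"
  let ?N = "(1 - 1 / X\<^sup>2) * (1 - p / X\<^sup>2)"
  let ?e1 = "(1 - X\<^sup>2) * (1 - p * X\<^sup>2)"
  let ?e2 = "(1 - X\<^sup>2) * (X\<^sup>2 - p)"
  define f where "f = (\<lambda>Y. \<Sum>k. aw_summand k Y)"
  define D where "D = qinf p (p / d * X) * qinf p (p / d / X)"
  have D: "D \<noteq> 0" using m by (simp add: D_def)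
  have qa: "qinf p (p / d * (X / p)) = (1 - X / d) * qinf p (p / d * X)"
    "qinf p (p / d / (p * X)) = (1 - 1 / (d * X)) * qinf p (p / d / X)"
    using qinf_split_1[OF p(1), of "p / d * (X / p)"] qinf_split_1[OF p(1), of "p / d / (p * X)"] p
    by (simp_all add: mult_ac)
  have qb: "qinf p (p / d * X) = (1 - p / d * X) * qinf p (p / d * (p * X))"
    "qinf p (p / d / X) = (1 - p / d / X) * qinf p (p / d / (X / p))"
    using qinf_split_1[OF p(1), of "p / d * X"] qinf_split_1[OF p(1), of "p / d / X"]
    by (simp_all add: mult_ac)
  have n1: "1 - 1 / (d * X) \<noteq> 0" "1 - X / d \<noteq> 0" "1 - p / d * X \<noteq> 0" "1 - p / d / X \<noteq> 0"
    using X nz m qb by (auto simp: field_simps)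
  have FY: "F Y = K * f Y / (qinf p (p / d * Y) * qinf p (p / d / Y))" if "Y \<in> {X, p * X, X / p}" for Y
    unfolding f_def using that by (rule F)
  have F0: "F X = K * f X / D" unfolding D_def by (rule FY) simp
  have gen0: "G = K * y * (u / v) / (u * q * q')" if "u \<noteq> 0" "G = K * y / (q * (v * q'))" for G y u v q q'
    using that by (simp add: mult_ac)
  have gen0': "G = K * y * (u / v) / (q * (u * q'))" if "u \<noteq> 0" "G = K * y / (v * q * q')" for G y u v q q'
    using that by (simp add: mult_ac)
  have F1: "F (p * X) = K * f (p * X) * ((1 - p / d * X) / (1 - 1 / (d * X))) / D"
    unfolding D_def qb(1) by (rule gen0[OF n1(3)], subst qa(2)[symmetric], rule FY) simp
  have F2: "F (X / p) = K * f (X / p) * ((1 - p / d / X) / (1 - X / d)) / D"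
    unfolding D_def qb(2) by (rule gen0'[OF n1(4)], subst qa(1)[symmetric], rule FY) simp
  \<comment> \<open>Shifting X changes the product (p X/d, p/(d X); p)_inf by a rational factor;
    combined with 1 - d X here, and with 1 - d/X in \<open>c2\<close>, it becomes the polynomial
    coefficient used in \<open>aw_gauged\<close>.\<close>
  have c1: "(1 - d * X) * ((1 - p / d * X) / (1 - 1 / (d * X))) = - X * (d - p * X)"
  proof -
    define q where "q = 1 - d * X"
    have "1 - 1 / (d * X) = - (q / (d * X))" "1 - p / d * X = (d - p * X) / d" "q \<noteq> 0"
      using X nz by (simp_all add: q_def field_simps)
    then show ?thesis unfolding q_def[symmetric] using X nz by simp
  qed
  have c2: "(1 - d / X) * ((1 - p / d / X) / (1 - X / d)) = - (d * X - p) / X\<^sup>2"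
  proof -
    define q v where "q = X - d" and "v = d * X - p"
    have q: "1 - d / X = q / X" "1 - p / d / X = v / (d * X)" "1 - X / d = - (q / d)" "q \<noteq> 0"
      using X nz by (simp_all add: q_def v_def field_simps)
    show ?thesis unfolding q(1-3) v_def[symmetric] using X nz q(4) by (simp add: power2_eq_square)
  qed
  have den: "(1 - 1 / X\<^sup>2) * (1 - p / X\<^sup>2) = - ?e2 / X ^ 4"
    using X by (simp add: field_simps power2_eq_square power4_eq_xxxx)
  have bc: "(1 - b / X) * (1 - c / X) = (X - b) * (X - c) / X\<^sup>2" "(1 - a / X) * (1 - d / X) = (X - a) * (X - d) / X\<^sup>2"
    using X by (simp_all add: field_simps power2_eq_square)
  have e: "1 - X\<^sup>2 \<noteq> 0" "1 - p * X\<^sup>2 \<noteq> 0" "X\<^sup>2 - p \<noteq> 0" using X by auto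
  have gen1: "A * B * C * E / e * (K * y * (u / v) / D) = (E * (u / v)) * (B * C) / e * (A * y) * (K / D)"
    for A B C E e y u v
    by (simp add: mult_ac)
  have gen2: "(- w / X\<^sup>2) * (v / X\<^sup>2) / (- e / X ^ 4) = w * v / e" for w v e
    using X(1) by (simp add: power2_eq_square power4_eq_xxxx)
  have gen3: "(w / X\<^sup>2) * (v / X\<^sup>2) / (- e / X ^ 4) = - (w * v / e)" for w v e
    using X(1) by (simp add: power2_eq_square power4_eq_xxxx)
  have T1: "?A1 / ?e1 * F (p * X) =
     - X * (d - p * X) * ((1 - b * X) * (1 - c * X)) / ?e1 * ((1 - a * X) * f (p * X)) * (K / D)"
    unfolding F1 c1[symmetric] by (rule gen1)
  have T2: "?A2 / ?N * F (X / p) =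
     (d * X - p) * ((X - b) * (X - c)) / ?e2 * ((1 - a / X) * f (X / p)) * (K / D)"
  proof -
    have "?A2 / ?N * F (X / p) =
      ((1 - d / X) * ((1 - p / d / X) / (1 - X / d))) * ((1 - b / X) * (1 - c / X)) / ?N *
      ((1 - a / X) * f (X / p)) * (K / D)"
      unfolding F2 by (rule gen1)
    also have "((1 - d / X) * ((1 - p / d / X) / (1 - X / d))) * ((1 - b / X) * (1 - c / X)) / ?N =
      (d * X - p) * ((X - b) * (X - c)) / ?e2"
      unfolding c2 bc(1) den by (rule gen2)
    finally show ?thesis .
  qed
  have T3: "?A2 / ?N =
     - ((X - a) * (X - d) * ((X - b) * (X - c)) / ?e2)"
  proof -
    have "?A2 = ((1 - a / X) * (1 - d / X)) * ((1 - b / X) * (1 - c / X))"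
      by (simp only: mult_ac)
    then show ?thesis
      unfolding bc den by (simp only: gen3)
  qed
  have "aw_gauged X f * (K / D) = 0"
    using aw_gauged_sum[OF X(1-4) sm] by (simp add: f_def)
  note G = this[unfolded aw_gauged_def]
  have A1: "?A1 / ?e1 =
     (1 - a * X) * (1 - d * X) * ((1 - b * X) * (1 - c * X)) / ?e1"
    by (simp only: mult_ac)
  have "F X = f X * (K / D)" by (simp add: F0)
  then show ?thesis
    by (rule aw_assemble[OF T1 T2 A1 T3 G])
qed

end

section \<open>Powers of q\<close>

lemma qpow_mult: "qpow \<tau> u * qpow \<tau> v = qpow \<tau> (u + v)"
  by (simp add: qpow_def exp_add[symmetric] distrib_left)

lemma qpow_divide: "qpow \<tau> u / qpow \<tau> v = qpow \<tau> (u - v)"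
  by (simp add: qpow_def exp_diff[symmetric] right_diff_distrib)

lemma qpow_nonzero [simp]: "qpow \<tau> u \<noteq> 0"
  by (simp add: qpow_def)

lemma qpow_inverse: "1 / qpow \<tau> u = qpow \<tau> (- u)"
  using qpow_divide[of \<tau> 0 u] by (simp add: qpow_def)

lemma qpow_power: "qpow \<tau> u ^ n = qpow \<tau> (of_nat n * u)"
  by (simp add: qpow_def exp_of_nat_mult[symmetric] mult_ac)

lemma qpoch_inf_conv: "qpoch_inf bs p = (\<Prod>b\<leftarrow>bs. qinf p b)"
  by (simp add: qpoch_inf_def qinf_def)

lemma qpoch_conv: "qpoch bs p n = (\<Prod>b\<leftarrow>bs. qfac p b n)"
  by (simp add: qpoch_def qfac_def)

lemma norm_qpow_less_1:
  assumes "Re \<tau> = 0" "Im \<tau> > 0" "Re u > 0"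
  shows "norm (qpow \<tau> u) < 1"
  using assms by (simp add: norm_qpow)

lemma qinf_qpow_eq_0D:
  assumes \<tau>: "Re \<tau> = 0" "Im \<tau> > 0" and z: "qinf (qpow \<tau> 2) (qpow \<tau> u) = 0"
  obtains j :: nat where "qpow \<tau> (u + 2 * of_nat j) = 1" "Re u + 2 * real j = 0"
proof -
  have "norm (qpow \<tau> 2) < 1" using \<tau> by (rule norm_qpow_less_1) simp
  then obtain j where "qpow \<tau> u * qpow \<tau> 2 ^ j = 1"
    using z qinf_eq_0_iff by blast
  then have j: "qpow \<tau> (u + 2 * of_nat j) = 1"
    by (simp add: qpow_power qpow_mult mult.commute)
  then have "exp (- (2 * pi * Im \<tau> * Re (u + 2 * of_nat j))) = 1"
    using norm_qpow[OF \<tau>(1), of "u + 2 * of_nat j"] by simp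
  then have "Re u + 2 * real j = 0"
    using \<tau> by simp
  with j show ?thesis by (rule that)
qed

lemma qinf_qpow_nonzero:
  assumes "Re \<tau> = 0" "Im \<tau> > 0" "Re u > 0"
  shows "qinf (qpow \<tau> 2) (qpow \<tau> u) \<noteq> 0"
  using assms by (intro qinf_nonzero norm_qpow_less_1) auto

text \<open>Comparing moduli, a zero would force r + 2j = 0 for the real number r, and then q^x = 1.
  This makes regularity at generic imaginary x independent of the values of the real
  parameters.\<close>

lemma qinf_qpow_nonzero_imaginary:
  assumes \<tau>: "Re \<tau> = 0" "Im \<tau> > 0" and r: "Im r = 0" and x: "Re x = 0" "qpow \<tau> (2 * x) \<noteq> 1"
  shows "qinf (qpow \<tau> 2) (qpow \<tau> (r - x)) \<noteq> 0"
proof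
  assume "qinf (qpow \<tau> 2) (qpow \<tau> (r - x)) = 0"
  then obtain j :: nat where j: "qpow \<tau> (r - x + 2 * of_nat j) = 1" "Re (r - x) + 2 * real j = 0"
    using qinf_qpow_eq_0D[OF \<tau>] by blast
  have "r + 2 * of_nat j = 0" using j(2) x r by (simp add: complex_eq_iff)
  then have e: "r - x + 2 * of_nat j = - x" by (simp add: algebra_simps)
  have "1 / qpow \<tau> x = 1" using j(1) unfolding e qpow_inverse .
  then have "qpow \<tau> (2 * x) = 1" unfolding mult_2 qpow_mult[symmetric] by simp
  then show False using x(2) by simp
qed

section \<open>Translation to the functions of the statement, with X = q^x\<close>

context
  fixes \<tau> lam \<alpha> \<beta> \<rho> \<sigma> :: complex
  assumes \<tau>: "Re \<tau> = 0" "Im \<tau> > 0"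
    and im: "Im lam = 0" "Im \<alpha> = 0" "Im \<beta> = 0" "Im \<rho> = 0" "Im \<sigma> = 0"
    and pos: "Re \<alpha> > 0" "Re \<beta> > 0" "Re \<rho> \<ge> 3" "Re \<sigma> \<ge> 3"
begin

abbreviation (input) "\<Phi> \<equiv> F_fun \<tau> lam \<alpha> \<beta> \<rho> \<sigma>"
abbreviation (input) "pp \<equiv> qpow \<tau> 2"
abbreviation (input) "pA2 \<equiv> qpow \<tau> (1 + \<alpha> + \<rho> - \<beta> - \<i> * lam)"
abbreviation (input) "pB2 X \<equiv> qpow \<tau> (2 + \<sigma> + \<i> * lam) * X"
abbreviation (input) "pC1 \<equiv> qpow \<tau> (\<alpha> + \<rho> + \<i> * lam)"
abbreviation (input) "pC2 X \<equiv> qpow \<tau> (\<sigma> - \<i> * lam) / X"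
abbreviation (input) "pD1 \<equiv> qpow \<tau> (1 - \<rho> + \<i> * lam)"
abbreviation (input) "pD2 \<equiv> qpow \<tau> (1 + \<rho> + \<i> * lam)"
abbreviation (input) "pD3 X \<equiv> qpow \<tau> (1 + \<beta> + \<sigma> - \<i> * lam) * X"

lemma p1: "norm pp < 1" "pp \<noteq> 0"
  using norm_qpow_less_1[OF \<tau>, of 2] by simp_all

text \<open>That the function of x factors through X = q^x is what gives its periodicity with period
  1/tau.\<close>

definition F_rep where
  "F_rep X = qinf pp (qpow \<tau> (1 + \<rho> + \<sigma>) / X) * qinf pp (qpow \<tau> (1 - \<rho> + \<sigma>) / X) /
     (qinf pp (qpow \<tau> (1 - \<alpha> - \<rho> + \<beta> + \<sigma>) / X) * qinf pp (qpow \<tau> (1 + \<alpha> + \<rho> + \<beta> + \<sigma>) / X)) *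
     (1 / (2 * of_real pi * \<i>) * kernel_integral pp pA2 (pB2 X) pC1 pD1 pD2 (pD3 X) (pC2 X))"

lemma inner_poles_conv: "inner_poles \<tau> lam \<alpha> \<rho> \<sigma> x = inner_set pp pC1 (pC2 (qpow \<tau> x))"
proof -
  have "qpow \<tau> (e + 2 * of_nat j) = qpow \<tau> e * pp ^ j" for e and j :: nat
    by (simp add: qpow_power qpow_mult mult.commute)
  then show ?thesis
    by (simp add: inner_poles_def inner_set_def qpow_divide)
qed

lemma outer_poles_conv: "outer_poles \<tau> lam \<beta> \<rho> \<sigma> x = outer_set pp pD1 pD2 (pD3 (qpow \<tau> x))"
proof -
  have "qpow \<tau> (- e - 2 * of_nat j) = 1 / (qpow \<tau> e * pp ^ j)" for e and j :: nat
    by (simp add: qpow_power qpow_mult qpow_inverse mult.commute)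
  then show ?thesis
    by (simp add: outer_poles_def outer_set_def qpow_mult)
qed

lemma kernel_conv:
  "F_integrand \<tau> lam \<alpha> \<beta> \<rho> \<sigma> x z / z =
   kernel pp pA2 (pB2 (qpow \<tau> x)) pC1 pD1 pD2 (pD3 (qpow \<tau> x)) (pC2 (qpow \<tau> x)) z"
proof -
  have e: "pp * pC1 * pC2 (qpow \<tau> x) / pA2 = qpow \<tau> (1 + \<beta> + \<sigma> + \<i> * lam - x)"
    "pp / pA2 = qpow \<tau> (1 - \<alpha> - \<rho> + \<beta> + \<i> * lam)"
    "pD1 * pD2 * pD3 (qpow \<tau> x) * pA2 / pB2 (qpow \<tau> x) = qpow \<tau> (2 + \<alpha> + \<rho> - \<i> * lam)"
    "pB2 (qpow \<tau> x) = qpow \<tau> (2 + \<sigma> + \<i> * lam + x)"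
    "pC2 (qpow \<tau> x) = qpow \<tau> (\<sigma> - \<i> * lam - x)"
    "pD3 (qpow \<tau> x) = qpow \<tau> (1 + \<beta> + \<sigma> - \<i> * lam + x)"
    unfolding qpow_mult qpow_divide by (rule arg_cong[where f = "qpow \<tau>"], simp add: algebra_simps)+
  show ?thesis
    unfolding kernel_def e(1-3) unfolding e(4-6) F_integrand_def qpoch_inf_conv by (simp add: mult_ac)
qed

lemma F_fun_conv: "\<Phi> x = F_rep (qpow \<tau> x)"
proof -
  have "contour_integral (F_contour \<tau> lam \<alpha> \<beta> \<rho> \<sigma> x) (\<lambda>z. F_integrand \<tau> lam \<alpha> \<beta> \<rho> \<sigma> x z / z) =
    kernel_integral pp pA2 (pB2 (qpow \<tau> x)) pC1 pD1 pD2 (pD3 (qpow \<tau> x)) (pC2 (qpow \<tau> x))"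
    unfolding F_contour_def kernel_integral_def inner_poles_conv outer_poles_conv kernel_conv ..
  then show ?thesis
    unfolding F_fun_def F_rep_def qpoch_inf_conv by (simp add: qpow_divide)
qed

lemma F_fun_periodic: "\<Phi> (x + 1 / \<tau>) = \<Phi> x"
proof -
  have "\<tau> \<noteq> 0" using \<tau> by auto
  then have "qpow \<tau> (1 / \<tau>) = 1"
    using exp_two_pi_i by (simp add: qpow_def mult_ac)
  then have "qpow \<tau> (x + 1 / \<tau>) = qpow \<tau> x"
    using qpow_mult[of \<tau> x "1 / \<tau>"] by simp
  then show ?thesis by (simp add: F_fun_conv)
qed

text \<open>The part of C that never vanishes for admissible parameters. The other four products of
  C enter in \<open>w8_sum_eq_W87\<close>, when the cleared series is normalised to an 8W7
  series.\<close>

definition F_norm where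
  "F_norm = qinf pp (qpow \<tau> (1 + \<beta> + 2 * \<i> * lam)) * qinf pp (qpow \<tau> (1 + \<alpha> - 2 * \<i> * lam)) /
     (qinf pp pp * qinf pp (qpow \<tau> (1 + \<alpha> + 2 * \<i> * lam)) * qinf pp (qpow \<tau> (1 + \<alpha> + 2 * \<rho> + 2 * \<i> * lam)) *
      qinf pp (qpow \<tau> (1 + \<beta> + 2 * \<sigma> - 2 * \<i> * lam)))"

abbreviation (input) "w8 X \<equiv> w8_term pp pA2 (pB2 X) pC1 pD1 pD2 (pD3 X) (pC2 X)"

lemma parameter_products:
  "pp * pC1 / pA2 = qpow \<tau> (1 + \<beta> + 2 * \<i> * lam)"
  "pp * pC2 (qpow \<tau> x) / pA2 = qpow \<tau> (1 - \<alpha> - \<rho> + \<beta> + \<sigma> - x)"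
  "pD1 * pD3 (qpow \<tau> x) * pA2 / pB2 (qpow \<tau> x) = qpow \<tau> (1 + \<alpha> - 2 * \<i> * lam)"
  "pB2 (qpow \<tau> x) * pC1 * pC2 (qpow \<tau> x) * pD2 / pp = qpow \<tau> (1 + \<alpha> + 2 * \<rho> + 2 * \<sigma> + 2 * \<i> * lam)"
  "pD1 * pC1 = qpow \<tau> (1 + \<alpha> + 2 * \<i> * lam)"
  "pD2 * pC1 = qpow \<tau> (1 + \<alpha> + 2 * \<rho> + 2 * \<i> * lam)"
  "pD3 (qpow \<tau> x) * pC1 = qpow \<tau> (1 + \<alpha> + \<rho> + \<beta> + \<sigma> + x)"
  "pD1 * pC2 (qpow \<tau> x) = qpow \<tau> (1 - \<rho> + \<sigma> - x)"
  "pD2 * pC2 (qpow \<tau> x) = qpow \<tau> (1 + \<rho> + \<sigma> - x)"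
  "pD3 (qpow \<tau> x) * pC2 (qpow \<tau> x) = qpow \<tau> (1 + \<beta> + 2 * \<sigma> - 2 * \<i> * lam)"
  "pB2 (qpow \<tau> x) / pD1 = qpow \<tau> (1 + \<rho> + \<sigma> + x)"
  "pB2 (qpow \<tau> x) / pD3 (qpow \<tau> x) = qpow \<tau> (1 - \<beta> + 2 * \<i> * lam)"
  "pC1 * pC2 (qpow \<tau> x) * pB2 (qpow \<tau> x) / pA2 = qpow \<tau> (1 + \<beta> + 2 * \<sigma> + 2 * \<i> * lam)"
  "pC1 * pC2 (qpow \<tau> x) * pD1 * pD2 = qpow \<tau> (2 + \<alpha> + \<rho> + \<sigma> + 2 * \<i> * lam - x)"
  "pB2 (qpow \<tau> x) * pC1 = qpow \<tau> (2 + \<alpha> + \<rho> + \<sigma> + 2 * \<i> * lam + x)"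
  "pC1 * pC2 (qpow \<tau> x) * pD2 * pD3 (qpow \<tau> x) = qpow \<tau> (2 + \<alpha> + 2 * \<rho> + \<beta> + 2 * \<sigma>)"
  "pD2 * pA2 = qpow \<tau> (2 + \<alpha> + 2 * \<rho> - \<beta>)"
  "pB2 (qpow \<tau> x) * pC2 (qpow \<tau> x) = qpow \<tau> (2 + 2 * \<sigma>)"
  unfolding qpow_mult qpow_divide by (rule arg_cong[where f = "qpow \<tau>"], simp add: algebra_simps)+

lemma norm_u: "norm (pB2 (qpow \<tau> x) * pC1 * pC2 (qpow \<tau> x) * pD2 / pp) < 1"
  unfolding parameter_products(4) using pos im by (intro norm_qpow_less_1 \<tau>) simp

lemma norm_Z: "norm (pD1 * pD3 (qpow \<tau> x) * pA2 / pB2 (qpow \<tau> x)) < 1"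
  unfolding parameter_products(3) using pos im by (intro norm_qpow_less_1 \<tau>) simp

lemma w8_summable: "summable (w8 (qpow \<tau> x))"
  by (rule w8_series_holomorphic(2)[OF p1 _ norm_Z norm_u]) simp

text \<open>The cleared form of the closed formula: it holds at every regular point, including those
  where the 8W7 series has a vanishing denominator or C is 0, and it is the starting point for the
  difference equation. Regularity makes nonzero the products by which
  \<open>kernel_integral_formula\<close> has to be divided.\<close>

lemma F_fun_series:
  assumes reg: "F_regular \<tau> lam \<alpha> \<beta> \<rho> \<sigma> x"
  shows "\<Phi> x = F_norm * (\<Sum>k. w8 (qpow \<tau> x) k) /
    (qinf pp (qpow \<tau> (1 + \<alpha> + \<rho> + \<beta> + \<sigma> + x)) * qinf pp (qpow \<tau> (1 + \<alpha> + \<rho> + \<beta> + \<sigma> - x)))"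
proof -
  let ?X = "qpow \<tau> x"
  have D: "pD1 \<noteq> 0" "pD2 \<noteq> 0" "pD3 ?X \<noteq> 0" by simp_all
  have disj: "inner_set pp pC1 (pC2 ?X) \<inter> outer_set pp pD1 pD2 (pD3 ?X) = {}"
    and pre: "qinf pp (qpow \<tau> (1 - \<alpha> - \<rho> + \<beta> + \<sigma> - x)) \<noteq> 0" "qinf pp (qpow \<tau> (1 + \<alpha> + \<rho> + \<beta> + \<sigma> - x)) \<noteq> 0"
    using reg unfolding F_regular_def inner_poles_conv outer_poles_conv qpoch_inf_conv by auto
  have in1: "pC1 \<in> inner_set pp pC1 (pC2 ?X)" and in2: "pC2 ?X \<in> inner_set pp pC1 (pC2 ?X)"
    unfolding inner_set_def by (auto intro: image_eqI[of _ _ 0])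
  have o1: "pC1 \<notin> outer_set pp pD1 pD2 (pD3 ?X)" and o2: "pC2 ?X \<notin> outer_set pp pD1 pD2 (pD3 ?X)"
    using disj in1 in2 by blast+
  have n1: "qinf pp (pD1 * pC1) \<noteq> 0" "qinf pp (pD2 * pC1) \<noteq> 0" "qinf pp (pD3 ?X * pC1) \<noteq> 0"
    using o1 unfolding in_outer_set_iff[OF p1 D] by blast+
  have n2: "qinf pp (pD1 * pC2 ?X) \<noteq> 0" "qinf pp (pD2 * pC2 ?X) \<noteq> 0" "qinf pp (pD3 ?X * pC2 ?X) \<noteq> 0"
    using o2 unfolding in_outer_set_iff[OF p1 D] by blast+
  define J where "J = kernel_integral pp pA2 (pB2 ?X) pC1 pD1 pD2 (pD3 ?X) (pC2 ?X)"
  have "J * (qinf pp pp * (qinf pp (pD1 * pC1) * qinf pp (pD2 * pC1) * qinf pp (pD3 ?X * pC1)) *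
      (qinf pp (pD1 * pC2 ?X) * qinf pp (pD2 * pC2 ?X) * qinf pp (pD3 ?X * pC2 ?X))) =
    2 * pi * \<i> * (qinf pp (pp * pC1 / pA2) * qinf pp (pp * pC2 ?X / pA2) * qinf pp (pD1 * pD3 ?X * pA2 / pB2 ?X)) *
      (\<Sum>k. w8 ?X k)"
    unfolding J_def
  proof (rule kernel_integral_formula[OF p1 _ _ _ D _ o2 norm_u norm_Z])
    show "qinf pp (Di * pC1) \<noteq> 0" if "Di \<in> {pD1, pD2, pD3 ?X}" for Di
      using that n1 by blast
  qed simp_all
  note J = this[unfolded parameter_products]
  note n = n1[unfolded parameter_products] n2[unfolded parameter_products] pre qinf_nonzero[OF p1(1) p1(1)]
  have gen: "g1 * g2 / (g3 * g4) * (1 / (2 * of_real pi * \<i>) * J) = (a1 * a2 / (e0 * e1 * e2 * e6)) * W / (e3 * g4)"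
    if J: "J * (e0 * (e1 * e2 * e3) * (g2 * g1 * e6)) = 2 * pi * \<i> * (a1 * g3 * a2) * W"
      and "g1 \<noteq> 0" "g2 \<noteq> 0" "g3 \<noteq> 0" "e0 \<noteq> 0" "e1 \<noteq> 0" "e2 \<noteq> 0" "e3 \<noteq> 0" "e6 \<noteq> 0"
    for g1 g2 g3 g4 e0 e1 e2 e3 e6 a1 a2 W :: complex
  proof -
    have "J = 2 * pi * \<i> * (a1 * g3 * a2) * W / (e0 * (e1 * e2 * e3) * (g2 * g1 * e6))"
      using J that(2-) by (simp add: nonzero_eq_divide_eq)
    then show ?thesis using that(2-) by (simp add: mult_ac)
  qed
  show ?thesis
    unfolding F_fun_conv F_rep_def J_def[symmetric] F_norm_def
      qpow_divide[of \<tau> "1 + \<rho> + \<sigma>" x] qpow_divide[of \<tau> "1 - \<rho> + \<sigma>" x]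
      qpow_divide[of \<tau> "1 - \<alpha> - \<rho> + \<beta> + \<sigma>" x] qpow_divide[of \<tau> "1 + \<alpha> + \<rho> + \<beta> + \<sigma>" x]
    by (rule gen[OF J]) (use n in auto)
qed

text \<open>The bound \<open>-7\<close> stems from \<open>Re (1 + \<alpha> + \<rho> + \<beta> + \<sigma>) > 7\<close>.\<close>

lemma F_regularI:
  assumes "qinf pp (qpow \<tau> (1 - \<alpha> - \<rho> + \<beta> + \<sigma> - x)) \<noteq> 0" "qinf pp (qpow \<tau> (1 + \<alpha> + \<rho> + \<beta> + \<sigma> - x)) \<noteq> 0"
    "qinf pp (qpow \<tau> (1 - \<rho> + \<sigma> - x)) \<noteq> 0" "qinf pp (qpow \<tau> (1 + \<rho> + \<sigma> - x)) \<noteq> 0"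
    and x: "Re x > - 7"
  shows "F_regular \<tau> lam \<alpha> \<beta> \<rho> \<sigma> x"
proof -
  let ?X = "qpow \<tau> x"
  have D: "pD1 \<noteq> 0" "pD2 \<noteq> 0" "pD3 ?X \<noteq> 0" by simp_all
  have n: "qinf pp (pD1 * pC1) \<noteq> 0" "qinf pp (pD2 * pC1) \<noteq> 0" "qinf pp (pD3 ?X * pC1) \<noteq> 0"
    "qinf pp (pD3 ?X * pC2 ?X) \<noteq> 0"
    unfolding parameter_products by (rule qinf_qpow_nonzero[OF \<tau>], use pos im x in simp)+
  have "pC2 ?X \<notin> outer_set pp pD1 pD2 (pD3 ?X)"
    unfolding in_outer_set_iff[OF p1 D] parameter_products using assms n(4)[unfolded parameter_products] by simp
  then have "inner_set pp pC1 (pC2 ?X) \<inter> outer_set pp pD1 pD2 (pD3 ?X) = {}"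
    using n by (intro inner_outer_disjoint[OF p1 D]) auto
  then show ?thesis
    using assms unfolding F_regular_def inner_poles_conv outer_poles_conv qpoch_inf_conv by simp
qed

abbreviation (input) "W x \<equiv> W87 (qpow \<tau> (1 + \<alpha> + 2 * \<rho> + 2 * \<sigma> + 2 * \<i> * lam)) (qpow \<tau> (1 + \<rho> + \<sigma> + x)) (qpow \<tau> (1 + \<rho> + \<sigma> - x))
      (qpow \<tau> (1 - \<beta> + 2 * \<i> * lam)) (qpow \<tau> (1 + \<beta> + 2 * \<sigma> + 2 * \<i> * lam))
      (qpow \<tau> (1 + \<alpha> + 2 * \<rho> + 2 * \<i> * lam)) pp (qpow \<tau> (1 + \<alpha> - 2 * \<i> * lam))"

text \<open>Returning to 8W7 replaces (v p^k; p)_inf by (v; p)_inf / (v; p)_k, which requires (v;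
  p)_inf to be nonzero. For two of the five v this follows from an exponent with positive real part;
  the other three are the hypotheses.\<close>

lemma w8_sum_eq_W87:
  assumes n: "qinf pp (qpow \<tau> (2 + \<alpha> + \<rho> + \<sigma> + 2 * \<i> * lam - x)) \<noteq> 0"
    "qinf pp (qpow \<tau> (2 + \<alpha> + \<rho> + \<sigma> + 2 * \<i> * lam + x)) \<noteq> 0"
    "qinf pp (qpow \<tau> (2 + \<alpha> + 2 * \<rho> - \<beta>)) \<noteq> 0"
  shows "(\<Sum>k. w8 (qpow \<tau> x) k) =
    qinf pp (qpow \<tau> (2 + \<alpha> + \<rho> + \<sigma> + 2 * \<i> * lam - x)) * qinf pp (qpow \<tau> (2 + \<alpha> + \<rho> + \<sigma> + 2 * \<i> * lam + x)) *
    qinf pp (qpow \<tau> (2 + \<alpha> + 2 * \<rho> + \<beta> + 2 * \<sigma>)) * qinf pp (qpow \<tau> (2 + \<alpha> + 2 * \<rho> - \<beta>)) *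
    qinf pp (qpow \<tau> (2 + 2 * \<sigma>)) / qinf pp (qpow \<tau> (3 + \<alpha> + 2 * \<rho> + 2 * \<sigma> + 2 * \<i> * lam)) *
    W x"
proof -
  define u where "u = qpow \<tau> (1 + \<alpha> + 2 * \<rho> + 2 * \<sigma> + 2 * \<i> * lam)"
  define v1 v2 v3 v4 v5 where "v1 = qpow \<tau> (2 + \<alpha> + \<rho> + \<sigma> + 2 * \<i> * lam - x)"
    and "v2 = qpow \<tau> (2 + \<alpha> + \<rho> + \<sigma> + 2 * \<i> * lam + x)" and "v3 = qpow \<tau> (2 + \<alpha> + 2 * \<rho> + \<beta> + 2 * \<sigma>)"
    and "v4 = qpow \<tau> (2 + \<alpha> + 2 * \<rho> - \<beta>)" and "v5 = qpow \<tau> (2 + 2 * \<sigma>)"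
  define b1 b2 b3 b4 b5 where "b1 = qpow \<tau> (1 + \<rho> + \<sigma> + x)" and "b2 = qpow \<tau> (1 + \<rho> + \<sigma> - x)"
    and "b3 = qpow \<tau> (1 - \<beta> + 2 * \<i> * lam)" and "b4 = qpow \<tau> (1 + \<beta> + 2 * \<sigma> + 2 * \<i> * lam)"
    and "b5 = qpow \<tau> (1 + \<alpha> + 2 * \<rho> + 2 * \<i> * lam)"
  define Z where "Z = qpow \<tau> (1 + \<alpha> - 2 * \<i> * lam)"
  define pu where "pu = qpow \<tau> (3 + \<alpha> + 2 * \<rho> + 2 * \<sigma> + 2 * \<i> * lam)"
  have vb: "pp * u / b1 = v1" "pp * u / b2 = v2" "pp * u / b3 = v3" "pp * u / b4 = v4" "pp * u / b5 = v5"
    "pp * u = pu"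
    unfolding u_def v1_def v2_def v3_def v4_def v5_def b1_def b2_def b3_def b4_def b5_def pu_def qpow_mult qpow_divide
    by (rule arg_cong[where f = "qpow \<tau>"], simp add: algebra_simps)+
  have un: "norm u < 1" unfolding u_def using pos im by (intro norm_qpow_less_1 \<tau>) simp
  have u0: "qinf pp (u * pp ^ k) \<noteq> 0" for k
    using un norm_mult_power_le[OF p1(1), of u k] by (intro qinf_nonzero p1) simp
  have q: "qinf pp v1 \<noteq> 0" "qinf pp v2 \<noteq> 0" "qinf pp v3 \<noteq> 0" "qinf pp v4 \<noteq> 0" "qinf pp v5 \<noteq> 0"
    unfolding v1_def v2_def v3_def v4_def v5_def
    by (rule n, rule n, rule qinf_qpow_nonzero[OF \<tau>], use pos im in simp, rule n,
        rule qinf_qpow_nonzero[OF \<tau>], use pos im in simp)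
  have split: "qinf pp v = qfac pp v k * qinf pp (v * pp ^ k)" for v k
    by (rule qinf_split[OF p1(1)])
  have div: "qinf pp (v * pp ^ k) = qinf pp v / qfac pp v k" if "qinf pp v \<noteq> 0" for v k
    using split[of v k] that by auto
  have up: "qinf pp u = (1 - u) * qinf pp pu"
    using qinf_split_1[OF p1(1), of u] vb(6) by (simp add: mult.commute)
  define K where "K = qinf pp v1 * qinf pp v2 * qinf pp v3 * qinf pp v4 * qinf pp v5 / qinf pp pu"
  have summand: "w8 (qpow \<tau> x) k = K * ((1 - u * pp ^ (2 * k)) * qpoch [u, b1, b2, b3, b4, b5] pp k * Z ^ k /
          ((1 - u) * qpoch [pp, v1, v2, v3, v4, v5] pp k))" for k
  proof -
    have uk: "qfac pp u k \<noteq> 0" "qinf pp u \<noteq> 0" "qinf pp pu \<noteq> 0" "1 - u \<noteq> 0"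
      using split[of u k] u0[of 0] up by auto
    have "w8 (qpow \<tau> x) k = (1 - u * pp ^ (2 * k)) * Z ^ k *
     (qfac pp b1 k * qfac pp b2 k * qfac pp b3 k * qfac pp b4 k * qfac pp b5 k) *
     (qinf pp (v1 * pp ^ k) * qinf pp (v2 * pp ^ k) * qinf pp (v3 * pp ^ k) * qinf pp (v4 * pp ^ k) * qinf pp (v5 * pp ^ k)) /
     (qfac pp pp k * qinf pp (u * pp ^ k))"
      unfolding w8_term_def parameter_products(3,4,13,14,16) unfolding parameter_products(6,9,11,12,15,17,18) u_def Z_def b1_def b2_def b3_def b4_def b5_def
        v1_def v2_def v3_def v4_def v5_def ..
    also have "\<dots> = K * ((1 - u * pp ^ (2 * k)) * qpoch [u, b1, b2, b3, b4, b5] pp k * Z ^ k /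
          ((1 - u) * qpoch [pp, v1, v2, v3, v4, v5] pp k))"
      unfolding div[OF q(1)] div[OF q(2)] div[OF q(3)] div[OF q(4)] div[OF q(5)] div[OF uk(2)] up K_def qpoch_conv
      using uk by (simp add: mult_ac)
    finally show ?thesis .
  qed
  \<comment> \<open>As K is nonzero, summability passes from the cleared series to the terms of the
    8W7 series, and the constant can be taken out of the sum.\<close>
  have "K \<noteq> 0" using q u0[of 0] up by (auto simp: K_def)
  then have "summable (\<lambda>k. (1 - u * pp ^ (2 * k)) * qpoch [u, b1, b2, b3, b4, b5] pp k * Z ^ k /
          ((1 - u) * qpoch [pp, v1, v2, v3, v4, v5] pp k))"
    using w8_summable[of x] unfolding summand summable_cmult_iff by blast
  then have "(\<Sum>k. w8 (qpow \<tau> x) k) = K * W87 u b1 b2 b3 b4 b5 pp Z"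
    unfolding summand W87_def vb(1-5) by (rule suminf_mult)
  then show ?thesis
    unfolding K_def u_def v1_def v2_def v3_def v4_def v5_def b1_def b2_def b3_def b4_def b5_def Z_def pu_def .
qed

lemma F_fun_W87:
  assumes reg: "F_regular \<tau> lam \<alpha> \<beta> \<rho> \<sigma> x"
    and n: "qinf pp (qpow \<tau> (2 + \<alpha> + \<rho> + \<sigma> + 2 * \<i> * lam - x)) \<noteq> 0"
    "qinf pp (qpow \<tau> (2 + \<alpha> + \<rho> + \<sigma> + 2 * \<i> * lam + x)) \<noteq> 0"
    "qinf pp (qpow \<tau> (2 + \<alpha> + 2 * \<rho> - \<beta>)) \<noteq> 0"
  shows "\<Phi> x = C_const \<tau> lam \<alpha> \<beta> \<rho> \<sigma> *
     (qinf pp (qpow \<tau> (2 + \<alpha> + \<rho> + \<sigma> + 2 * \<i> * lam + x)) * qinf pp (qpow \<tau> (2 + \<alpha> + \<rho> + \<sigma> + 2 * \<i> * lam - x)) /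
      (qinf pp (qpow \<tau> (1 + \<alpha> + \<rho> + \<beta> + \<sigma> + x)) * qinf pp (qpow \<tau> (1 + \<alpha> + \<rho> + \<beta> + \<sigma> - x)))) *
    W x"
  unfolding F_fun_series[OF reg] w8_sum_eq_W87[OF n] F_norm_def C_const_def qpoch_inf_conv
  by (simp add: mult_ac)

text \<open>All exponents in C except 2 + alpha + 2 rho - beta have positive real part, so only that
  product can vanish.\<close>

lemma C_const_eq_0D:
  assumes "C_const \<tau> lam \<alpha> \<beta> \<rho> \<sigma> = 0"
  obtains j :: nat where "Re \<beta> - Re \<alpha> - 2 * Re \<rho> = 2 + 2 * real j"
proof -
  have "qinf pp (qpow \<tau> (2 + 2 * \<sigma>)) \<noteq> 0" "qinf pp (qpow \<tau> (2 + \<alpha> + 2 * \<rho> + \<beta> + 2 * \<sigma>)) \<noteq> 0"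
    "qinf pp (qpow \<tau> (1 + \<beta> + 2 * \<i> * lam)) \<noteq> 0" "qinf pp (qpow \<tau> (1 + \<alpha> - 2 * \<i> * lam)) \<noteq> 0"
    "qinf pp pp \<noteq> 0" "qinf pp (qpow \<tau> (1 + \<alpha> + 2 * \<i> * lam)) \<noteq> 0"
    "qinf pp (qpow \<tau> (1 + \<alpha> + 2 * \<rho> + 2 * \<i> * lam)) \<noteq> 0"
    "qinf pp (qpow \<tau> (1 + \<beta> + 2 * \<sigma> - 2 * \<i> * lam)) \<noteq> 0"
    "qinf pp (qpow \<tau> (3 + \<alpha> + 2 * \<rho> + 2 * \<sigma> + 2 * \<i> * lam)) \<noteq> 0"
    by (rule qinf_qpow_nonzero[OF \<tau>], use pos im in simp)+
  then have "qinf pp (qpow \<tau> (2 + \<alpha> + 2 * \<rho> - \<beta>)) = 0"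
    using assms unfolding C_const_def qpoch_inf_conv by simp
  then obtain j :: nat where "Re (2 + \<alpha> + 2 * \<rho> - \<beta>) + 2 * real j = 0"
    using qinf_qpow_eq_0D[OF \<tau>] by blast
  then show ?thesis by (intro that[of j]) simp
qed

text \<open>Obtained from \<open>F_fun_series\<close> at x, x+2 and x-2 rather than from the 8W7
  formula, so parameters with C = 0 are included.\<close>

lemma F_fun_askey_wilson:
  assumes x: "Re x = 0" "qpow \<tau> (2 * x) \<noteq> 1"
  defines "a \<equiv> 1 + \<rho> + \<sigma>" and "b \<equiv> 1 - \<rho> + \<sigma>" and "c \<equiv> 1 + \<alpha> + \<rho> - \<beta> - \<sigma>" and "d \<equiv> 1 - \<alpha> - \<rho> - \<beta> - \<sigma>"
  shows "AW_coeff \<tau> a b c d x * (\<Phi> (x + 2) - \<Phi> x) +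
     AW_coeff \<tau> a b c d (- x) * (\<Phi> (x - 2) - \<Phi> x) =
     AW_eigenvalue \<tau> \<beta> lam * \<Phi> x"
proof -
  define h where "h = 2 + \<alpha> + \<rho> + \<sigma> + 2 * \<i> * lam"
  define X where "X = qpow \<tau> x"
  let ?a = "qpow \<tau> a" and ?b = "qpow \<tau> b" and ?c = "qpow \<tau> c" and ?d = "qpow \<tau> d" and ?h = "qpow \<tau> h"
  let ?s = "aw_summand pp ?a ?b ?c ?d ?h"
  let ?A1 = "(1 - ?a * X) * (1 - ?b * X) * (1 - ?c * X) * (1 - ?d * X) / ((1 - X\<^sup>2) * (1 - pp * X\<^sup>2))"
  let ?A2 = "(1 - ?a / X) * (1 - ?b / X) * (1 - ?c / X) * (1 - ?d / X) / ((1 - 1 / X\<^sup>2) * (1 - pp / X\<^sup>2))"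
  have e: "?b * ?c * pp / (?h * ?d) = qpow \<tau> (1 + \<alpha> - 2 * \<i> * lam)"
    "?h * ?d / pp = qpow \<tau> (1 - \<beta> + 2 * \<i> * lam)" "?h / ?c = qpow \<tau> (1 + \<beta> + 2 * \<sigma> + 2 * \<i> * lam)"
    "?h / ?b = qpow \<tau> (1 + \<alpha> + 2 * \<rho> + 2 * \<i> * lam)" "pp * ?a / ?d = qpow \<tau> (2 + \<alpha> + 2 * \<rho> + \<beta> + 2 * \<sigma>)"
    "?a * ?c = qpow \<tau> (2 + \<alpha> + 2 * \<rho> - \<beta>)" "?a * ?b = qpow \<tau> (2 + 2 * \<sigma>)"
    "?h * ?a / pp = qpow \<tau> (1 + \<alpha> + 2 * \<rho> + 2 * \<sigma> + 2 * \<i> * lam)"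
    "pp / ?d = qpow \<tau> (1 + \<alpha> + \<rho> + \<beta> + \<sigma>)"
    unfolding a_def b_def c_def d_def h_def qpow_mult qpow_divide
    by (rule arg_cong[where f = "qpow \<tau>"], simp add: algebra_simps)+
  have nu: "norm (?h * ?a / pp) < 1" and nZ: "norm (?b * ?c * pp / (?h * ?d)) < 1"
    unfolding e using pos im by (auto intro!: norm_qpow_less_1 \<tau>)
  note nz = p1 qpow_nonzero qpow_nonzero qpow_nonzero qpow_nonzero qpow_nonzero nu nZ
  have w8: "w8 (qpow \<tau> y) k = ?s k (qpow \<tau> y)" for y k
  proof -
    have f: "?a * qpow \<tau> y = qpow \<tau> (1 + \<rho> + \<sigma> + y)" "?a / qpow \<tau> y = qpow \<tau> (1 + \<rho> + \<sigma> - y)"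
      "?h * qpow \<tau> y = qpow \<tau> (2 + \<alpha> + \<rho> + \<sigma> + 2 * \<i> * lam + y)"
      "?h / qpow \<tau> y = qpow \<tau> (2 + \<alpha> + \<rho> + \<sigma> + 2 * \<i> * lam - y)"
      unfolding a_def h_def qpow_mult qpow_divide by simp_all
    show ?thesis
      unfolding w8_term_def parameter_products(3,4,13,14,16)
      unfolding parameter_products(6,9,11,12,15,17,18) aw_summand_def[OF nz] aw_weight_def[OF nz] aw_basis_def[OF nz] e f
      by (simp add: mult_ac)
  qed
  have shift: "qpow \<tau> (x + 2) = pp * X" "qpow \<tau> (x - 2) = X / pp"
    by (simp_all add: X_def qpow_mult qpow_divide add.commute)
  \<comment> \<open>The shift by 0, 2 or -2 is absorbed into the real exponent, which leaves the
    case of an imaginary x.\<close>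
  have reg: "F_regular \<tau> lam \<alpha> \<beta> \<rho> \<sigma> (x + n)" if "n \<in> {0, 2, - 2}" for n
  proof (rule F_regularI)
    have n: "qinf pp (qpow \<tau> (r - (x + n))) \<noteq> 0" if "Im r = 0" for r
    proof -
      have "qinf pp (qpow \<tau> ((r - n) - x)) \<noteq> 0"
        using \<open>Im r = 0\<close> \<open>n \<in> {0, 2, - 2}\<close> x by (intro qinf_qpow_nonzero_imaginary \<tau>) auto
      then show ?thesis by (simp add: algebra_simps)
    qed
    show "qinf pp (qpow \<tau> (1 - \<alpha> - \<rho> + \<beta> + \<sigma> - (x + n))) \<noteq> 0" "qinf pp (qpow \<tau> (1 + \<alpha> + \<rho> + \<beta> + \<sigma> - (x + n))) \<noteq> 0"
      "qinf pp (qpow \<tau> (1 - \<rho> + \<sigma> - (x + n))) \<noteq> 0" "qinf pp (qpow \<tau> (1 + \<rho> + \<sigma> - (x + n))) \<noteq> 0"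
      using im by (auto intro!: n)
    show "Re (x + n) > - 7" using x that by auto
  qed
  define F where "F = (\<lambda>Y. F_norm * (\<Sum>k. ?s k Y) / (qinf pp (pp / ?d * Y) * qinf pp (pp / ?d / Y)))"
  have F: "\<Phi> (x + n) = F (qpow \<tau> (x + n))" if "n \<in> {0, 2, - 2}" for n
    unfolding F_fun_series[OF reg[OF that]] F_def w8 e(9) unfolding qpow_mult qpow_divide ..
  have F0: "\<Phi> x = F X" "\<Phi> (x + 2) = F (pp * X)"
    "\<Phi> (x - 2) = F (X / pp)"
    using F[of 0] F[of 2] F[of "- 2"] shift by (simp_all add: X_def)
  have nX: "norm X = 1" using \<tau> x by (simp add: X_def norm_qpow)
  have X2: "X\<^sup>2 = qpow \<tau> (2 * x)" by (simp add: X_def qpow_power)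
  \<comment> \<open>The exponent \<open>d\<close> has negative real part while X has modulus 1; this
    rules out the coincidences q^d X = 1 and q^d = X.\<close>
  have "1 < norm ?d"
  proof -
    have "norm (pp / ?d) < norm pp"
    proof -
      have "norm (1 / ?d) < 1"
        unfolding qpow_inverse d_def using pos im by (intro norm_qpow_less_1 \<tau>) simp
      then show ?thesis using p1 by (simp add: norm_divide field_simps)
    qed
    then show ?thesis using p1 by (simp add: norm_divide field_simps)
  qed
  then have dX: "?d * X \<noteq> 1" "?d \<noteq> X"
    using nX by (metis mult.right_neutral norm_mult norm_one order_less_irrefl, auto)
  have "norm (pp * X\<^sup>2) < 1" using p1 nX by (simp add: norm_mult norm_power)
  then have X1: "X \<noteq> 0" "X\<^sup>2 \<noteq> 1" "pp * X\<^sup>2 \<noteq> 1" "X\<^sup>2 \<noteq> pp"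
    using x X2 nX p1 by (auto simp: norm_power dest: arg_cong[where f = norm])
  have m: "qinf pp (pp / ?d * X) \<noteq> 0" "qinf pp (pp / ?d / X) \<noteq> 0"
    unfolding e(9) X_def unfolding qpow_mult qpow_divide by (rule qinf_qpow_nonzero[OF \<tau>], use pos im x in simp)+
  have sm: "summable (\<lambda>k. ?s k Y)" if "Y \<in> {X, pp * X, X / pp}" for Y
  proof -
    have "Y \<in> {qpow \<tau> x, qpow \<tau> (x + 2), qpow \<tau> (x - 2)}"
      using that unfolding shift X_def by simp
    then obtain y where "Y = qpow \<tau> y" by blast
    then show ?thesis using w8_summable[of y] unfolding w8 by simp
  qed
  have "?A1 * (F (pp * X) - F X) + ?A2 * (F (X / pp) - F X) =
     aw_eigen pp ?a ?b ?c ?d ?h * F X"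
  proof (rule askey_wilson_equation[OF nz X1 dX m])
    show "summable (\<lambda>k. ?s k Y)" if "Y \<in> {X, pp * X, X / pp}" for Y
      by (rule sm[OF that])
  qed (simp only: F_def)
  moreover have "AW_coeff \<tau> a b c d x = ?A1"
    unfolding AW_coeff_def X2 unfolding X_def qpow_mult ..
  moreover have "AW_coeff \<tau> a b c d (- x) = ?A2"
    unfolding AW_coeff_def X2 unfolding X_def qpow_divide qpow_inverse by simp
  moreover have "aw_eigen pp ?a ?b ?c ?d ?h = AW_eigenvalue \<tau> \<beta> lam"
  proof -
    have g: "?a * ?b * ?c / ?h = qpow \<tau> (1 - \<beta> - 2 * \<i> * lam)"
      unfolding a_def b_def c_def h_def qpow_mult qpow_divide
      by (rule arg_cong[where f = "qpow \<tau>"]) (simp add: algebra_simps)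
    have "aw_eigen pp ?a ?b ?c ?d ?h = - (1 - ?h * ?d / pp) * (1 - ?a * ?b * ?c / ?h)"
      unfolding aw_eigen_def[OF nz] using p1 by (simp add: field_simps)
    also have "\<dots> = - (1 - qpow \<tau> (1 - \<beta> + 2 * \<i> * lam)) * (1 - qpow \<tau> (1 - \<beta> - 2 * \<i> * lam))"
      unfolding e(2) g ..
    also have "\<dots> = - 1 - qpow \<tau> (1 - \<beta> + 2 * \<i> * lam) * qpow \<tau> (1 - \<beta> - 2 * \<i> * lam) +
        (qpow \<tau> (1 - \<beta> + 2 * \<i> * lam) + qpow \<tau> (1 - \<beta> - 2 * \<i> * lam))"
      by (simp add: algebra_simps)
    also have "\<dots> = AW_eigenvalue \<tau> \<beta> lam"
      unfolding AW_eigenvalue_def distrib_left qpow_mult by (simp add: algebra_simps)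
    finally show ?thesis .
  qed
  ultimately show ?thesis
    unfolding F0 by simp
qed

end

text \<open>"Generically nonzero" is made precise as: the exceptional parameters form a nowhere
  dense set. They lie where (be - al - 2 rh - 2)/2 is a natural number, a closed condition that
  every small change of \<open>be\<close> destroys.\<close>

lemma interior_closure_exceptional:
  fixes Z :: "(real \<times> real \<times> real \<times> real \<times> real) set"
  assumes "\<And>l al be rh si. (l, al, be, rh, si) \<in> Z \<Longrightarrow> \<exists>j::nat. be - al - 2 * rh = 2 + 2 * real j"
  shows "interior (closure Z) = {}"
proof -
  define f :: "real \<times> real \<times> real \<times> real \<times> real \<Rightarrow> real"
    where "f = (\<lambda>v. (fst (snd (snd v)) - fst (snd v) - 2 * fst (snd (snd (snd v))) - 2) / 2)"
  define H where "H = f -` \<nat>"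
  have "closed H"
    unfolding H_def f_def by (intro closed_vimage closed_Nats continuous_intros) auto
  moreover have "Z \<subseteq> H"
  proof
    fix v assume "v \<in> Z"
    then obtain l al be rh si where v: "v = (l, al, be, rh, si)" "(l, al, be, rh, si) \<in> Z"
      by (cases v) auto
    from assms[OF v(2)] obtain j :: nat where "be - al - 2 * rh = 2 + 2 * real j" ..
    then have "f v = real j" by (simp add: f_def v)
    then show "v \<in> H" by (simp add: H_def)
  qed
  ultimately have "closure Z \<subseteq> H" by (rule closure_minimal[rotated])
  moreover have "interior H = {}"
  proof (rule ccontr)
    assume "interior H \<noteq> {}"
    then obtain v where "v \<in> interior H" by blast
    then obtain e where e: "e > 0" "ball v e \<subseteq> H" by (auto simp: mem_interior)
    obtain l al be rh si where v: "v = (l, al, be, rh, si)" by (cases v) auto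
    \<comment> \<open>With s at most 1, adding it to \<open>be\<close> moves \<open>f\<close> by
      s/2, strictly between 0 and 1, so two natural numbers cannot both occur as values.\<close>
    define s where "s = min (e / 2) 1"
    have s: "0 < s" "s < e" "s \<le> 1" using e by (auto simp: s_def)
    define v' where "v' = (l, al, be + s, rh, si)"
    have "dist v v' = s"
      using s by (simp add: v v'_def dist_Pair_Pair dist_real_def)
    then have "v' \<in> ball v e" "v \<in> ball v e" using e s by simp_all
    then have "v' \<in> H" "v \<in> H" using e(2) by blast+
    then obtain m n where mn: "f v' = real m" "f v = real n"
      unfolding H_def Nats_def by auto
    have "f v' = f v + s / 2" by (simp add: f_def v v'_def field_simps)
    then have "real m - real n = s / 2" using mn by simp
    then have "real n < real m" "real m < real (n + 1)" using s by auto
    then have "n < m" "m < n + 1" by (simp_all only: of_nat_less_iff)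
    then show False by simp
  qed
  ultimately show ?thesis using interior_mono by blast
qed

theorem theorem4p6:
  fixes \<tau> :: complex and lam \<alpha> \<beta> \<rho> \<sigma> :: real
    and a b c d ta tb tc td :: complex
  assumes "Re \<tau> = 0" and "Im \<tau> > 0"
    and "\<alpha> > 0" and "\<beta> > 0" and "\<rho> \<ge> 3" and "\<sigma> \<ge> 3"
    and "a = 1 + \<rho> + \<sigma>" and "b = 1 - \<rho> + \<sigma>"
    and "c = 1 + \<alpha> + \<rho> - \<beta> - \<sigma>" and "d = 1 - \<alpha> - \<rho> - \<beta> - \<sigma>"
    and "ta = 1 - \<beta>" and "tb = 1 + \<beta> + 2 * \<sigma>"
    and "tc = 1 + \<alpha> + 2 * \<rho>" and "td = 1 - \<alpha>"
  shows
    "(\<forall>x. F_regular \<tau> lam \<alpha> \<beta> \<rho> \<sigma> x \<and>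
          qpoch_inf [qpow \<tau> (2 - d + x), qpow \<tau> (2 - d - x)] (qpow \<tau> 2) \<noteq> 0 \<and>
          (let u = qpow \<tau> (- 2 + ta + tb + tc + 2 * \<i> * lam); p = qpow \<tau> 2 in
             qpoch_inf [p * u / qpow \<tau> (a + x), p * u / qpow \<tau> (a - x),
                        p * u / qpow \<tau> (ta + 2 * \<i> * lam), p * u / qpow \<tau> (tb + 2 * \<i> * lam),
                        p * u / qpow \<tau> (tc + 2 * \<i> * lam)] p \<noteq> 0) \<longrightarrow>
          F_fun \<tau> lam \<alpha> \<beta> \<rho> \<sigma> x =
            C_const \<tau> lam \<alpha> \<beta> \<rho> \<sigma> *
            (qpoch_inf [qpow \<tau> (2 + a - td + 2 * \<i> * lam + x),
                        qpow \<tau> (2 + a - td + 2 * \<i> * lam - x)] (qpow \<tau> 2) /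
             qpoch_inf [qpow \<tau> (2 - d + x), qpow \<tau> (2 - d - x)] (qpow \<tau> 2)) *
            W87 (qpow \<tau> (- 2 + ta + tb + tc + 2 * \<i> * lam))
              (qpow \<tau> (a + x)) (qpow \<tau> (a - x)) (qpow \<tau> (ta + 2 * \<i> * lam))
              (qpow \<tau> (tb + 2 * \<i> * lam)) (qpow \<tau> (tc + 2 * \<i> * lam))
              (qpow \<tau> 2) (qpow \<tau> (2 - td - 2 * \<i> * lam))) \<and>
     interior (closure {(l, al, be, rh, si).
       (al :: real) > 0 \<and> (be :: real) > 0 \<and> (rh :: real) \<ge> 3 \<and> (si :: real) \<ge> 3 \<and>
       C_const \<tau> (of_real l) al be rh si = 0}) = {} \<and>
     (\<forall>x. F_fun \<tau> lam \<alpha> \<beta> \<rho> \<sigma> (x + 1 / \<tau>) = F_fun \<tau> lam \<alpha> \<beta> \<rho> \<sigma> x) \<and>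
     (\<forall>x. Re x = 0 \<and> qpow \<tau> (2 * x) \<noteq> 1 \<longrightarrow>
          AW_coeff \<tau> a b c d x *
            (F_fun \<tau> lam \<alpha> \<beta> \<rho> \<sigma> (x + 2) - F_fun \<tau> lam \<alpha> \<beta> \<rho> \<sigma> x) +
          AW_coeff \<tau> a b c d (- x) *
            (F_fun \<tau> lam \<alpha> \<beta> \<rho> \<sigma> (x - 2) - F_fun \<tau> lam \<alpha> \<beta> \<rho> \<sigma> x) =
          AW_eigenvalue \<tau> \<beta> lam * F_fun \<tau> lam \<alpha> \<beta> \<rho> \<sigma> x)"
proof -
  define A B R S L where "A = complex_of_real \<alpha>" and "B = complex_of_real \<beta>" and "R = complex_of_real \<rho>"
    and "S = complex_of_real \<sigma>" and "L = complex_of_real lam"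
  note H = assms(1,2)
  have im: "Im L = 0" "Im A = 0" "Im B = 0" "Im R = 0" "Im S = 0"
    by (simp_all add: A_def B_def R_def S_def L_def)
  have pos: "Re A > 0" "Re B > 0" "Re R \<ge> 3" "Re S \<ge> 3"
    using assms by (simp_all add: A_def B_def R_def S_def)
  have abcd: "a = 1 + R + S" "b = 1 - R + S" "c = 1 + A + R - B - S" "d = 1 - A - R - B - S"
    "ta = 1 - B" "tb = 1 + B + 2 * S" "tc = 1 + A + 2 * R" "td = 1 - A"
    using assms by (simp_all add: A_def B_def R_def S_def)
  have 1: "F_fun \<tau> L A B R S x =
            C_const \<tau> L A B R S *
            (qpoch_inf [qpow \<tau> (2 + a - td + 2 * \<i> * L + x),
                        qpow \<tau> (2 + a - td + 2 * \<i> * L - x)] (qpow \<tau> 2) /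
             qpoch_inf [qpow \<tau> (2 - d + x), qpow \<tau> (2 - d - x)] (qpow \<tau> 2)) *
            W87 (qpow \<tau> (- 2 + ta + tb + tc + 2 * \<i> * L))
              (qpow \<tau> (a + x)) (qpow \<tau> (a - x)) (qpow \<tau> (ta + 2 * \<i> * L))
              (qpow \<tau> (tb + 2 * \<i> * L)) (qpow \<tau> (tc + 2 * \<i> * L))
              (qpow \<tau> 2) (qpow \<tau> (2 - td - 2 * \<i> * L))"
    if reg: "F_regular \<tau> L A B R S x"
      and n: "let u = qpow \<tau> (- 2 + ta + tb + tc + 2 * \<i> * L); p = qpow \<tau> 2 in
             qpoch_inf [p * u / qpow \<tau> (a + x), p * u / qpow \<tau> (a - x),
                        p * u / qpow \<tau> (ta + 2 * \<i> * L), p * u / qpow \<tau> (tb + 2 * \<i> * L),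
                        p * u / qpow \<tau> (tc + 2 * \<i> * L)] p \<noteq> 0" for x
  proof -
    have e: "2 + a - td + 2 * \<i> * L + x = 2 + A + R + S + 2 * \<i> * L + x"
      "2 + a - td + 2 * \<i> * L - x = 2 + A + R + S + 2 * \<i> * L - x"
      "2 - d + x = 1 + A + R + B + S + x" "2 - d - x = 1 + A + R + B + S - x"
      "- 2 + ta + tb + tc + 2 * \<i> * L = 1 + A + 2 * R + 2 * S + 2 * \<i> * L"
      "2 - td - 2 * \<i> * L = 1 + A - 2 * \<i> * L"
      by (simp_all add: abcd)
    have e': "qpow \<tau> 2 * qpow \<tau> (1 + A + 2 * R + 2 * S + 2 * \<i> * L) / qpow \<tau> (1 + R + S + x) = qpow \<tau> (2 + A + R + S + 2 * \<i> * L - x)"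
      "qpow \<tau> 2 * qpow \<tau> (1 + A + 2 * R + 2 * S + 2 * \<i> * L) / qpow \<tau> (1 + R + S - x) = qpow \<tau> (2 + A + R + S + 2 * \<i> * L + x)"
      "qpow \<tau> 2 * qpow \<tau> (1 + A + 2 * R + 2 * S + 2 * \<i> * L) / qpow \<tau> (1 + B + 2 * S + 2 * \<i> * L) = qpow \<tau> (2 + A + 2 * R - B)"
      unfolding qpow_mult qpow_divide by (rule arg_cong[where f = "qpow \<tau>"], simp add: algebra_simps)+
    have "qinf (qpow \<tau> 2) (qpow \<tau> (2 + A + R + S + 2 * \<i> * L - x)) \<noteq> 0"
      "qinf (qpow \<tau> 2) (qpow \<tau> (2 + A + R + S + 2 * \<i> * L + x)) \<noteq> 0"
      "qinf (qpow \<tau> 2) (qpow \<tau> (2 + A + 2 * R - B)) \<noteq> 0"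
      using n unfolding Let_def e(5) qpoch_inf_conv unfolding abcd(1,6) by (simp_all add: e')
    from F_fun_W87[OF H im pos reg this] show ?thesis
      unfolding e qpoch_inf_conv unfolding abcd by simp
  qed
  let ?Z = "{(l, al, be, rh, si).
       (al :: real) > 0 \<and> (be :: real) > 0 \<and> (rh :: real) \<ge> 3 \<and> (si :: real) \<ge> 3 \<and>
       C_const \<tau> (of_real l) al be rh si = 0}"
  have 2: "interior (closure ?Z) = {}"
  proof (rule interior_closure_exceptional)
    fix l al be rh si :: real
    assume "(l, al, be, rh, si) \<in> ?Z"
    then have *: "al > 0" "be > 0" "rh \<ge> 3" "si \<ge> 3" "C_const \<tau> (of_real l) al be rh si = 0" by auto
    obtain j :: nat where "Re (complex_of_real be) - Re (complex_of_real al) - 2 * Re (complex_of_real rh) = 2 + 2 * real j"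
      by (rule C_const_eq_0D[OF H _ _ _ _ _ _ _ _ _ *(5)]) (use * in auto)
    then show "\<exists>j::nat. be - al - 2 * rh = 2 + 2 * real j" by auto
  qed
  have 3: "F_fun \<tau> L A B R S (x + 1 / \<tau>) = F_fun \<tau> L A B R S x" for x
    by (rule F_fun_periodic[OF H im pos])
  have 4: "AW_coeff \<tau> a b c d x * (F_fun \<tau> L A B R S (x + 2) - F_fun \<tau> L A B R S x) +
          AW_coeff \<tau> a b c d (- x) * (F_fun \<tau> L A B R S (x - 2) - F_fun \<tau> L A B R S x) =
          AW_eigenvalue \<tau> B L * F_fun \<tau> L A B R S x"
    if "Re x = 0" "qpow \<tau> (2 * x) \<noteq> 1" for x
    unfolding abcd by (rule F_fun_askey_wilson[OF H im pos that])
  show ?thesis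
    using 1 2 3 4 unfolding A_def B_def R_def S_def L_def by blast
qed

end
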